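(* Let $\alpha_1,\alpha_2,\gamma_1,\gamma_2,\Gamma$ be real constants and let $r>0$. For any $u_0\in\mathcal{A}(r)$ there exists $T>0$ such that the Cauchy problem $$\partial_t u=\alpha_1\partial_x^3u+i\alpha_2\partial_x^2u+i\gamma_1|u|^2u+\gamma_2\partial_x(|u|^2u)-i\Gamma u\,\partial_x(|u|^2),\quad x\in\mathbf{T},\qquad u(0,\cdot)=u_0,$$ has a unique solution $u\in C([-T,T];\mathcal{A}(r/2))$ on $(-T,T)$. Moreover, there is a constant $c>0$ independent of $r$ and $u_0$ such that (for $u_0\ne0$) $T$ can be chosen to satisfy $$T\ge c\,\min\{1,r\}\,\|u_0\|_{\mathcal{A}(r)}^{-2}.$$
   Context: Notation: $\mathbf{T}=\mathbf{R}/2\pi\mathbf{Z}$; functions are complex-valued; $\hat f(k)=\frac1{\sqrt{2\pi}}\int_{\mathbf{T}}e^{-ikx}f(x)\,dx$ for $k\in\mathbf{Z}$. For $r>0$, $\mathcal{A}(r)$ is the Banach space $$\mathcal{A}(r)=\{f\in L^2(\mathbf{T}):\ \|f\|_{\mathcal{A}(r)}:=\|e^{r|k|}\hat f(k)\|_{\ell^1(\mathbf{Z})}<\infty\}.$$ Notion of solution: Let $T>0$, $s\ge0$, $u_0\in H^s(\mathbf{T})$. A function $u$ is a solution of the Cauchy problem on $[0,T)$ if $u\in L^\infty_{loc}([0,T);H^s(\mathbf{T}))\cap L^3_{loc}([0,T)\times\mathbf{T})$, $\partial_x(|u|^2)\in L^1_{loc}([0,T);H^{-s}(\mathbf{T}))$,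 and for every $\phi\in C_0^\infty([0,T)\times\mathbf{T})$, $$-\int_0^T\!\!\int_{\mathbf{T}}u\,\partial_t\phi\,dx\,dt-\int_{\mathbf{T}}u_0\phi(0,\cdot)\,dx=\int_0^T\!\!\int_{\mathbf{T}}\big[u(-\alpha_1\partial_x^3\phi+i\alpha_2\partial_x^2\phi)+|u|^2u(i\gamma_1\phi-\gamma_2\partial_x\phi)\big]dx\,dt-i\Gamma\int_0^T\langle\partial_x(|u|^2)(t),u(t)\phi(t)\rangle_{H^{-s},H^s}\,dt .$$ A solution on $(-T,0]$ is defined in a similar manner (with test functions in $C_0^\infty((-T,0]\times\mathbf{T})$, time integrals over $(-T,0)$, and the term $-\int_{\mathbf{T}}u_0\phi(0,\cdot)\,dx$ replaced by $+\int_{\mathbf{T}}u_0\phi(0,\cdot)\,dx$). A solution on $(-T,T)$ is a function whose restrictions to $[0,T)$ and $(-T,0]$ are solutions there with the same $u_0$. *)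

theory Defs
  imports "HOL-Analysis.Analysis"
begin

text \<open>
  Functions on the torus \<open>T = R / 2 pi Z\<close> are \<open>2 pi\<close>-periodic functions on the real line, integrated
  over \<open>{0..2 * pi}\<close>. Elements of \<open>L^2(T)\<close> and its subspaces are Borel representatives, and equality
  in these spaces is \<open>torus_ae_eq\<close>. Functions of time and space take time as the first argument.
\<close>

definition torus :: "real set" where
  "torus = {0..2 * pi}"

definition torus_periodic :: "(real \<Rightarrow> 'a) \<Rightarrow> bool" where
  "torus_periodic f \<longleftrightarrow> (\<forall>x. f (x + 2 * pi) = f x)"

definition torus_ae_eq :: "(real \<Rightarrow> complex) \<Rightarrow> (real \<Rightarrow> complex) \<Rightarrow> bool" where
  "torus_ae_eq f g \<longleftrightarrow> (AE x in lborel. x \<in> torus \<longrightarrow> f x = g x)"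

definition L2_torus :: "(real \<Rightarrow> complex) set" where
  "L2_torus = {f. torus_periodic f \<and> f \<in> borel_measurable borel \<and>
     set_integrable lborel torus (\<lambda>x. (cmod (f x))\<^sup>2)}"

definition fourier :: "(real \<Rightarrow> complex) \<Rightarrow> int \<Rightarrow> complex" where
  "fourier f k = complex_of_real (1 / sqrt (2 * pi)) *
     (LINT x:torus|lborel. exp (- \<i> * of_int k * of_real x) * f x)"


section \<open>Analytic spaces\<close>

definition A_space :: "real \<Rightarrow> (real \<Rightarrow> complex) set" where
  "A_space r = {f \<in> L2_torus.
     (\<lambda>k::int. exp (r * \<bar>real_of_int k\<bar>) * cmod (fourier f k)) summable_on UNIV}"

definition A_norm :: "real \<Rightarrow> (real \<Rightarrow> complex) \<Rightarrow> real" where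
  "A_norm r f = (\<Sum>\<^sub>\<infinity>k::int. exp (r * \<bar>real_of_int k\<bar>) * cmod (fourier f k))"

definition continuous_into_A :: "real set \<Rightarrow> real \<Rightarrow> (real \<Rightarrow> real \<Rightarrow> complex) \<Rightarrow> bool" where
  "continuous_into_A J r u \<longleftrightarrow> (\<forall>t\<in>J. u t \<in> A_space r) \<and>
     (\<forall>t\<in>J. ((\<lambda>\<tau>. A_norm r (\<lambda>x. u \<tau> x - u t x)) \<longlongrightarrow> 0) (at t within J))"


section \<open>Sobolev spaces and distributions on the torus\<close>

definition sobolev_summable :: "real \<Rightarrow> (int \<Rightarrow> complex) \<Rightarrow> bool" where
  "sobolev_summable s a \<longleftrightarrow>
     (\<lambda>k. (1 + (real_of_int k)\<^sup>2) powr s * (cmod (a k))\<^sup>2) summable_on UNIV"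

definition sobolev_norm :: "real \<Rightarrow> (int \<Rightarrow> complex) \<Rightarrow> real" where
  "sobolev_norm s a = sqrt (\<Sum>\<^sub>\<infinity>k. (1 + (real_of_int k)\<^sup>2) powr s * (cmod (a k))\<^sup>2)"

text \<open>Only used for \<open>s \<ge> 0\<close>, where \<open>H^s(T)\<close> is contained in \<open>L^2(T)\<close>.\<close>

definition H_space :: "real \<Rightarrow> (real \<Rightarrow> complex) set" where
  "H_space s = {f \<in> L2_torus. sobolev_summable s (fourier f)}"

text \<open>Distributions on the torus are functionals on smooth periodic functions. They only occur below
  as derivatives of integrable functions, so linearity and continuity are automatic. A distribution
  \<open>F\<close> lies in \<open>H^s(T)\<close>, for \<open>s\<close> of either sign, iff \<open>sobolev_summable s (distr_fourier F)\<close>.\<close>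

type_synonym distr = "(real \<Rightarrow> complex) \<Rightarrow> complex"

definition distr_of_fun :: "(real \<Rightarrow> complex) \<Rightarrow> distr" where
  "distr_of_fun g = (\<lambda>\<psi>. LINT x:torus|lborel. g x * \<psi> x)"

definition distr_deriv :: "distr \<Rightarrow> distr" where
  "distr_deriv F = (\<lambda>\<psi>. - F (\<lambda>x. vector_derivative \<psi> (at x)))"

definition distr_fourier :: "distr \<Rightarrow> int \<Rightarrow> complex" where
  "distr_fourier F k = complex_of_real (1 / sqrt (2 * pi)) *
     F (\<lambda>x. exp (- \<i> * of_int k * of_real x))"

text \<open>The pairing of \<open>H^{-s}\<close> with \<open>H^s\<close> is the bilinear one (no complex conjugation), extending
  \<open>\<integral> g f dx\<close>; with the normalization of \<open>fourier\<close> this is Parseval's formula.\<close>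

definition sobolev_pairing :: "distr \<Rightarrow> (real \<Rightarrow> complex) \<Rightarrow> complex" where
  "sobolev_pairing F f = (\<Sum>\<^sub>\<infinity>k::int. distr_fourier F k * fourier f (- k))"

definition dx_abs_sq :: "(real \<Rightarrow> complex) \<Rightarrow> distr" where
  "dx_abs_sq f = distr_deriv (distr_of_fun (\<lambda>x. complex_of_real ((cmod (f x))\<^sup>2)))"


section \<open>Test functions\<close>

text \<open>The time interval \<open>I\<close> is half-open and contains one of its end points; time derivatives at that
  end point are one-sided.\<close>

definition d_t :: "real set \<Rightarrow> (real \<Rightarrow> real \<Rightarrow> complex) \<Rightarrow> real \<Rightarrow> real \<Rightarrow> complex" where
  "d_t I \<phi> = (\<lambda>t x. vector_derivative (\<lambda>\<tau>. \<phi> \<tau> x) (at t within I))"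

definition d_x :: "(real \<Rightarrow> real \<Rightarrow> complex) \<Rightarrow> real \<Rightarrow> real \<Rightarrow> complex" where
  "d_x \<phi> = (\<lambda>t x. vector_derivative (\<phi> t) (at x))"

primrec C_k :: "nat \<Rightarrow> real set \<Rightarrow> (real \<Rightarrow> real \<Rightarrow> complex) \<Rightarrow> bool" where
  "C_k 0 I \<phi> \<longleftrightarrow> continuous_on (I \<times> UNIV) (\<lambda>(t, x). \<phi> t x)"
| "C_k (Suc n) I \<phi> \<longleftrightarrow>
     continuous_on (I \<times> UNIV) (\<lambda>(t, x). \<phi> t x) \<and>
     (\<forall>t\<in>I. \<forall>x. (\<lambda>\<tau>. \<phi> \<tau> x) differentiable (at t within I) \<and> \<phi> t differentiable (at x)) \<and>
     C_k n I (d_t I \<phi>) \<and> C_k n I (d_x \<phi>)"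

text \<open>Since the torus is compact, compact support in \<open>I \<times> T\<close> only restricts the time variable.\<close>

definition test_functions :: "real set \<Rightarrow> (real \<Rightarrow> real \<Rightarrow> complex) set" where
  "test_functions I = {\<phi>. (\<forall>t\<in>I. torus_periodic (\<phi> t)) \<and> (\<forall>n. C_k n I \<phi>) \<and>
     (\<exists>K. compact K \<and> K \<subseteq> I \<and> (\<forall>t\<in>I - K. \<forall>x. \<phi> t x = 0))}"


section \<open>Solutions\<close>

text \<open>For jointly measurable \<open>u\<close>, the map \<open>t \<mapsto> u(t)\<close> into the separable space \<open>H^s\<close>, and likewise
  \<open>t \<mapsto> \<partial>_x(|u(t)|^2)\<close> into \<open>H^{-s}\<close>, is automatically strongly measurable (by Fubini and Pettis), so
  \<open>Linfty_loc_H\<close> and \<open>L1_loc_H\<close> do not require it separately.\<close>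

definition Linfty_loc_H :: "real set \<Rightarrow> real \<Rightarrow> (real \<Rightarrow> real \<Rightarrow> complex) \<Rightarrow> bool" where
  "Linfty_loc_H I s u \<longleftrightarrow> (\<forall>K. compact K \<and> K \<subseteq> I \<longrightarrow>
     (\<exists>C. AE t in lborel. t \<in> K \<longrightarrow> u t \<in> H_space s \<and> sobolev_norm s (fourier (u t)) \<le> C))"

definition L3_loc :: "real set \<Rightarrow> (real \<Rightarrow> real \<Rightarrow> complex) \<Rightarrow> bool" where
  "L3_loc I u \<longleftrightarrow> (\<forall>K. compact K \<and> K \<subseteq> I \<longrightarrow>
     set_integrable lborel (K \<times> torus) (\<lambda>(t, x). (cmod (u t x)) ^ 3))"

definition L1_loc_H :: "real set \<Rightarrow> real \<Rightarrow> (real \<Rightarrow> distr) \<Rightarrow> bool" where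
  "L1_loc_H I s F \<longleftrightarrow> (\<forall>K. compact K \<and> K \<subseteq> I \<longrightarrow>
     (AE t in lborel. t \<in> K \<longrightarrow> sobolev_summable s (distr_fourier (F t))) \<and>
     set_integrable lborel K (\<lambda>t. sobolev_norm s (distr_fourier (F t))))"

text \<open>\<open>\<sigma>\<close> is the sign with which the initial value enters: \<open>1\<close> on \<open>[0,T)\<close> and \<open>-1\<close> on \<open>(-T,0]\<close>.\<close>

definition weak_equation ::
  "real \<Rightarrow> real \<Rightarrow> real \<Rightarrow> real \<Rightarrow> real \<Rightarrow> real set \<Rightarrow> real \<Rightarrow>
   (real \<Rightarrow> complex) \<Rightarrow> (real \<Rightarrow> real \<Rightarrow> complex) \<Rightarrow> (real \<Rightarrow> real \<Rightarrow> complex) \<Rightarrow> bool" where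
  "weak_equation \<alpha>1 \<alpha>2 \<gamma>1 \<gamma>2 \<Gamma> I \<sigma> u0 u \<phi> \<longleftrightarrow>
     - (LINT t:I|lborel. (LINT x:torus|lborel. u t x * d_t I \<phi> t x))
     - of_real \<sigma> * (LINT x:torus|lborel. u0 x * \<phi> 0 x)
     = (LINT t:I|lborel. (LINT x:torus|lborel.
          u t x * (- of_real \<alpha>1 * d_x (d_x (d_x \<phi>)) t x + \<i> * of_real \<alpha>2 * d_x (d_x \<phi>) t x)
          + of_real ((cmod (u t x))\<^sup>2) * u t x *
              (\<i> * of_real \<gamma>1 * \<phi> t x - of_real \<gamma>2 * d_x \<phi> t x)))
       - \<i> * of_real \<Gamma> *
           (LINT t:I|lborel. sobolev_pairing (dx_abs_sq (u t)) (\<lambda>x. u t x * \<phi> t x))"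

definition solution_on ::
  "real \<Rightarrow> real \<Rightarrow> real \<Rightarrow> real \<Rightarrow> real \<Rightarrow> real set \<Rightarrow> real \<Rightarrow> real \<Rightarrow>
   (real \<Rightarrow> complex) \<Rightarrow> (real \<Rightarrow> real \<Rightarrow> complex) \<Rightarrow> bool" where
  "solution_on \<alpha>1 \<alpha>2 \<gamma>1 \<gamma>2 \<Gamma> I \<sigma> s u0 u \<longleftrightarrow>
     u0 \<in> H_space s \<and>
     (\<forall>t\<in>I. torus_periodic (u t)) \<and>
     set_borel_measurable borel (I \<times> UNIV) (\<lambda>(t, x). u t x) \<and>
     Linfty_loc_H I s u \<and> L3_loc I u \<and>
     L1_loc_H I (- s) (\<lambda>t. dx_abs_sq (u t)) \<and>
     (\<forall>\<phi>\<in>test_functions I. weak_equation \<alpha>1 \<alpha>2 \<gamma>1 \<gamma>2 \<Gamma> I \<sigma> u0 u \<phi>)"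

definition solution ::
  "real \<Rightarrow> real \<Rightarrow> real \<Rightarrow> real \<Rightarrow> real \<Rightarrow> real \<Rightarrow> real \<Rightarrow>
   (real \<Rightarrow> complex) \<Rightarrow> (real \<Rightarrow> real \<Rightarrow> complex) \<Rightarrow> bool" where
  "solution \<alpha>1 \<alpha>2 \<gamma>1 \<gamma>2 \<Gamma> T s u0 u \<longleftrightarrow>
     solution_on \<alpha>1 \<alpha>2 \<gamma>1 \<gamma>2 \<Gamma> {0..<T} 1 s u0 u \<and>
     solution_on \<alpha>1 \<alpha>2 \<gamma>1 \<gamma>2 \<Gamma> {-T<..0} (- 1) s u0 u"

end

theory Submission
  imports Defs
begin

text \<open>
  Write \<open>u(t) = \<Sum> a_k(t) e^{ikx}\<close> and remove the dispersive part by \<open>z_k = e^{i t omega_k} a_k\<close>. The modes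
  satisfy \<open>z_k' = \<Sum> M(t,k,i,j) z_i z_j cnj z_l\<close>, summed over \<open>i + j - l = k\<close>, with a multiplier of size
  \<open>O(1 + n)\<close> for \<open>n = |i| + |j| + |l|\<close>. Measured with the shrinking weight \<open>e^{(r - lt)|k|}\<close>, the time integral
  gains a factor \<open>1 / (l n)\<close>, which pays for the lost derivative: the Duhamel map is dominated by
  \<open>b + q B * B * B\<close> with \<open>q = O(T + 1/l)\<close>. The scalar iteration \<open>B \<mapsto> b + q B * B * B\<close> increases to a
  summable limit as soon as \<open>8 q |b|^2 \<le> 1\<close>, and the Picard differences are dominated by its differences;
  with \<open>l = r / (2T)\<close> this is the stated lower bound for \<open>T\<close>. Uniqueness in \<open>A(r/2)\<close> follows from the same
  estimate on short time steps, starting from a smaller radius. A weak solution is reduced to its modes by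
  testing with \<open>\<eta>(t) e^{-ikx}\<close>, where \<open>\<eta>'\<close> is a smooth bump.
\<close>

section \<open>Dominated unordered sums\<close>

text \<open>The obstacle is the derivative in the cubic term: at a fixed radius of analyticity
  nothing in these estimates recovers the factor \<open>n\<close>. The gain from a shrinking radius
  appears only after integrating in time at fixed frequencies. Majorants therefore take the supremum
  over time inside the sum over modes: one time-independent summable sequence bounds a whole curve.
  The complex problem can then be compared mode by mode with a monotone scalar recursion, and no
  Banach space of curves has to be set up. The number 8 makes a total mass of twice the initial one
  reproduce itself. In the uniqueness proof both solutions obey, at every time, a bound with the
  same radius. Each short step may therefore spend radius afresh, and its length depends only on
  that bound; equality of the modes, once reached, holds for every radius. Exponential decay of the
  coefficients beats every Sobolev weight, so one curve is a solution for all \<open>s\<close> at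
  once.\<close>

lemma infsum_tendsto_dominated:
  fixes f :: "'i \<Rightarrow> 'a \<Rightarrow> 'b::banach"
  assumes lim: "\<And>i. (f i \<longlongrightarrow> g i) F"
    and bound: "\<forall>\<^sub>F x in F. \<forall>i. norm (f i x) \<le> m i"
    and m: "m summable_on UNIV"
  shows "((\<lambda>x. \<Sum>\<^sub>\<infinity>i. f i x) \<longlongrightarrow> (\<Sum>\<^sub>\<infinity>i. g i)) F"
proof (cases "F = bot")
  case False
  define S where "S = {x. \<forall>i. norm (f i x) \<le> m i}"
  \<comment> \<open>The limit values are adjoined as the extra point \<open>None\<close>. The M-test
    over this enlarged set then yields one finite \<open>X\<close> that truncates the sums at all
    \<open>x\<close> and the limit sum equally well, and only a finite sum has to pass to the
    limit.\<close>
  define f' where "f' i y = (case y of None \<Rightarrow> g i | Some x \<Rightarrow> f i x)" for i y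
  have g: "norm (g i) \<le> m i" for i
    using bound by (intro tendsto_upperbound[OF tendsto_norm[OF lim]] False) (auto elim: eventually_mono)
  have u: "uniform_limit (insert None (Some ` S)) (\<lambda>X y. \<Sum>i\<in>X. f' i y) (\<lambda>y. \<Sum>\<^sub>\<infinity>i. f' i y)
      (finite_subsets_at_top UNIV)"
    by (rule Weierstrass_m_test_general[OF _ m]) (auto simp: f'_def S_def g split: option.split)
  show ?thesis
  proof (rule tendstoI)
    fix e :: real assume "e > 0"
    then have "\<forall>\<^sub>F X in finite_subsets_at_top UNIV. \<forall>y\<in>insert None (Some ` S).
        dist (\<Sum>i\<in>X. f' i y) (\<Sum>\<^sub>\<infinity>i. f' i y) < e / 3"
      using u[unfolded uniform_limit_iff, rule_format, of "e / 3"] by simp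
    then have "\<exists>X. \<forall>y\<in>insert None (Some ` S). dist (\<Sum>i\<in>X. f' i y) (\<Sum>\<^sub>\<infinity>i. f' i y) < e / 3"
      using finite_subsets_at_top_neq_bot eventually_happens' by blast
    then obtain X where X: "dist (\<Sum>i\<in>X. g i) (\<Sum>\<^sub>\<infinity>i. g i) < e / 3"
      "\<And>x. x \<in> S \<Longrightarrow> dist (\<Sum>i\<in>X. f i x) (\<Sum>\<^sub>\<infinity>i. f i x) < e / 3"
      by (auto simp: f'_def)
    have "((\<lambda>x. \<Sum>i\<in>X. f i x) \<longlongrightarrow> (\<Sum>i\<in>X. g i)) F"
      by (intro tendsto_sum lim)
    then have "\<forall>\<^sub>F x in F. dist (\<Sum>i\<in>X. f i x) (\<Sum>i\<in>X. g i) < e / 3"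
      by (rule tendstoD) (use \<open>e > 0\<close> in simp)
    with bound show "\<forall>\<^sub>F x in F. dist (\<Sum>\<^sub>\<infinity>i. f i x) (\<Sum>\<^sub>\<infinity>i. g i) < e"
    proof eventually_elim
      case (elim x)
      then have "x \<in> S" by (simp add: S_def)
      from X(2)[OF this] X(1) elim(2) show ?case
        by (metis dist_commute dist_triangle_third)
    qed
  qed
qed auto

lemma infsum_continuous_on_dominated:
  fixes f :: "'i \<Rightarrow> 'a::topological_space \<Rightarrow> 'b::banach"
  assumes "\<And>i. continuous_on S (f i)" "\<And>i x. x \<in> S \<Longrightarrow> norm (f i x) \<le> m i" "m summable_on UNIV"
  shows "continuous_on S (\<lambda>x. \<Sum>\<^sub>\<infinity>i. f i x)"
  unfolding continuous_on_def
proof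
  fix x assume "x \<in> S"
  show "((\<lambda>x. \<Sum>\<^sub>\<infinity>i. f i x) \<longlongrightarrow> (\<Sum>\<^sub>\<infinity>i. f i x)) (at x within S)"
  proof (rule infsum_tendsto_dominated[OF _ _ assms(3)])
    show "(f i \<longlongrightarrow> f i x) (at x within S)" for i
      using assms(1) \<open>x \<in> S\<close> unfolding continuous_on_def by blast
    show "\<forall>\<^sub>F y in at x within S. \<forall>i. norm (f i y) \<le> m i"
      unfolding eventually_at_filter by (rule always_eventually) (use assms(2) in blast)
  qed
qed

lemma summable_on_dominated:
  fixes f :: "'i \<Rightarrow> 'b::banach"
  assumes "m summable_on S" "\<And>i. i \<in> S \<Longrightarrow> norm (f i) \<le> m i"
  shows "f summable_on S" "norm (\<Sum>\<^sub>\<infinity>i\<in>S. f i) \<le> (\<Sum>\<^sub>\<infinity>i\<in>S. m i)"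
proof -
  show s: "f summable_on S"
    by (rule abs_summable_summable, rule summable_on_comparison_test[OF assms(1)]) (use assms(2) in auto)
  show "norm (\<Sum>\<^sub>\<infinity>i\<in>S. f i) \<le> (\<Sum>\<^sub>\<infinity>i\<in>S. m i)"
    by (rule norm_infsum_le[OF has_sum_infsum[OF s] has_sum_infsum[OF assms(1)] assms(2)])
qed

text \<open>By the M-test the finite partial sums converge uniformly on the compact interval, and
  the integral commutes with uniform limits along the filter of finite subsets; the index type is
  arbitrary.\<close>

lemma infsum_has_integral_dominated:
  fixes f :: "'i \<Rightarrow> real \<Rightarrow> 'b::banach"
  assumes c: "\<And>i. continuous_on {a..b} (f i)" 
    and le: "\<And>i x. x \<in> {a..b} \<Longrightarrow> norm (f i x) \<le> m i" and m: "m summable_on UNIV"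
  shows "((\<lambda>i. integral {a..b} (f i)) has_sum integral {a..b} (\<lambda>x. \<Sum>\<^sub>\<infinity>i. f i x)) UNIV"
proof -
  have u: "uniform_limit {a..b} (\<lambda>X x. \<Sum>i\<in>X. f i x) (\<lambda>x. \<Sum>\<^sub>\<infinity>i. f i x) (finite_subsets_at_top UNIV)"
    by (rule Weierstrass_m_test_general[OF _ m]) (use le in auto)
  obtain I J where I: "\<And>X. ((\<lambda>x. \<Sum>i\<in>X. f i x) has_integral I X) {a..b}"
    and J: "((\<lambda>x. \<Sum>\<^sub>\<infinity>i. f i x) has_integral J) {a..b}"
    and IJ: "(I \<longlongrightarrow> J) (finite_subsets_at_top UNIV)"
    by (rule uniform_limit_integral[OF u]) (auto intro!: continuous_on_sum c)
  have "I X = (\<Sum>i\<in>X. integral {a..b} (f i))" if "finite X" for X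
  proof -
    have "((\<lambda>x. \<Sum>i\<in>X. f i x) has_integral (\<Sum>i\<in>X. integral {a..b} (f i))) {a..b}"
      using that by (intro has_integral_sum) (auto intro!: integrable_integral integrable_continuous_real c)
    with I show ?thesis using has_integral_unique by blast
  qed
  then have "\<forall>\<^sub>F X in finite_subsets_at_top UNIV. I X = (\<Sum>i\<in>X. integral {a..b} (f i))"
    by (intro eventually_finite_subsets_at_top_weakI) auto
  with IJ have "((\<lambda>X. \<Sum>i\<in>X. integral {a..b} (f i)) \<longlongrightarrow> J) (finite_subsets_at_top UNIV)"
    using tendsto_cong by force
  then show ?thesis
    using J by (auto simp: has_sum_def integral_unique)
qed

lemma has_sum_product_nonneg:
  fixes f :: "'i \<Rightarrow> real" and g :: "'j \<Rightarrow> real"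
  assumes "(f has_sum a) UNIV" "(g has_sum b) UNIV" "\<And>x. 0 \<le> f x" "\<And>x. 0 \<le> g x"
  shows "((\<lambda>(x, y). f x * g y) has_sum a * b) UNIV"
proof -
  have s: "((\<lambda>y. (\<lambda>(x, y). f x * g y) (x, y)) has_sum f x * b) UNIV" for x
    using has_sum_cmult_right[OF assms(2)] by simp
  have t: "((\<lambda>x. f x * b) has_sum a * b) UNIV"
    by (rule has_sum_cmult_left[OF assms(1)])
  have "(\<lambda>(x, y). f x * g y) summable_on (SIGMA x:UNIV. UNIV)"
    using assms(3,4) by (intro summable_on_SigmaI[OF s] has_sum_imp_summable[OF t]) auto
  from has_sum_SigmaI[OF s t this] show ?thesis by simp
qed

section \<open>Trilinear convolutions\<close>

text \<open>If \<open>A\<close>, \<open>B\<close>, \<open>C\<close> are the Fourier coefficients of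
  f, g, h, this is coefficient \<open>k\<close> of the product of f, g and the conjugate of h: the
  third frequency \<open>l = i + j - k\<close> solves \<open>i + j - l = k\<close>.\<close>

definition conv3 :: "(int \<Rightarrow> real) \<Rightarrow> (int \<Rightarrow> real) \<Rightarrow> (int \<Rightarrow> real) \<Rightarrow> int \<Rightarrow> real" where
  "conv3 A B C k = (\<Sum>\<^sub>\<infinity>(i, j). A i * B j * C (i + j - k))"

text \<open>The bijection between \<open>(k, i, j)\<close> and \<open>((i, j), l)\<close> turns the
  sum over all outputs \<open>k\<close> into a product of three sums. This is Young's inequality in
  the space of summable sequences, with equality because everything is nonnegative.\<close>

lemma conv3_has_sum:
  assumes A: "(A has_sum a) UNIV" "\<And>k. 0 \<le> A k" and B: "(B has_sum b) UNIV" "\<And>k. 0 \<le> B k"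
    and C: "(C has_sum c) UNIV" "\<And>k. 0 \<le> C k"
  shows conv3_summable: "(\<lambda>(i, j). A i * B j * C (i + j - k)) summable_on UNIV"
    and "(conv3 A B C has_sum a * b * c) UNIV"
    and conv3_nonneg: "0 \<le> conv3 A B C k"
proof -
  have "((\<lambda>(ij, l). (case ij of (i, j) \<Rightarrow> A i * B j) * C l) has_sum a * b * c) UNIV"
    using assms by (intro has_sum_product_nonneg) auto
  moreover have "bij (\<lambda>(k, i, j). ((i, j), i + j - k :: int))"
    by (rule bij_betw_byWitness[where f' = "\<lambda>((i, j), l). (i + j - l, i, j)"]) auto
  ultimately have s: "((\<lambda>(k, i, j). A i * B j * C (i + j - k)) has_sum a * b * c) UNIV"
    by (subst (asm) has_sum_reindex_bij_betw[symmetric, of _ UNIV]) (auto simp: case_prod_unfold)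
  then have ss: "(\<lambda>(k, i, j). A i * B j * C (i + j - k)) summable_on (SIGMA k:UNIV. UNIV)"
    using has_sum_imp_summable by fastforce
  from summable_on_SigmaD1[OF this] have t: "(\<lambda>ij. case ij of (i, j) \<Rightarrow> A i * B j * C (i + j - k)) summable_on UNIV" for k
    using assms by (force simp: case_prod_unfold)
  then show "(\<lambda>(i, j). A i * B j * C (i + j - k)) summable_on UNIV" .
  show "(conv3 A B C has_sum a * b * c) UNIV"
    using has_sum_SigmaD[of "\<lambda>(k, i, j). A i * B j * C (i + j - k)" UNIV "\<lambda>_. UNIV" "a * b * c" "conv3 A B C"]
      has_sum_infsum[OF t] s
    by (simp add: conv3_def)
  show "0 \<le> conv3 A B C k"
    unfolding conv3_def using assms by (intro infsum_nonneg) auto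
qed

section \<open>Trilinear forms with a multiplier of linear growth\<close>

definition trilin ::
  "(int \<Rightarrow> int \<Rightarrow> int \<Rightarrow> complex) \<Rightarrow> (int \<Rightarrow> complex) \<Rightarrow> (int \<Rightarrow> complex) \<Rightarrow> (int \<Rightarrow> complex) \<Rightarrow> int \<Rightarrow> complex" where
  "trilin m a b c k = (\<Sum>\<^sub>\<infinity>(i, j). m k i j * a i * b j * cnj (c (i + j - k)))"

definition freq :: "int \<Rightarrow> int \<Rightarrow> int \<Rightarrow> real" where
  "freq k i j = \<bar>real_of_int i\<bar> + \<bar>real_of_int j\<bar> + \<bar>real_of_int (i + j - k)\<bar>"

lemma abs_le_freq: "\<bar>real_of_int k\<bar> \<le> freq k i j"
  by (simp add: freq_def)

lemma freq_nonneg: "0 \<le> freq k i j"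
  by (simp add: freq_def)

lemma mult_exp_neg_le: "n * exp (- (e * n)) \<le> 1 / e" if "e > 0" for e n :: real
proof -
  have "e * n \<le> exp (e * n)" using exp_ge_add_one_self[of "e * n"] by linarith
  then have "e * n * exp (- (e * n)) \<le> exp (e * n) * exp (- (e * n))"
    by (intro mult_right_mono) auto
  then show ?thesis using that by (simp add: exp_minus field_simps)
qed

text \<open>Linear growth of the multiplier in \<open>freq\<close> is the loss of one derivative.
  The dependence on the time \<open>s\<close> makes room for the phases that appear when the
  dispersive part is removed.\<close>

locale symbol =
  fixes M :: "real \<Rightarrow> int \<Rightarrow> int \<Rightarrow> int \<Rightarrow> complex" and g1 g2 T :: real
  assumes cont: "\<And>k i j. continuous_on {0..T} (\<lambda>s. M s k i j)"
    and bound: "\<And>s k i j. s \<in> {0..T} \<Longrightarrow> cmod (M s k i j) \<le> g1 + g2 * freq k i j"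
    and g: "0 \<le> g1" "0 \<le> g2" and T: "0 \<le> T"
begin

text \<open>\<open>A\<close> does not depend on the time \<open>s\<close>, so its sum bounds the
  weighted supremum over time taken inside the sum over \<open>k\<close>. The order matters because
  time integration gains something only at fixed frequencies.\<close>

definition majorised :: "real \<Rightarrow> real \<Rightarrow> (int \<Rightarrow> real) \<Rightarrow> (real \<Rightarrow> int \<Rightarrow> complex) \<Rightarrow> bool" where
  "majorised r l A a \<longleftrightarrow> (\<forall>k. 0 \<le> A k) \<and> A summable_on UNIV \<and> (\<forall>k. continuous_on {0..T} (\<lambda>s. a s k)) \<and>
     (\<forall>s\<in>{0..T}. \<forall>k. cmod (a s k) \<le> exp (- ((r - l * s) * \<bar>real_of_int k\<bar>)) * A k)"

lemma majorised_nonneg: "majorised r l A a \<Longrightarrow> 0 \<le> A k"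
  and majorised_summable: "majorised r l A a \<Longrightarrow> A summable_on UNIV"
  and majorised_continuous: "majorised r l A a \<Longrightarrow> continuous_on {0..T} (\<lambda>s. a s k)"
  and majorised_bound: "majorised r l A a \<Longrightarrow> s \<in> {0..T} \<Longrightarrow> cmod (a s k) \<le> exp (- ((r - l * s) * \<bar>real_of_int k\<bar>)) * A k"
  by (auto simp: majorised_def)

lemma majorised_diff:
  assumes "majorised r l A a" "majorised r l B b"
    "\<And>s k. s \<in> {0..T} \<Longrightarrow> cmod (a s k - b s k) \<le> exp (- ((r - l * s) * \<bar>real_of_int k\<bar>)) * D k"
    "\<And>k. 0 \<le> D k" "D summable_on UNIV"
  shows "majorised r l D (\<lambda>s k. a s k - b s k)"
  using assms unfolding majorised_def by (auto intro!: continuous_intros)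

text \<open>The integral in time gains the reciprocal of \<open>l\<close>, which compensates the loss of one derivative
  in \<open>M\<close>: integrating \<open>n exp (- (r - l s) n)\<close> up to \<open>t\<close> gives at most \<open>exp (- (r - l t) n) / l\<close>.\<close>

context
  fixes r l :: real
  assumes l: "0 < l" and r: "0 < r - l * T"
begin

lemma trilin_summand_bound:
  assumes a: "majorised r l A a" and b: "majorised r l B b" and c: "majorised r l C c" and s: "s \<in> {0..T}"
  shows "cmod (M s k i j * a s i * b s j * cnj (c s (i + j - k))) \<le>
     ((g1 + g2 * freq k i j) * exp (- ((r - l * s) * freq k i j))) * (A i * B j * C (i + j - k))"
proof -
  have "cmod (M s k i j * a s i * b s j * cnj (c s (i + j - k)))
     = cmod (M s k i j) * (cmod (a s i) * cmod (b s j) * cmod (c s (i + j - k)))"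
    by (simp add: norm_mult)
  also have "\<dots> \<le> (g1 + g2 * freq k i j) * ((exp (- ((r - l * s) * \<bar>real_of_int i\<bar>)) * A i) *
      (exp (- ((r - l * s) * \<bar>real_of_int j\<bar>)) * B j) *
      (exp (- ((r - l * s) * \<bar>real_of_int (i + j - k)\<bar>)) * C (i + j - k)))"
    using g freq_nonneg[of k i j]
    by (intro mult_mono bound[OF s] majorised_bound[OF a s] majorised_bound[OF b s] majorised_bound[OF c s]
          mult_nonneg_nonneg add_nonneg_nonneg norm_ge_zero exp_ge_zero majorised_nonneg[OF a] majorised_nonneg[OF b])
  also have "\<dots> = ((g1 + g2 * freq k i j) * exp (- ((r - l * s) * freq k i j))) * (A i * B j * C (i + j - k))"
    unfolding freq_def by (simp only: distrib_left minus_add_distrib exp_add) (simp add: mult_ac)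
  finally show ?thesis .
qed

text \<open>A bound uniform in \<open>s\<close>: the radius left at time \<open>T\<close> absorbs
  the factor \<open>freq\<close> by \<open>mult_exp_neg_le\<close>. It serves summability and
  continuity only; its constant does not enter the smallness conditions on \<open>T\<close>.\<close>

lemma trilin_summand_bound':
  assumes a: "majorised r l A a" and b: "majorised r l B b" and c: "majorised r l C c" and s: "s \<in> {0..T}"
  shows "cmod (M s k i j * a s i * b s j * cnj (c s (i + j - k))) \<le>
     (g1 + g2 / (r - l * T)) * (A i * B j * C (i + j - k))"
proof -
  have ls: "l * s \<le> l * T" using l s by auto
  define e where "e = r - l * T"
  have e: "0 < e" using r by (simp add: e_def)
  have "(g1 + g2 * freq k i j) * exp (- ((r - l * s) * freq k i j)) \<le> (g1 + g2 * freq k i j) * exp (- (e * freq k i j))"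
    using ls g freq_nonneg[of k i j] by (intro mult_left_mono) (auto simp: e_def intro!: mult_right_mono)
  also have "\<dots> = g1 * exp (- (e * freq k i j)) + g2 * (freq k i j * exp (- (e * freq k i j)))"
    by (simp add: algebra_simps)
  also have "\<dots> \<le> g1 * 1 + g2 * (1 / e)"
    using g e freq_nonneg[of k i j] by (intro add_mono mult_left_mono mult_exp_neg_le) auto
  finally have "(g1 + g2 * freq k i j) * exp (- ((r - l * s) * freq k i j)) \<le> g1 + g2 / e" by simp
  then have "((g1 + g2 * freq k i j) * exp (- ((r - l * s) * freq k i j))) * (A i * B j * C (i + j - k)) 
     \<le> (g1 + g2 / e) * (A i * B j * C (i + j - k))"
    by (intro mult_right_mono mult_nonneg_nonneg majorised_nonneg[OF a] majorised_nonneg[OF b] majorised_nonneg[OF c])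
  with trilin_summand_bound[OF assms, of k i j] show ?thesis by (simp add: e_def)
qed

lemma majorised_conv3_summable:
  assumes "majorised r l A a" "majorised r l B b" "majorised r l C c"
  shows "(\<lambda>(i, j). A i * B j * C (i + j - k)) summable_on UNIV"
  by (rule conv3_summable[OF has_sum_infsum _ has_sum_infsum _ has_sum_infsum])
     (use assms majorised_summable majorised_nonneg in blast)+

lemma trilin_summable:
  assumes "majorised r l A a" "majorised r l B b" "majorised r l C c" "s \<in> {0..T}"
  shows "(\<lambda>(i, j). M s k i j * a s i * b s j * cnj (c s (i + j - k))) summable_on UNIV"
  by (rule summable_on_dominated[OF summable_on_cmult_right[OF majorised_conv3_summable[OF assms(1-3)]]])
     (use trilin_summand_bound'[OF assms] in auto)

lemma trilin_continuous:
  assumes "majorised r l A a" "majorised r l B b" "majorised r l C c"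
  shows "continuous_on {0..T} (\<lambda>s. trilin (M s) (a s) (b s) (c s) k)"
  unfolding trilin_def
proof (rule infsum_continuous_on_dominated)
  show "(\<lambda>ij. (g1 + g2 / (r - l * T)) * (case ij of (i, j) \<Rightarrow> A i * B j * C (i + j - k))) summable_on UNIV"
    by (intro summable_on_cmult_right majorised_conv3_summable[OF assms])
qed (use trilin_summand_bound'[OF assms] in
      \<open>auto simp: case_prod_unfold intro!: continuous_intros cont assms[THEN majorised_continuous]\<close>)

lemma trilin_integral_bound:
  assumes a: "majorised r l A a" and b: "majorised r l B b" and c: "majorised r l C c" and t: "t \<in> {0..T}"
  shows "cmod (integral {0..t} (\<lambda>s. trilin (M s) (a s) (b s) (c s) k)) \<le>
     exp (- ((r - l * t) * \<bar>real_of_int k\<bar>)) * ((g1 * T + g2 / l) * conv3 A B C k)"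
proof -
  define f where "f = (\<lambda>(i, j) s. M s k i j * a s i * b s j * cnj (c s (i + j - k)))"
  define E where "E = exp (- ((r - l * t) * \<bar>real_of_int k\<bar>)) * (g1 * T + g2 / l)"
  have pos: "0 \<le> A i * B j * C (i + j - k)" for i j
    by (intro mult_nonneg_nonneg majorised_nonneg[OF a] majorised_nonneg[OF b] majorised_nonneg[OF c])
  have cf: "continuous_on {0..t} (f ij)" for ij
    by (rule continuous_on_subset[of "{0..T}"])
       (use t in \<open>auto simp: f_def case_prod_unfold intro!: continuous_intros cont
          majorised_continuous[OF a] majorised_continuous[OF b] majorised_continuous[OF c]\<close>)
  have f: "integral {0..t} (\<lambda>s. trilin (M s) (a s) (b s) (c s) k) = (\<Sum>\<^sub>\<infinity>ij. integral {0..t} (f ij))"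
  proof -
    have "((\<lambda>ij. integral {0..t} (f ij)) has_sum integral {0..t} (\<lambda>s. \<Sum>\<^sub>\<infinity>ij. f ij s)) UNIV"
    proof (rule infsum_has_integral_dominated[OF cf])
      show "(\<lambda>ij. (g1 + g2 / (r - l * T)) * (case ij of (i, j) \<Rightarrow> A i * B j * C (i + j - k))) summable_on UNIV"
        by (intro summable_on_cmult_right majorised_conv3_summable[OF a b c])
      show "norm (f ij s) \<le> (g1 + g2 / (r - l * T)) * (case ij of (i, j) \<Rightarrow> A i * B j * C (i + j - k))"
        if "s \<in> {0..t}" for ij s
        using trilin_summand_bound'[OF a b c, of s] that t by (auto simp: f_def case_prod_unfold)
    qed
    then show ?thesis
      by (simp add: infsumI trilin_def f_def case_prod_unfold)
  qed
  have le: "cmod (integral {0..t} (f ij)) \<le> E * (case ij of (i, j) \<Rightarrow> A i * B j * C (i + j - k))" for ij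
  proof -
    obtain i j where ij: "ij = (i, j)" by (cases ij)
    define n where "n = freq k i j"
    have n: "0 \<le> n" "\<bar>real_of_int k\<bar> \<le> n" by (simp_all add: n_def abs_le_freq freq_nonneg)
    have lt: "l * t \<le> l * T" using l t by auto
    have rt: "0 \<le> r - l * t" using lt r by linarith
    \<comment> \<open>An antiderivative of the dominating function. In the \<open>g1\<close> part
      the exponential, which increases with \<open>s\<close>, is frozen at time \<open>t\<close>. In
      the \<open>g2\<close> part it is kept, since integrating it produces
      \<open>1 / (l * n)\<close> and cancels the factor \<open>n\<close>.\<close>
    define G where "G s = g1 * exp (- ((r - l * t) * n)) * s + g2 / l * exp (- ((r - l * s) * n))" for s
    have G: "(G has_vector_derivative (g1 * exp (- ((r - l * t) * n)) + g2 * n * exp (- ((r - l * s) * n)))) (at s within S)" for s S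
      unfolding G_def using l
      by (auto intro!: derivative_eq_intros simp: has_real_derivative_iff_has_vector_derivative[symmetric])
    have I: "((\<lambda>s. (g1 * exp (- ((r - l * t) * n)) + g2 * n * exp (- ((r - l * s) * n))) * (A i * B j * C (i + j - k)))
      has_integral (G t - G 0) * (A i * B j * C (i + j - k))) {0..t}"
      using t by (intro has_integral_mult_left fundamental_theorem_of_calculus G) auto
    have "cmod (integral {0..t} (f ij)) \<le>
       integral {0..t} (\<lambda>s. (g1 * exp (- ((r - l * t) * n)) + g2 * n * exp (- ((r - l * s) * n))) * (A i * B j * C (i + j - k)))"
    proof (rule integral_norm_bound_integral)
      show "f ij integrable_on {0..t}" by (intro integrable_continuous_real cf)
      fix s assume s: "s \<in> {0..t}"
      have ls: "l * s \<le> l * t" using s l by auto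
      have "cmod (f ij s) \<le> ((g1 + g2 * n) * exp (- ((r - l * s) * n))) * (A i * B j * C (i + j - k))"
        using trilin_summand_bound[OF a b c, of s] s t by (auto simp: f_def ij n_def)
      also have "\<dots> = (g1 * exp (- ((r - l * s) * n)) + g2 * n * exp (- ((r - l * s) * n))) * (A i * B j * C (i + j - k))"
        by (simp add: algebra_simps)
      also have "\<dots> \<le> (g1 * exp (- ((r - l * t) * n)) + g2 * n * exp (- ((r - l * s) * n))) * (A i * B j * C (i + j - k))"
        using ls n g by (intro mult_right_mono add_right_mono mult_left_mono pos) (auto intro!: mult_right_mono)
      finally show "cmod (f ij s) \<le> (g1 * exp (- ((r - l * t) * n)) + g2 * n * exp (- ((r - l * s) * n))) * (A i * B j * C (i + j - k))" .
    qed (use I in blast)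
    also have "\<dots> = (G t - G 0) * (A i * B j * C (i + j - k))" using I by (rule integral_unique)
    also have "\<dots> \<le> E * (A i * B j * C (i + j - k))"
    proof (intro mult_right_mono pos)
      \<comment> \<open>\<open>G 0\<close> is nonnegative and is dropped. The next step lowers the
        frequency in the exponent from \<open>n\<close> to \<open>\<bar>k\<bar>\<close>, which is
        allowed because the radius at time \<open>t\<close> is still nonnegative.\<close>
      have "G t - G 0 \<le> exp (- ((r - l * t) * n)) * (g1 * t + g2 / l)"
        using g l by (simp add: G_def algebra_simps)
      also have "\<dots> \<le> exp (- ((r - l * t) * \<bar>real_of_int k\<bar>)) * (g1 * T + g2 / l)"
        using g l t n rt by (intro mult_mono add_mono mult_left_mono) (auto intro!: mult_left_mono)
      finally show "G t - G 0 \<le> E" by (simp add: E_def)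
    qed
    finally show ?thesis by (simp add: ij)
  qed
  have "cmod (integral {0..t} (\<lambda>s. trilin (M s) (a s) (b s) (c s) k)) \<le>
    (\<Sum>\<^sub>\<infinity>ij. E * (case ij of (i, j) \<Rightarrow> A i * B j * C (i + j - k)))"
    unfolding f
    by (rule summable_on_dominated(2)[OF summable_on_cmult_right[OF majorised_conv3_summable[OF a b c]] le])
  also have "\<dots> = E * conv3 A B C k"
    unfolding conv3_def by (rule infsum_cmult_right') 
  finally show ?thesis by (simp add: E_def mult_ac)
qed

lemma trilin_telescope:
  assumes y: "majorised r l P y" and z: "majorised r l Q z" and w: "majorised r l D (\<lambda>s k. z s k - y s k)"
    and s: "s \<in> {0..T}"
  shows "trilin (M s) (z s) (z s) (z s) k - trilin (M s) (y s) (y s) (y s) k =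
    trilin (M s) (\<lambda>k. z s k - y s k) (z s) (z s) k + trilin (M s) (y s) (\<lambda>k. z s k - y s k) (z s) k +
    trilin (M s) (y s) (y s) (\<lambda>k. z s k - y s k) k"
proof -
  note S = trilin_summable[OF _ _ _ s, of _ _ _ _ _ _ k]
  have "trilin (M s) (\<lambda>k. z s k - y s k) (z s) (z s) k + trilin (M s) (y s) (\<lambda>k. z s k - y s k) (z s) k +
    trilin (M s) (y s) (y s) (\<lambda>k. z s k - y s k) k + trilin (M s) (y s) (y s) (y s) k = trilin (M s) (z s) (z s) (z s) k"
    unfolding trilin_def
    apply (subst infsum_add[symmetric], rule S[OF w z z], rule S[OF y w z])
    apply (subst infsum_add[symmetric], rule summable_on_add, rule S[OF w z z], rule S[OF y w z], rule S[OF y y w])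
    apply (subst infsum_add[symmetric], rule summable_on_add, rule summable_on_add, 
           rule S[OF w z z], rule S[OF y w z], rule S[OF y y w], rule S[OF y y y])
    by (rule infsum_cong) (auto simp: algebra_simps)
  then show ?thesis by (simp add: algebra_simps)
qed

lemma trilin_integral_diff_bound:
  assumes y: "majorised r l P y" and z: "majorised r l Q z" and w: "majorised r l D (\<lambda>s k. z s k - y s k)"
    and t: "t \<in> {0..T}"
  shows "cmod (integral {0..t} (\<lambda>s. trilin (M s) (z s) (z s) (z s) k) - integral {0..t} (\<lambda>s. trilin (M s) (y s) (y s) (y s) k)) \<le>
     exp (- ((r - l * t) * \<bar>real_of_int k\<bar>)) * ((g1 * T + g2 / l) * (conv3 D Q Q k + conv3 P D Q k + conv3 P P D k))"
proof -
  let ?w = "\<lambda>s k. z s k - y s k"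
  have int: "(\<lambda>s. trilin (M s) (a s) (b s) (c s) k) integrable_on {0..t}" 
    if "majorised r l A a" "majorised r l B b" "majorised r l C c" for A B C a b c
    by (intro integrable_continuous_real continuous_on_subset[OF trilin_continuous[OF that]]) (use t in auto)
  have "integral {0..t} (\<lambda>s. trilin (M s) (z s) (z s) (z s) k) - integral {0..t} (\<lambda>s. trilin (M s) (y s) (y s) (y s) k)
    = integral {0..t} (\<lambda>s. trilin (M s) (z s) (z s) (z s) k - trilin (M s) (y s) (y s) (y s) k)"
    by (intro integral_diff[symmetric] int[OF y y y] int[OF z z z])
  also have "\<dots> = integral {0..t} (\<lambda>s. trilin (M s) (?w s) (z s) (z s) k + trilin (M s) (y s) (?w s) (z s) k +
    trilin (M s) (y s) (y s) (?w s) k)"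
    by (rule integral_cong) (use trilin_telescope[OF y z w] t in auto)
  also have "\<dots> = integral {0..t} (\<lambda>s. trilin (M s) (?w s) (z s) (z s) k) + integral {0..t} (\<lambda>s. trilin (M s) (y s) (?w s) (z s) k) +
    integral {0..t} (\<lambda>s. trilin (M s) (y s) (y s) (?w s) k)"
  proof -
    note I = int[OF w z z] int[OF y w z] int[OF y y w]
    show ?thesis
      by (subst integral_add[OF integrable_add[OF I(1,2)] I(3)], subst integral_add[OF I(1,2)]) (rule refl)
  qed
  finally show ?thesis
    using trilin_integral_bound[OF w z z t, of k] trilin_integral_bound[OF y w z t, of k]
      trilin_integral_bound[OF y y w t, of k]
    by (simp only: distrib_left) (meson add_mono norm_triangle_le norm_triangle_ineq order_trans)
qed

end
end

section \<open>The abstract Cauchy problem\<close>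

lemma summable_on_real_diff:
  fixes f g :: "'a \<Rightarrow> real"
  shows "f summable_on A \<Longrightarrow> g summable_on A \<Longrightarrow> (\<lambda>x. f x - g x) summable_on A"
  using summable_on_add[of f A "\<lambda>x. - g x"] by (simp add: summable_on_uminus)

text \<open>Scalar counterpart of \<open>trilin_telescope\<close>, with the slots in the same order.
  The three convolutions that bound a difference of cubic terms thus add up exactly to a difference
  of cubes of majorants.\<close>

lemma conv3_add:
  assumes "A summable_on UNIV" "\<And>k. 0 \<le> A k" "D summable_on UNIV" "\<And>k. 0 \<le> D k"
  defines "B \<equiv> \<lambda>k. A k + D k"
  shows "conv3 B B B k - conv3 A A A k = conv3 D B B k + conv3 A D B k + conv3 A A D k"
proof -
  have B: "B summable_on UNIV" "\<And>k. 0 \<le> B k"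
    unfolding B_def using assms by (auto intro!: summable_on_add add_nonneg_nonneg)
  note S = conv3_summable[OF has_sum_infsum _ has_sum_infsum _ has_sum_infsum, of _ _ _ k]
  note s = S[OF assms(3,4) B B] S[OF assms(1,2,3,4) B] S[OF assms(1,2) assms(1,2) assms(3,4)] S[OF assms(1,2) assms(1,2) assms(1,2)]
  have "conv3 D B B k + conv3 A D B k + conv3 A A D k + conv3 A A A k = conv3 B B B k"
    unfolding conv3_def
    by (simp only: infsum_add[symmetric] s summable_on_add) (auto intro!: infsum_cong simp: B_def algebra_simps)
  then show ?thesis by simp
qed

primrec majorant :: "real \<Rightarrow> (int \<Rightarrow> real) \<Rightarrow> nat \<Rightarrow> int \<Rightarrow> real" where
  "majorant q b 0 = (\<lambda>k. 0)"
| "majorant q b (Suc n) = (\<lambda>k. b k + q * conv3 (majorant q b n) (majorant q b n) (majorant q b n) k)"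

text \<open>The total mass \<open>S\<close> of an iterate becomes \<open>R + q * S ^ 3\<close>. The
  bound \<open>S \<le> 2 * R\<close> is preserved because
  \<open>q * (2 * R) ^ 3 = (q * 8 * R ^ 2) * R \<le> R\<close>; this is the origin of the number 8.
  Monotonicity in \<open>n\<close> follows since \<open>conv3\<close> is monotone on nonnegative
  sequences and the iteration starts at zero.\<close>

lemma majorant:
  assumes b: "(b has_sum R) UNIV" "\<And>k. 0 \<le> b k" and q: "0 \<le> q" "q * (8 * R\<^sup>2) \<le> 1" 
  shows "0 \<le> majorant q b n k"
    and "majorant q b n summable_on UNIV"
    and "(\<Sum>\<^sub>\<infinity>k. majorant q b n k) \<le> 2 * R"
    and "majorant q b n k \<le> majorant q b (Suc n) k"
proof -
  have R: "0 \<le> R" using b has_sum_nonneg by blast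
  have *: "(\<forall>k. 0 \<le> majorant q b n k) \<and> (\<exists>S. (majorant q b n has_sum S) UNIV \<and> 0 \<le> S \<and> S \<le> 2 * R)" for n
  proof (induction n)
    case (Suc n)
    then obtain S where S: "\<And>k. 0 \<le> majorant q b n k" "(majorant q b n has_sum S) UNIV" "0 \<le> S" "S \<le> 2 * R"
      by auto
    have "q * S ^ 3 \<le> q * (2 * R) ^ 3" using S q by (intro mult_left_mono power_mono) auto
    also have "\<dots> = (q * (8 * R\<^sup>2)) * R" by (simp add: power3_eq_cube power2_eq_square)
    also have "\<dots> \<le> R" using q R by (simp add: mult_left_le_one_le)
    finally have "R + q * (S * S * S) \<le> 2 * R" by (simp add: power3_eq_cube)
    moreover have "(majorant q b (Suc n) has_sum R + q * (S * S * S)) UNIV"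
      unfolding majorant.simps by (intro has_sum_add has_sum_cmult_right conv3_has_sum b S)
    moreover have "0 \<le> majorant q b (Suc n) k" for k
      using b q conv3_nonneg[OF S(2,1) S(2,1) S(2,1)] by simp
    ultimately show ?case using S R q by (auto intro!: exI[of _ "R + q * (S * S * S)"])
  qed (use R in \<open>auto intro!: exI[of _ 0]\<close>)
  show n: "0 \<le> majorant q b n k" for n k using * by auto
  show s: "majorant q b n summable_on UNIV" for n using * has_sum_imp_summable by blast
  show "(\<Sum>\<^sub>\<infinity>k. majorant q b n k) \<le> 2 * R" using * infsumI by metis
  show "majorant q b n k \<le> majorant q b (Suc n) k"
  proof (induction n arbitrary: k)
    case 0 then show ?case using n[of "Suc 0"] by simp
  next
    case (Suc n)
    have "conv3 (majorant q b n) (majorant q b n) (majorant q b n) k \<le> conv3 (majorant q b (Suc n)) (majorant q b (Suc n)) (majorant q b (Suc n)) k"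
      unfolding conv3_def
      by (intro infsum_mono conv3_summable[OF has_sum_infsum[OF s] n has_sum_infsum[OF s] n has_sum_infsum[OF s] n])
         (auto simp del: majorant.simps intro!: mult_mono Suc.IH n mult_nonneg_nonneg)
    then have "q * conv3 (majorant q b n) (majorant q b n) (majorant q b n) k \<le> q * conv3 (majorant q b (Suc n)) (majorant q b (Suc n)) (majorant q b (Suc n)) k"
      using q by (intro mult_left_mono) auto
    then show ?case unfolding majorant.simps(2)[of q b n] majorant.simps(2)[of q b "Suc n"] by (intro add_left_mono)
  qed
qed

section \<open>Picard iteration dominated mode by mode\<close>

context symbol
begin

definition mild :: "(int \<Rightarrow> complex) \<Rightarrow> (real \<Rightarrow> int \<Rightarrow> complex) \<Rightarrow> bool" where
  "mild z0 z \<longleftrightarrow> (\<forall>t\<in>{0..T}. \<forall>k.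
     z t k = z0 k + integral {0..t} (\<lambda>s. trilin (M s) (z s) (z s) (z s) k))"

primrec picard :: "(int \<Rightarrow> complex) \<Rightarrow> nat \<Rightarrow> real \<Rightarrow> int \<Rightarrow> complex" where
  "picard z0 0 = (\<lambda>t k. 0)"
| "picard z0 (Suc n) = (\<lambda>t k. z0 k + integral {0..t}
     (\<lambda>s. trilin (M s) (picard z0 n s) (picard z0 n s) (picard z0 n s) k))"

text \<open>Both claims reproduce the recursion of \<open>majorant\<close> exactly: the bound on the
  time integral is one step of that recursion, and for differences the three telescoping terms
  recombine by \<open>conv3_add\<close>.\<close>

lemma picard_majorised:
  assumes l: "0 < l" and r: "0 < r - l * T"
    and b: "(b has_sum R) UNIV" "\<And>k. 0 \<le> b k" and z0: "\<And>k. cmod (z0 k) \<le> exp (- (r * \<bar>real_of_int k\<bar>)) * b k"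
    and q: "(g1 * T + g2 / l) * (8 * R\<^sup>2) \<le> 1"
  defines "B \<equiv> majorant (g1 * T + g2 / l) b"
  shows "majorised r l (B n) (picard z0 n)"
    "majorised r l (\<lambda>k. B (Suc n) k - B n k) (\<lambda>s k. picard z0 (Suc n) s k - picard z0 n s k)"
proof -
  have q0: "0 \<le> g1 * T + g2 / l" using g T l by simp
  note m = majorant[OF b q0 q, folded B_def]
  have Bs: "B (Suc n) k = b k + (g1 * T + g2 / l) * conv3 (B n) (B n) (B n) k" for n k by (simp add: B_def)
  have z0': "cmod (z0 k) \<le> exp (- ((r - l * t) * \<bar>real_of_int k\<bar>)) * b k" if "t \<in> {0..T}" for t k
  proof -
    have "exp (- (r * \<bar>real_of_int k\<bar>)) \<le> exp (- ((r - l * t) * \<bar>real_of_int k\<bar>))"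
      using l that by (auto intro!: mult_right_mono)
    from mult_right_mono[OF this b(2)[of k]] z0[of k] show ?thesis by linarith
  qed
  have step: "majorised r l (B (Suc n)) (picard z0 (Suc n))" if z: "majorised r l (B n) (picard z0 n)" for n
  proof -
    have "cmod (picard z0 (Suc n) t k) \<le> exp (- ((r - l * t) * \<bar>real_of_int k\<bar>)) * B (Suc n) k" if "t \<in> {0..T}" for t k
      using norm_triangle_le[OF add_mono[OF z0'[OF that, of k] trilin_integral_bound[OF l r z z z that, of k]]]
      by (simp add: Bs algebra_simps)
    moreover have "continuous_on {0..T} (\<lambda>t. picard z0 (Suc n) t k)" for k
      unfolding picard.simps
      by (intro continuous_intros indefinite_integral_continuous_1 integrable_continuous_real trilin_continuous[OF l r z z z])
    ultimately show ?thesis using m by (auto simp: majorised_def simp del: picard.simps)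
  qed
  show z: "majorised r l (B n) (picard z0 n)" for n
  proof (induction n)
    case 0
    show ?case by (simp add: B_def majorised_def)
  qed (rule step)
  have Bd: "(\<lambda>k. B (Suc n) k - B n k) summable_on UNIV" "0 \<le> B (Suc n) k - B n k" for n k
    using m by (auto intro!: summable_on_real_diff)
  show "majorised r l (\<lambda>k. B (Suc n) k - B n k) (\<lambda>s k. picard z0 (Suc n) s k - picard z0 n s k)"
  proof (induction n)
    case 0
    show ?case using z[of "Suc 0"] by (simp add: B_def del: picard.simps(2) majorant.simps(2)) 
  next
    case (Suc n)
    show ?case
    proof (rule majorised_diff[OF z z _ Bd(2,1)])
      fix t k assume t: "t \<in> {0..T}"
      have "cmod (picard z0 (Suc (Suc n)) t k - picard z0 (Suc n) t k) \<le>
         exp (- ((r - l * t) * \<bar>real_of_int k\<bar>)) * ((g1 * T + g2 / l) *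
          (conv3 (\<lambda>k. B (Suc n) k - B n k) (B (Suc n)) (B (Suc n)) k + conv3 (B n) (\<lambda>k. B (Suc n) k - B n k) (B (Suc n)) k
          + conv3 (B n) (B n) (\<lambda>k. B (Suc n) k - B n k) k))"
        using trilin_integral_diff_bound[OF l r z z Suc.IH t, of k] by (simp add: picard.simps(2))
      also have "conv3 (\<lambda>k. B (Suc n) k - B n k) (B (Suc n)) (B (Suc n)) k + conv3 (B n) (\<lambda>k. B (Suc n) k - B n k) (B (Suc n)) k
          + conv3 (B n) (B n) (\<lambda>k. B (Suc n) k - B n k) k = conv3 (B (Suc n)) (B (Suc n)) (B (Suc n)) k - conv3 (B n) (B n) (B n) k"
        using conv3_add[OF m(2)[of n] m(1)[of n] Bd(1)[of n] Bd(2), of k] by (simp add: add.commute)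
      also have "(g1 * T + g2 / l) * \<dots> = B (Suc (Suc n)) k - B (Suc n) k"
        unfolding Bs[of "Suc n"] Bs[of n] by (simp add: algebra_simps)
      finally show "cmod (picard z0 (Suc (Suc n)) t k - picard z0 (Suc n) t k) \<le>
         exp (- ((r - l * t) * \<bar>real_of_int k\<bar>)) * (B (Suc (Suc n)) k - B (Suc n) k)" .
    qed
  qed
qed

text \<open>The increments of \<open>B n k\<close> telescope and bound those of the Picard iterates,
  so each mode is a Cauchy sequence, uniformly in time. The monotone limit \<open>C\<close> of the
  scalar iterates majorises the limit curve and controls the passage to the limit in the
  integral.\<close>

theorem mild_exists:
  assumes l: "0 < l" and r: "0 < r - l * T"
    and b: "(b has_sum R) UNIV" "\<And>k. 0 \<le> b k" and z0: "\<And>k. cmod (z0 k) \<le> exp (- (r * \<bar>real_of_int k\<bar>)) * b k"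
    and q: "(g1 * T + g2 / l) * (8 * R\<^sup>2) \<le> 1"
  obtains z B where "majorised r l B z" "mild z0 z"
proof -
  have q0: "0 \<le> g1 * T + g2 / l" using g T l by simp
  define B where "B = majorant (g1 * T + g2 / l) b"
  note m = majorant[OF b q0 q, folded B_def]
  note p = picard_majorised[OF l r b z0 q, folded B_def]
  have incB: "mono (\<lambda>n. B n k)" for k
    using m(4) by (simp add: incseq_Suc_iff)
  have leR: "B n k \<le> 2 * R" for n k
  proof -
    have "(\<Sum>k\<in>{k}. B n k) \<le> (\<Sum>\<^sub>\<infinity>k. B n k)"
      by (rule finite_sum_le_infsum) (use m in auto)
    then show ?thesis using m(3)[of n] by simp
  qed
  define C where "C k = lim (\<lambda>n. B n k)" for k
  have C: "(\<lambda>n. B n k) \<longlonglongrightarrow> C k" for k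
    unfolding C_def using incseq_convergent[OF incB, of k "2 * R"] leR
    by (metis convergent_LIMSEQ_iff convergentI)
  have BC: "B n k \<le> C k" for n k using incseq_le[OF incB C] .
  have C0: "0 \<le> C k" for k using BC[of 0 k] by (simp add: B_def)
  \<comment> \<open>Every finite sum of \<open>C\<close> is a limit of finite sums of
    \<open>B n\<close>, all of which stay below the total mass \<open>2 * R\<close>.\<close>
  have Cs: "C summable_on UNIV"
  proof (rule nonneg_bdd_above_summable_on)
    show "bdd_above (sum C ` {F. F \<subseteq> UNIV \<and> finite F})"
    proof (rule bdd_aboveI2)
      fix F :: "int set" assume "F \<in> {F. F \<subseteq> UNIV \<and> finite F}"
      then have "(\<Sum>k\<in>F. B n k) \<le> 2 * R" for n
        using finite_sum_le_infsum[of "B n" UNIV F] m(3)[of n] m(1,2) by auto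
      moreover have "(\<lambda>n. \<Sum>k\<in>F. B n k) \<longlonglongrightarrow> (\<Sum>k\<in>F. C k)" by (intro tendsto_sum C)
      ultimately show "(\<Sum>k\<in>F. C k) \<le> 2 * R" using LIMSEQ_le_const2 by blast
    qed
  qed (use C0 in auto)
  have diff: "cmod (picard z0 (d + n) t k - picard z0 n t k) \<le> exp (- ((r - l * t) * \<bar>real_of_int k\<bar>)) * (B (d + n) k - B n k)"
    if t: "t \<in> {0..T}" for n d t k
  proof (induction d)
    case (Suc d)
    have "cmod (picard z0 (Suc (d + n)) t k - picard z0 (d + n) t k) \<le> exp (- ((r - l * t) * \<bar>real_of_int k\<bar>)) * (B (Suc (d + n)) k - B (d + n) k)"
      using majorised_bound[OF p(2) t] .
    from norm_triangle_le[OF add_mono[OF this Suc]] show ?case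
      by (simp add: algebra_simps del: picard.simps)
  qed simp
  define z where "z t k = lim (\<lambda>n. picard z0 n t k)" for t k
  have le1: "exp (- ((r - l * t) * \<bar>real_of_int k\<bar>)) \<le> 1" if "t \<in> {0..T}" for t k
  proof -
    have "l * t \<le> l * T" using that l by auto
    then have "0 \<le> r - l * t" using r by linarith
    then show ?thesis by simp
  qed
  have z: "(\<lambda>n. picard z0 n t k) \<longlonglongrightarrow> z t k" if t: "t \<in> {0..T}" for t k
  proof -
    have "Cauchy (\<lambda>n. picard z0 n t k)"
    proof (rule CauchyI')
      fix e :: real assume "e > 0"
      with LIMSEQ_imp_Cauchy[OF C, of k] obtain N where N: "\<And>m n. m \<ge> N \<Longrightarrow> n \<ge> N \<Longrightarrow> norm (B m k - B n k) < e"
        using CauchyD by blast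
      have "norm (picard z0 n t k - picard z0 (d + n) t k) < e" if "n \<ge> N" for n d
      proof -
        have "norm (picard z0 n t k - picard z0 (d + n) t k) \<le> 1 * (B (d + n) k - B n k)"
          using diff[OF t, of d n k] mult_right_mono[OF le1[OF t, of k], of "B (d + n) k - B n k"]
            monoD[OF incB[of k], of n "d + n"] by (simp add: norm_minus_commute)
        also have "\<dots> < e" using N[of "d + n" n] that by simp
        finally show ?thesis .
      qed
      then have "norm (picard z0 m t k - picard z0 n t k) < e" if "m \<ge> N" "n > m" for m n
        using that by (metis less_imp_le le_add_diff_inverse2)
      then show "\<exists>M. \<forall>m\<ge>M. \<forall>n>m. dist (picard z0 m t k) (picard z0 n t k) < e"
        by (auto simp: dist_norm)
    qed
    then show ?thesis unfolding z_def by (simp add: Cauchy_convergent_iff convergent_LIMSEQ_iff)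
  qed
  have zd: "cmod (z t k - picard z0 n t k) \<le> exp (- ((r - l * t) * \<bar>real_of_int k\<bar>)) * (C k - B n k)"
    if t: "t \<in> {0..T}" for t n k
  proof (rule LIMSEQ_le)
    show "(\<lambda>d. cmod (picard z0 (d + n) t k - picard z0 n t k)) \<longlonglongrightarrow> cmod (z t k - picard z0 n t k)"
      by (intro tendsto_intros LIMSEQ_ignore_initial_segment[OF z[OF t]])
    show "(\<lambda>d. exp (- ((r - l * t) * \<bar>real_of_int k\<bar>)) * (B (d + n) k - B n k)) \<longlonglongrightarrow> exp (- ((r - l * t) * \<bar>real_of_int k\<bar>)) * (C k - B n k)"
      by (intro tendsto_intros LIMSEQ_ignore_initial_segment[OF C])
  qed (use diff[OF t] in auto)
  have mz: "majorised r l C z"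
  proof -
    have "continuous_on {0..T} (\<lambda>t. z t k)" for k
    proof (rule uniform_limit_theorem)
      show "uniform_limit {0..T} (\<lambda>n t. picard z0 n t k) (\<lambda>t. z t k) sequentially"
      proof (rule uniform_limitI)
        fix e :: real assume "e > 0"
        then have "\<forall>\<^sub>F n in sequentially. dist (B n k) (C k) < e" by (rule tendstoD[OF C])
        then show "\<forall>\<^sub>F n in sequentially. \<forall>t\<in>{0..T}. dist (picard z0 n t k) (z t k) < e"
        proof eventually_elim
          case (elim n)
          show ?case
          proof
            fix t assume t: "t \<in> {0..T}"
            have "cmod (z t k - picard z0 n t k) \<le> 1 * (C k - B n k)"
              using zd[OF t, of k n] mult_right_mono[OF le1[OF t, of k], of "C k - B n k"] BC[of n k] by simp
            with elim show "dist (picard z0 n t k) (z t k) < e"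
              by (simp add: dist_norm norm_minus_commute)
          qed
        qed
      qed
    qed (use p(1) in \<open>auto simp: majorised_def\<close>)
    moreover have "cmod (z t k) \<le> exp (- ((r - l * t) * \<bar>real_of_int k\<bar>)) * C k" if "t \<in> {0..T}" for t k
      using zd[OF that, of k 0] by (simp add: B_def)
    ultimately show ?thesis using C0 Cs by (auto simp: majorised_def)
  qed
  have "mild z0 z"
    unfolding mild_def
  proof (intro ballI allI)
    fix t k assume t: "t \<in> {0..T}"
    define D where "D n k = C k - B n k" for n k
    have D: "D n summable_on UNIV" "0 \<le> D n k" for n k
      unfolding D_def using Cs m(2) BC by (auto intro!: summable_on_real_diff)
    have w: "majorised r l (D n) (\<lambda>s k. z s k - picard z0 n s k)" for n
      by (rule majorised_diff[OF mz p(1) _ D(2,1)]) (use zd in \<open>simp add: D_def\<close>)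
    define E where "E = exp (- ((r - l * t) * \<bar>real_of_int k\<bar>)) * (g1 * T + g2 / l)"
    \<comment> \<open>The distance of the two integrals is at most a constant times the difference
      of the cubes of \<open>C\<close> and \<open>B n\<close>. That difference vanishes by dominated
      convergence of the convolution, with the cube of \<open>C\<close> as dominating
      family.\<close>
    have "(\<lambda>n. integral {0..t} (\<lambda>s. trilin (M s) (picard z0 n s) (picard z0 n s) (picard z0 n s) k)) \<longlonglongrightarrow>
       integral {0..t} (\<lambda>s. trilin (M s) (z s) (z s) (z s) k)"
    proof (rule LIM_zero_cancel, rule Lim_null_comparison)
      have "(\<lambda>n. conv3 (B n) (B n) (B n) k) \<longlonglongrightarrow> conv3 C C C k"
        unfolding conv3_def
      proof (rule infsum_tendsto_dominated)
        show "(\<lambda>(i, j). C i * C j * C (i + j - k)) summable_on UNIV"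
          by (intro conv3_summable[OF has_sum_infsum[OF Cs] C0 has_sum_infsum[OF Cs] C0 has_sum_infsum[OF Cs] C0])
        show "\<forall>\<^sub>F n in sequentially. \<forall>ij. norm (case ij of (i, j) \<Rightarrow> B n i * B n j * B n (i + j - k)) \<le> (case ij of (i, j) \<Rightarrow> C i * C j * C (i + j - k))"
          by (intro always_eventually allI) (auto simp: abs_mult m(1) C0 intro!: mult_mono BC)
      qed (auto intro!: tendsto_intros C)
      then have "(\<lambda>n. E * (conv3 C C C k - conv3 (B n) (B n) (B n) k)) \<longlonglongrightarrow> E * (conv3 C C C k - conv3 C C C k)"
        by (intro tendsto_intros)
      then show "(\<lambda>n. E * (conv3 C C C k - conv3 (B n) (B n) (B n) k)) \<longlonglongrightarrow> 0" by simp
      show "\<forall>\<^sub>F n in sequentially. norm (integral {0..t} (\<lambda>s. trilin (M s) (picard z0 n s) (picard z0 n s) (picard z0 n s) k) -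
         integral {0..t} (\<lambda>s. trilin (M s) (z s) (z s) (z s) k)) \<le> E * (conv3 C C C k - conv3 (B n) (B n) (B n) k)"
      proof (intro always_eventually allI)
        fix n
        have "conv3 (D n) C C k + conv3 (B n) (D n) C k + conv3 (B n) (B n) (D n) k = conv3 C C C k - conv3 (B n) (B n) (B n) k"
          using conv3_add[OF m(2)[of n] m(1)[of n] D(1)[of n] D(2)[of n], of k] by (simp add: D_def[abs_def])
        then show "norm (integral {0..t} (\<lambda>s. trilin (M s) (picard z0 n s) (picard z0 n s) (picard z0 n s) k) -
         integral {0..t} (\<lambda>s. trilin (M s) (z s) (z s) (z s) k)) \<le> E * (conv3 C C C k - conv3 (B n) (B n) (B n) k)"
          using trilin_integral_diff_bound[OF l r p(1)[of n] mz w[of n] t, of k]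
          by (simp add: E_def norm_minus_commute mult.assoc)
      qed
    qed
    then have "(\<lambda>n. picard z0 (Suc n) t k) \<longlonglongrightarrow> z0 k + integral {0..t} (\<lambda>s. trilin (M s) (z s) (z s) (z s) k)"
      unfolding picard.simps by (intro tendsto_intros)
    with LIMSEQ_Suc[OF z[OF t, of k]] show "z t k = z0 k + integral {0..t} (\<lambda>s. trilin (M s) (z s) (z s) (z s) k)"
      using LIMSEQ_unique by blast
  qed
  with mz show ?thesis by (rule that)
qed

text \<open>The same difference is majorised again and again: a majorant of mass \<open>d\<close>
  yields, through the integral equation, one of mass at most \<open>3 * q * S ^ 2 * d\<close>, where
  \<open>q = g1 * T + g2 / l\<close> and \<open>S\<close> is the mass of \<open>B\<close>. This is
  at most \<open>d / 2\<close> because of the factor 6 in the hypothesis. Starting from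
  \<open>B + B\<close>, the mass tends to zero.\<close>

lemma mild_unique_step:
  assumes l: "0 < l" and r: "0 < r - l * T"
    and y: "majorised r l B y" and z: "majorised r l B z" and mild: "mild z0 y" "mild z0 z"
    and q: "(g1 * T + g2 / l) * (6 * (\<Sum>\<^sub>\<infinity>k. B k)\<^sup>2) \<le> 1" and t: "t \<in> {0..T}"
  shows "z t k = y t k"
proof -
  define S where "S = (\<Sum>\<^sub>\<infinity>k. B k)"
  define q where "q = g1 * T + g2 / l"
  have q0: "0 \<le> q" using g T l by (simp add: q_def)
  have B: "(B has_sum S) UNIV" "\<And>k. 0 \<le> B k" using majorised_summable[OF y] majorised_nonneg[OF y] by (simp_all add: S_def)
  have "\<exists>D. majorised r l D (\<lambda>s k. z s k - y s k) \<and> (\<Sum>\<^sub>\<infinity>k. D k) \<le> (1 / 2) ^ n * (2 * S)" for n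
  proof (induction n)
    case 0
    have "cmod (z s k - y s k) \<le> exp (- ((r - l * s) * \<bar>real_of_int k\<bar>)) * (B k + B k)" if "s \<in> {0..T}" for s k
      unfolding distrib_left
      by (intro norm_triangle_le_diff add_mono majorised_bound[OF z that] majorised_bound[OF y that])
    then have "majorised r l (\<lambda>k. B k + B k) (\<lambda>s k. z s k - y s k)"
      using majorised_summable[OF y] B(2)
      by (intro majorised_diff[OF z y] summable_on_add add_nonneg_nonneg) auto
    moreover have "(\<Sum>\<^sub>\<infinity>k. B k + B k) = 2 * S" using infsumI[OF has_sum_add[OF B(1) B(1)]] by simp
    ultimately show ?case by (intro exI[of _ "\<lambda>k. B k + B k"]) simp
  next
    case (Suc n)
    then obtain D where D: "majorised r l D (\<lambda>s k. z s k - y s k)" "(\<Sum>\<^sub>\<infinity>k. D k) \<le> (1 / 2) ^ n * (2 * S)" by blast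
    define d where "d = (\<Sum>\<^sub>\<infinity>k. D k)"
    have Ds: "(D has_sum d) UNIV" "\<And>k. 0 \<le> D k" using majorised_summable[OF D(1)] majorised_nonneg[OF D(1)] by (simp_all add: d_def)
    define D' where "D' k = q * (conv3 D B B k + conv3 B D B k + conv3 B B D k)" for k
    have s: "(D' has_sum q * (d * S * S + S * d * S + S * S * d)) UNIV"
      unfolding D'_def by (intro has_sum_cmult_right has_sum_add conv3_has_sum B Ds)
    have "q * (d * S * S + S * d * S + S * S * d) = (q * (6 * S\<^sup>2)) * d * (1 / 2)"
      by (simp add: power2_eq_square)
    also have "\<dots> \<le> 1 * d * (1 / 2)"
      using q has_sum_nonneg[OF Ds(1)] Ds(2) by (intro mult_right_mono) (auto simp: S_def q_def)
    finally have le: "(\<Sum>\<^sub>\<infinity>k. D' k) \<le> (1 / 2) ^ Suc n * (2 * S)" using D(2) infsumI[OF s] by (simp add: d_def)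
    have "majorised r l D' (\<lambda>s k. z s k - y s k)"
    proof (rule majorised_diff[OF z y])
      show "cmod (z s k - y s k) \<le> exp (- ((r - l * s) * \<bar>real_of_int k\<bar>)) * D' k" if s: "s \<in> {0..T}" for s k
        using trilin_integral_diff_bound[OF l r y z D(1) s, of k] mild s by (simp add: mild_def D'_def q_def)
      show "0 \<le> D' k" for k
        unfolding D'_def using q0 conv3_nonneg[OF Ds B B] conv3_nonneg[OF B Ds B] conv3_nonneg[OF B B Ds]
        by (intro mult_nonneg_nonneg add_nonneg_nonneg) auto
    qed (use s has_sum_imp_summable in blast)
    with le show ?case by blast
  qed
  then obtain D where D: "\<And>n. majorised r l (D n) (\<lambda>s k. z s k - y s k)" "\<And>n. (\<Sum>\<^sub>\<infinity>k. D n k) \<le> (1 / 2) ^ n * (2 * S)"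
    by metis
  have "cmod (z t k - y t k) \<le> (1 / 2) ^ n * (2 * S)" for n
  proof -
    have "l * t \<le> l * T" using t l by auto
    then have "0 \<le> r - l * t" using r by linarith
    then have "exp (- ((r - l * t) * \<bar>real_of_int k\<bar>)) \<le> 1" by simp
    from mult_right_mono[OF this majorised_nonneg[OF D(1)[of n], of k]] majorised_bound[OF D(1)[of n] t, of k]
    have "cmod (z t k - y t k) \<le> D n k" by simp
    also have "D n k = (\<Sum>k\<in>{k}. D n k)" by simp
    also have "\<dots> \<le> (\<Sum>\<^sub>\<infinity>k. D n k)"
      by (rule finite_sum_le_infsum) (use D(1)[of n] in \<open>auto simp: majorised_def\<close>)
    finally show ?thesis using D(2)[of n] by simp
  qed
  moreover have "(\<lambda>n. (1 / 2) ^ n * (2 * S)) \<longlonglongrightarrow> 0 * (2 * S)"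
    by (intro tendsto_intros LIMSEQ_power_zero) simp
  ultimately have "cmod (z t k - y t k) \<le> 0 * (2 * S)"
    using LIMSEQ_le_const by blast
  then show ?thesis by simp
qed

end

section \<open>Uniqueness on the whole time interval from uniform exponential decay\<close>

lemma summable_on_exp_neg_abs: "(\<lambda>k::int. exp (- (e * \<bar>real_of_int k\<bar>))) summable_on UNIV" if "e > 0"
proof -
  have "summable (\<lambda>n. exp (- e) ^ n)" using that by (intro summable_geometric) simp
  then have n: "(\<lambda>n::nat. exp (- (e * real n))) summable_on UNIV"
    by (intro summable_nonneg_imp_summable_on) (auto simp: exp_of_nat_mult[symmetric] mult_ac)
  have "bij_betw int UNIV {0..}" "bij_betw (\<lambda>n. - int n) UNIV {..0}"
    by (rule bij_betw_byWitness[where f' = nat], auto) (rule bij_betw_byWitness[where f' = "\<lambda>k. nat (- k)"], auto)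
  from this[THEN summable_on_reindex_bij_betw, of "\<lambda>k. exp (- (e * \<bar>real_of_int k\<bar>))"]
  have "(\<lambda>k::int. exp (- (e * \<bar>real_of_int k\<bar>))) summable_on {0..} \<union> {..0}"
    using n by (intro summable_on_union) auto
  moreover have "{0..} \<union> {..0} = (UNIV :: int set)" by auto
  ultimately show ?thesis by simp
qed

text \<open>Half of the decay rate is turned into summability of the majorant, and the other half
  remains as the radius that shrinks in time.\<close>

lemma (in symbol) majorised_exp:
  assumes r: "0 < r" and m: "0 \<le> m" and l: "0 \<le> l"
    and v: "\<And>k. continuous_on {0..T} (\<lambda>t. v t k)"
    and le: "\<And>t k. t \<in> {0..T} \<Longrightarrow> cmod (v t k) \<le> m * exp (- (r * \<bar>real_of_int k\<bar>))"
  shows "majorised (r / 2) l (\<lambda>k. m * exp (- (r / 2 * \<bar>real_of_int k\<bar>))) v"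
  unfolding majorised_def
proof (intro conjI allI ballI v)
  show "(\<lambda>k. m * exp (- (r / 2 * \<bar>real_of_int k\<bar>))) summable_on UNIV"
    using r by (intro summable_on_cmult_right summable_on_exp_neg_abs) auto
  fix s k assume s: "s \<in> {0..T}"
  have "cmod (v s k) \<le> m * exp (- (r * \<bar>real_of_int k\<bar>))" by (rule le[OF s])
  also have "\<dots> = exp (- (r / 2 * \<bar>real_of_int k\<bar>)) * (m * exp (- (r / 2 * \<bar>real_of_int k\<bar>)))"
    by (simp add: exp_add[symmetric])
  also have "\<dots> \<le> exp (- ((r / 2 - l * s) * \<bar>real_of_int k\<bar>)) * (m * exp (- (r / 2 * \<bar>real_of_int k\<bar>)))"
  proof (intro mult_right_mono mult_nonneg_nonneg)
    have "(r / 2 - l * s) * \<bar>real_of_int k\<bar> \<le> r / 2 * \<bar>real_of_int k\<bar>"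
      using s l by (intro mult_right_mono) auto
    then show "exp (- (r / 2 * \<bar>real_of_int k\<bar>)) \<le> exp (- ((r / 2 - l * s) * \<bar>real_of_int k\<bar>))" by simp
  qed (use m in auto)
  finally show "cmod (v s k) \<le> exp (- ((r / 2 - l * s) * \<bar>real_of_int k\<bar>)) * (m * exp (- (r / 2 * \<bar>real_of_int k\<bar>)))" .
qed (use m in auto)

text \<open>The interval is covered by steps of a length \<open>d\<close> that depends only on the
  bound \<open>m\<close>, the rate \<open>r\<close> and the constants of the multiplier. The decay
  hypothesis holds at every time, so the radius spent in one step is available again in the
  next.\<close>

theorem (in symbol) mild_unique:
  assumes r: "0 < r" and y: "\<And>k. continuous_on {0..T} (\<lambda>t. y t k)" and z: "\<And>k. continuous_on {0..T} (\<lambda>t. z t k)"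
    and le: "\<And>t k. t \<in> {0..T} \<Longrightarrow> cmod (y t k) \<le> m * exp (- (r * \<bar>real_of_int k\<bar>))"
      "\<And>t k. t \<in> {0..T} \<Longrightarrow> cmod (z t k) \<le> m * exp (- (r * \<bar>real_of_int k\<bar>))"
    and mild: "mild z0 y" "mild z0 z" and t: "t \<in> {0..T}"
  shows "z t k = y t k"
proof -
  have m: "0 \<le> m" using norm_ge_zero[THEN order_trans, OF le(1)[of 0 0]] T by simp
  define B where "B k = m * exp (- (r / 2 * \<bar>real_of_int k\<bar>))" for k
  define S where "S = (\<Sum>\<^sub>\<infinity>k. B k)"
  \<comment> \<open>Chosen so that on a step of length \<open>T'\<close>, with the slope
    \<open>l\<close> used below, the left side of the hypothesis of \<open>mild_unique_step\<close>
    is exactly \<open>T' * N\<close>.\<close>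
  define N where "N = (g1 + g2 / (r / 4)) * (6 * S\<^sup>2)"
  have N: "0 \<le> N" using g r by (simp add: N_def)
  define d where "d = 1 / (N + 1)"
  have d: "0 < d" "d * N \<le> 1" using N by (auto simp: d_def field_simps)
  have "\<forall>t\<in>{0..T}. t \<le> real n * d \<longrightarrow> (\<forall>k. z t k = y t k)" for n
  proof (induction n)
    case 0
    then show ?case using mild by (auto simp: mild_def)
  next
    case (Suc n)
    define t0 where "t0 = real n * d"
    show ?case
    proof (intro ballI impI allI)
      fix t k assume t: "t \<in> {0..T}" "t \<le> real (Suc n) * d"
      show "z t k = y t k"
      proof (cases "t \<le> t0")
        case True
        then show ?thesis using Suc t by (simp add: t0_def)
      next
        case False
        have t0: "0 \<le> t0" using d by (simp add: t0_def)
        define T' where "T' = t - t0"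
        have T': "0 < T'" "T' \<le> d" using False t by (auto simp: T'_def t0_def algebra_simps)
        interpret sh: symbol "\<lambda>s. M (t0 + s)" g1 g2 T'
          using t t0 T' g
          by unfold_locales (auto intro!: bound continuous_on_compose2[OF cont] continuous_intros simp: T'_def)
        \<comment> \<open>A step spends \<open>l * T' = r / 4\<close>, half of the radius
          \<open>r / 2\<close> that \<open>majorised_exp\<close> leaves; short steps thus have a
          steep slope and a large gain.\<close>
        define l where "l = r / (4 * T')"
        have l: "0 < l" "0 < r / 2 - l * T'" "l * T' = r / 4" using T' r by (auto simp: l_def)
        have maj: "sh.majorised (r / 2) l B (\<lambda>s. v (t0 + s))"
          if v: "\<And>k. continuous_on {0..T} (\<lambda>t. v t k)" 
            "\<And>t k. t \<in> {0..T} \<Longrightarrow> cmod (v t k) \<le> m * exp (- (r * \<bar>real_of_int k\<bar>))" for v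
          unfolding B_def
        proof (rule sh.majorised_exp[OF r m])
          show "continuous_on {0..T'} (\<lambda>s. v (t0 + s) k)" for k
            using t t0 by (auto intro!: continuous_on_compose2[OF v(1)] continuous_intros simp: T'_def)
          show "cmod (v (t0 + s) k) \<le> m * exp (- (r * \<bar>real_of_int k\<bar>))" if "s \<in> {0..T'}" for s k
            using that t t0 by (intro v(2)) (auto simp: T'_def)
        qed (use l in auto)
        have sm: "sh.mild (y t0) (\<lambda>s. v (t0 + s))" if v: "mild z0 v" "\<And>k. v t0 k = y t0 k"
          and vl: "\<And>k. continuous_on {0..T} (\<lambda>t. v t k)"
            "\<And>t k. t \<in> {0..T} \<Longrightarrow> cmod (v t k) \<le> m * exp (- (r * \<bar>real_of_int k\<bar>))" for v
          unfolding sh.mild_def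
        proof (intro ballI allI)
          fix s k assume s: "s \<in> {0..T'}"
          define f where "f s = trilin (M s) (v s) (v s) (v s) k" for s
          \<comment> \<open>This majorisation over the whole interval only provides continuity of
            the integrand. The slope \<open>r / (4 * (T + 1))\<close> is small enough to keep the
            radius positive up to time \<open>T\<close>.\<close>
          have maj: "majorised (r / 2) (r / (4 * (T + 1))) (\<lambda>k. m * exp (- (r / 2 * \<bar>real_of_int k\<bar>))) v"
            using T r by (intro majorised_exp r m vl) auto
          have fc: "continuous_on {0..T} f"
            unfolding f_def by (rule trilin_continuous[OF _ _ maj maj maj]) (use T r in \<open>auto simp: field_simps intro!: add_pos_nonneg\<close>)
          have t0s: "0 \<le> s" "t0 + s \<le> T" using s t by (auto simp: T'_def)
          from integral_shift_Icc_real[of 0 s f t0] have "integral {0..s} (\<lambda>s. f (t0 + s)) = integral {t0..t0 + s} f"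
            by (simp add: o_def add.commute)
          moreover have "integral {0..t0} f + integral {t0..t0 + s} f = integral {0..t0 + s} f"
            using t0 t0s by (intro Henstock_Kurzweil_Integration.integral_combine integrable_continuous_real continuous_on_subset[OF fc]) auto
          moreover have "v (t0 + s) k = z0 k + integral {0..t0 + s} f" "v t0 k = z0 k + integral {0..t0} f"
            using v(1) t0 t0s unfolding mild_def f_def by auto
          ultimately show "v (t0 + s) k = y t0 k + integral {0..s} (\<lambda>s. trilin (M (t0 + s)) (v (t0 + s)) (v (t0 + s)) (v (t0 + s)) k)"
            using v(2)[of k] by (simp add: f_def)
        qed
        have "z (t0 + T') k = y (t0 + T') k"
        proof (rule sh.mild_unique_step[OF l(1,2) maj[OF y le(1)] maj[OF z le(2)] sm[OF mild(1) _ y le(1)] sm[OF mild(2) _ z le(2)]])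
          have "(g1 * T' + g2 / l) * (6 * S\<^sup>2) = T' * N" using r T' by (simp add: l_def N_def field_simps)
          also have "\<dots> \<le> d * N" using T' N by (intro mult_right_mono)
          finally show "(g1 * T' + g2 / l) * (6 * (\<Sum>\<^sub>\<infinity>k. B k)\<^sup>2) \<le> 1" using d by (simp add: S_def)
          show "z t0 k = y t0 k" for k using Suc t t0 False by (auto simp: t0_def)
        qed (use T' in auto)
        then show ?thesis by (simp add: T'_def)
      qed
    qed
  qed
  moreover obtain n where "t / d \<le> real n" using real_arch_simple by blast
  then have "t \<le> real n * d" using d by (simp add: field_simps)
  ultimately show ?thesis using t by blast
qed

section \<open>Fourier series on the torus\<close>

abbreviation l1 :: "('i \<Rightarrow> complex) \<Rightarrow> bool" where
  "l1 a \<equiv> (\<lambda>i. cmod (a i)) summable_on UNIV"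

definition wave :: "int \<Rightarrow> real \<Rightarrow> complex" where
  "wave k x = exp (\<i> * of_int k * of_real x)"

lemma exp_neg_eq_wave: "exp (- \<i> * of_int k * of_real x) = wave (- k) x"
  by (simp add: wave_def)

lemma wave_mult: "wave j x * wave k x = wave (j + k) x"
  by (simp add: wave_def exp_add[symmetric] algebra_simps)

lemma wave_0 [simp]: "wave 0 x = 1"
  by (simp add: wave_def)

lemma wave_conv_cis: "wave k x = cis (of_int k * x)"
  by (simp add: wave_def cis_conv_exp mult_ac)

lemma norm_wave [simp]: "norm (wave k x) = 1"
  by (simp add: wave_conv_cis)

lemma cnj_wave: "cnj (wave k x) = wave (- k) x"
  by (simp add: wave_conv_cis cis_cnj)

lemma wave_period: "wave k (x + 2 * pi) = wave k x"
proof -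
  have "cis (2 * pi * of_int k) = 1" by (rule cis_multiple_2pi) simp
  then show ?thesis by (simp add: wave_conv_cis distrib_left cis_mult[symmetric] mult_ac)
qed

lemma continuous_on_wave [continuous_intros]: "continuous_on S f \<Longrightarrow> continuous_on S (\<lambda>x. wave k (f x))"
  unfolding wave_def by (intro continuous_intros)

lemma wave_measurable [measurable]: "wave k \<in> borel_measurable borel"
  by (intro borel_measurable_continuous_onI) (auto intro!: continuous_intros)

lemma wave_has_vector_derivative:
  "(wave k has_vector_derivative \<i> * of_int k * wave k x) (at x within S)"
  unfolding wave_def[abs_def]
  by (rule has_vector_derivative_real_field) (auto intro!: derivative_eq_intros)

lemma torus_sets [measurable]: "torus \<in> sets lborel"
  by (simp add: torus_def)

lemma set_integrable_torus_continuous: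
  "continuous_on torus f \<Longrightarrow> set_integrable lborel torus (f :: real \<Rightarrow> 'b::{banach, second_countable_topology})"
  unfolding torus_def by (rule borel_integrable_atLeastAtMost')

lemma torus_integral_eq:
  fixes f :: "real \<Rightarrow> complex"
  shows "continuous_on torus f \<Longrightarrow> (LINT x:torus|lborel. f x) = integral {0..2 * pi} f"
  using set_borel_integral_eq_integral(2)[OF set_integrable_torus_continuous] by (simp add: torus_def)

lemma integral_wave: "(LINT x:torus|lborel. wave k x) = (if k = 0 then of_real (2 * pi) else 0)"
proof (cases "k = 0")
  case True
  have "integral {0..2 * pi} (\<lambda>x. 1 :: complex) = 2 * of_real pi"
    by (simp add: scaleR_conv_of_real)
  moreover have "wave 0 = (\<lambda>x. 1)" by (simp add: fun_eq_iff)
  ultimately show ?thesis using True by (subst torus_integral_eq) (auto intro!: continuous_intros)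
next
  case False
  have I: "((\<lambda>x. \<i> * of_int k * wave k x) has_integral wave k (2 * pi) - wave k 0) {0..2 * pi}"
    by (intro fundamental_theorem_of_calculus wave_has_vector_derivative) simp
  have "wave k (2 * pi) = wave k 0" using wave_period[of k 0] by simp
  with integral_unique[OF I] have "integral {0..2 * pi} (\<lambda>x. \<i> * of_int k * wave k x) = 0"
    by (simp only: diff_self)
  then have "\<i> * of_int k * integral {0..2 * pi} (wave k) = 0" by simp
  then show ?thesis using False
    by (subst torus_integral_eq) (auto intro!: continuous_intros)
qed

text \<open>The index type is free and the frequencies \<open>n i\<close> may repeat, so that double
  and triple sums arising from products of series are covered.\<close>

lemma wave_sum_continuous:
  fixes c :: "'i \<Rightarrow> complex"
  assumes "l1 c"
  shows "continuous_on S (\<lambda>x. \<Sum>\<^sub>\<infinity>i. c i * wave (n i) x)"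
  by (rule infsum_continuous_on_dominated[OF _ _ assms]) (auto intro!: continuous_intros simp: norm_mult)

lemma bounded_on_torus:
  fixes f :: "real \<Rightarrow> complex"
  assumes "continuous_on torus f"
  obtains P where "0 < P" "\<And>x. x \<in> torus \<Longrightarrow> cmod (f x) \<le> P"
proof -
  have "compact (f ` torus)" by (rule compact_continuous_image[OF assms]) (simp add: torus_def)
  then have "bounded (f ` torus)" by (rule compact_imp_bounded)
  then show ?thesis unfolding bounded_pos using that by auto
qed

lemma wave_sum_integral:
  fixes c :: "'i \<Rightarrow> complex"
  assumes c: "l1 c" and f: "continuous_on torus f"
  shows "((\<lambda>i. c i * (LINT x:torus|lborel. wave (n i) x * f x)) has_sum
     (LINT x:torus|lborel. (\<Sum>\<^sub>\<infinity>i. c i * wave (n i) x) * f x)) UNIV"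
proof -
  obtain P where P: "0 < P" "\<And>x. x \<in> torus \<Longrightarrow> cmod (f x) \<le> P" using bounded_on_torus[OF f] by blast
  have "((\<lambda>i. integral {0..2 * pi} (\<lambda>x. c i * (wave (n i) x * f x))) has_sum
     integral {0..2 * pi} (\<lambda>x. \<Sum>\<^sub>\<infinity>i. c i * (wave (n i) x * f x))) UNIV"
  proof (rule infsum_has_integral_dominated)
    show "(\<lambda>i. cmod (c i) * P) summable_on UNIV" by (rule summable_on_cmult_left[OF c])
    show "continuous_on {0..2 * pi} (\<lambda>x. c i * (wave (n i) x * f x))" for i
      using f by (auto simp: torus_def intro!: continuous_intros)
    show "norm (c i * (wave (n i) x * f x)) \<le> cmod (c i) * P" if "x \<in> {0..2 * pi}" for i x
      using P(2)[of x] that by (auto simp: norm_mult torus_def intro!: mult_left_mono)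
  qed
  moreover have "(\<Sum>\<^sub>\<infinity>i. c i * (wave (n i) x * f x)) = (\<Sum>\<^sub>\<infinity>i. c i * wave (n i) x) * f x" for x
    by (simp add: mult.assoc[symmetric] infsum_cmult_left')
  ultimately show ?thesis
    using f by (subst (1 2) torus_integral_eq) (auto intro!: continuous_intros wave_sum_continuous c)
qed

text \<open>The coefficients are unnormalised: \<open>fourier\<close> of the sum is
  \<open>sqrt (2 * pi)\<close> times \<open>a\<close>. Products of series then become plain
  convolutions.\<close>

definition fseries :: "(int \<Rightarrow> complex) \<Rightarrow> real \<Rightarrow> complex" where
  "fseries a x = (\<Sum>\<^sub>\<infinity>k. a k * wave k x)"

lemma fseries_continuous: "l1 a \<Longrightarrow> continuous_on S (fseries a)"
  unfolding fseries_def[abs_def] by (rule wave_sum_continuous)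

lemma fseries_measurable: "l1 a \<Longrightarrow> fseries a \<in> borel_measurable borel"
  by (intro borel_measurable_continuous_onI fseries_continuous)

lemma fseries_periodic: "torus_periodic (fseries a)"
  by (simp add: torus_periodic_def fseries_def wave_period)

lemma continuous_periodic_L2:
  assumes "continuous_on UNIV f" "torus_periodic f"
  shows "f \<in> L2_torus"
  unfolding L2_torus_def
  using assms by (auto intro!: borel_measurable_continuous_onI set_integrable_torus_continuous continuous_intros
      intro: continuous_on_subset)

lemma fseries_L2: "l1 a \<Longrightarrow> fseries a \<in> L2_torus"
  by (intro continuous_periodic_L2 fseries_continuous fseries_periodic)

lemma fseries_integral:
  assumes "l1 a" "continuous_on torus f"
  shows "((\<lambda>k. a k * (LINT x:torus|lborel. wave k x * f x)) has_sum
     (LINT x:torus|lborel. fseries a x * f x)) UNIV"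
  unfolding fseries_def using wave_sum_integral[OF assms, of "\<lambda>k. k"] .

lemma fourier_fseries:
  assumes a: "l1 a"
  shows "fourier (fseries a) k = of_real (sqrt (2 * pi)) * a k"
proof -
  have "((\<lambda>j. a j * (LINT x:torus|lborel. wave j x * wave (- k) x)) has_sum
     (LINT x:torus|lborel. fseries a x * wave (- k) x)) UNIV"
    by (intro fseries_integral a continuous_intros)
  moreover have "((\<lambda>j. a j * (LINT x:torus|lborel. wave j x * wave (- k) x)) has_sum (a k * of_real (2 * pi))) UNIV"
    by (rule has_sum_finite_neutralI[where B = "{k}"]) (auto simp: wave_mult integral_wave simp del: wave_0)
  ultimately have "(LINT x:torus|lborel. fseries a x * wave (- k) x) = a k * of_real (2 * pi)"
    by (rule has_sum_unique)
  moreover have "complex_of_real (1 / sqrt (2 * pi)) * of_real (2 * pi) = of_real (sqrt (2 * pi))"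
    unfolding of_real_mult[symmetric] by (simp add: real_div_sqrt)
  ultimately have A: "fourier (fseries a) k = of_real (1 / sqrt (2 * pi)) * (a k * of_real (2 * pi))"
    and B: "complex_of_real (1 / sqrt (2 * pi)) * of_real (2 * pi) = of_real (sqrt (2 * pi))"
    unfolding fourier_def exp_neg_eq_wave by (simp_all only: mult.commute)
  have "fourier (fseries a) k = (of_real (1 / sqrt (2 * pi)) * of_real (2 * pi)) * a k"
    unfolding A by (simp only: mult_ac)
  then show ?thesis unfolding B .
qed

lemma L2_torus_integrable:
  assumes "f \<in> L2_torus"
  shows "set_integrable lborel torus f"
proof (rule set_integrable_bound)
  show "set_integrable lborel torus (\<lambda>x. 1 + (cmod (f x))\<^sup>2)"
    using assms by (intro set_integral_add(1)[OF set_integrable_torus_continuous]) (auto simp: L2_torus_def)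
  show "set_borel_measurable lborel torus f"
    using assms by (auto simp: L2_torus_def set_borel_measurable_def)
  have "t \<le> 1 + t\<^sup>2" for t :: real using zero_le_power2[of "t - 1 / 2"] by (simp add: power2_eq_square algebra_simps)
  then show "AE x in lborel. x \<in> torus \<longrightarrow> norm (f x) \<le> norm (1 + (cmod (f x))\<^sup>2)"
    by (intro always_eventually) (simp add: abs_of_nonneg add_nonneg_nonneg)
qed

lemma set_integrable_bounded_mult:
  fixes f g :: "real \<Rightarrow> complex"
  assumes f: "set_integrable lborel torus f" and g: "g \<in> borel_measurable borel" and P: "\<And>x. x \<in> torus \<Longrightarrow> cmod (g x) \<le> P"
  shows "set_integrable lborel torus (\<lambda>x. g x * f x)"
proof (rule set_integrable_bound)
  show "set_integrable lborel torus (\<lambda>x. of_real P * f x)" using f by simp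
  have "(\<lambda>x. g x * (indicator torus x *\<^sub>R f x)) \<in> borel_measurable lborel"
    by (rule borel_measurable_times) (use f g in \<open>auto simp: set_integrable_def\<close>)
  also have "(\<lambda>x. g x * (indicator torus x *\<^sub>R f x)) = (\<lambda>x. indicator torus x *\<^sub>R (g x * f x))"
    by (simp add: fun_eq_iff)
  finally show "set_borel_measurable lborel torus (\<lambda>x. g x * f x)"
    unfolding set_borel_measurable_def .
  show "AE x in lborel. x \<in> torus \<longrightarrow> norm (g x * f x) \<le> norm (complex_of_real P * f x)"
    using P by (intro always_eventually) (auto simp: norm_mult intro!: mult_right_mono order_trans[OF P])
qed

lemma wave_mult_integrable:
  assumes "set_integrable lborel torus f"
  shows "set_integrable lborel torus (\<lambda>x. wave k x * f x)"
  by (rule set_integrable_bounded_mult[OF assms, of _ 1]) auto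

section \<open>Uniqueness of Fourier coefficients\<close>

inductive trig_poly :: "(real \<Rightarrow> complex) \<Rightarrow> bool" where
  wave: "trig_poly (\<lambda>x. c * wave k x)"
| add: "trig_poly p \<Longrightarrow> trig_poly q \<Longrightarrow> trig_poly (\<lambda>x. p x + q x)"

lemma trig_poly_mult:
  assumes "trig_poly p" "trig_poly q"
  shows "trig_poly (\<lambda>x. p x * q x)"
  using assms(1)
proof induction
  case (wave c k)
  from assms(2) show ?case
  proof induction
    case (wave d j)
    have "(\<lambda>x. c * wave k x * (d * wave j x)) = (\<lambda>x. (c * d) * wave (k + j) x)"
      by (simp add: wave_mult[symmetric] mult_ac)
    then show ?case by (simp add: trig_poly.wave)
  qed (simp add: distrib_left trig_poly.add)
qed (simp add: distrib_right trig_poly.add)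

text \<open>On the circle a real-linear function is a combination of sine and cosine, hence of
  \<open>wave 1\<close> and \<open>wave (- 1)\<close>. Closure under sums and products gives all
  polynomials.\<close>

lemma trig_poly_of_polynomial:
  fixes p :: "complex \<Rightarrow> real"
  assumes "real_polynomial_function p"
  shows "trig_poly (\<lambda>x. of_real (p (cis x)))"
  using assms
proof induction
  case (linear f)
  have f: "f (cis x) = f 1 * cos x + f \<i> * sin x" for x
  proof -
    interpret f: bounded_linear f by fact
    have "cis x = cos x *\<^sub>R 1 + sin x *\<^sub>R \<i>" by (simp add: complex_eq_iff)
    then have "f (cis x) = cos x * f 1 + sin x * f \<i>" by (simp only: f.add f.scaleR) simp
    then show ?thesis by simp
  qed
  have "(\<lambda>x. complex_of_real (f (cis x))) = (\<lambda>x. (f 1 / 2 + f \<i> / (2 * \<i>)) * wave 1 x + (f 1 / 2 - f \<i> / (2 * \<i>)) * wave (- 1) x)"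
    unfolding f by (rule ext) (auto simp: wave_conv_cis complex_eq_iff field_simps)
  then show ?case by (simp add: trig_poly.add trig_poly.wave)
next
  case (const c)
  show ?case using trig_poly.wave[of "of_real c" 0] by simp
qed (auto simp: trig_poly_mult trig_poly.add)

text \<open>Orthogonality to the waves extends to trigonometric polynomials, by Stone-Weierstrass to
  continuous functions of \<open>cis x\<close>, and by dominated convergence to indicators of
  \<open>{0..x}\<close>. All integrals of \<open>h\<close> over initial segments then vanish, which
  forces \<open>h\<close> to be zero almost everywhere.\<close>

lemma fourier_zero_imp_zero_AE:
  fixes h :: "real \<Rightarrow> complex"
  assumes h: "set_integrable lborel torus h" and hm: "h \<in> borel_measurable borel"
    and zero: "\<And>k. (LINT x:torus|lborel. wave k x * h x) = 0"
  shows "AE x in lborel. x \<in> torus \<longrightarrow> h x = 0"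
proof -
  have trig: "set_integrable lborel torus (\<lambda>x. p x * h x) \<and> (LINT x:torus|lborel. p x * h x) = 0" if "trig_poly p" for p
    using that
  proof induction
    case (wave c k)
    have "set_integrable lborel torus (\<lambda>x. wave k x * h x)" by (rule wave_mult_integrable[OF h])
    then show ?case using zero[of k] by (simp add: mult.assoc)
  qed (auto simp: distrib_right set_integral_add)
  define N where "N = (LINT x:torus|lborel. cmod (h x))"
  have hn: "set_integrable lborel torus (\<lambda>x. cmod (h x))" using h by (rule set_integrable_norm)
  have N: "0 \<le> N" unfolding N_def set_lebesgue_integral_def by (rule integral_nonneg_AE) auto
  have cont: "(LINT x:torus|lborel. of_real (G (cis x)) * h x) = 0" if G: "continuous_on UNIV G" for G :: "complex \<Rightarrow> real"
  proof (rule ccontr)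
    define I where "I = (LINT x:torus|lborel. of_real (G (cis x)) * h x)"
    assume "I \<noteq> 0"
    \<comment> \<open>An approximation error \<open>e\<close> changes the integral by at most
      \<open>e * N\<close>, which is below \<open>cmod I\<close>; the \<open>+ 1\<close> covers
      \<open>N = 0\<close>.\<close>
    define e where "e = cmod I / (2 * (N + 1))"
    have e: "e > 0" using \<open>I \<noteq> 0\<close> N by (simp add: e_def)
    obtain p where p: "real_polynomial_function p" "\<And>z. z \<in> sphere 0 1 \<Longrightarrow> \<bar>G z - p z\<bar> < e"
      using Stone_Weierstrass_real_polynomial_function[OF compact_sphere continuous_on_subset[OF G] e, of 0 1] by auto
    have d: "\<bar>G (cis x) - p (cis x)\<bar> \<le> e" for x using p(2)[of "cis x"] by (simp add: less_imp_le)
    have pc: "continuous_on UNIV p" using p(1)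
      by (simp add: continuous_on_polymonial_function real_polynomial_function_eq)
    have m: "(\<lambda>x. complex_of_real (f (cis x))) \<in> borel_measurable borel" if "continuous_on UNIV f" for f
      by (intro borel_measurable_continuous_onI continuous_intros continuous_on_compose2[OF that]) auto
    have i: "set_integrable lborel torus (\<lambda>x. of_real (G (cis x) - p (cis x)) * h x)"
      by (rule set_integrable_bounded_mult[OF h, of _ e]) (use m[OF continuous_on_diff[OF G pc]] d in \<open>auto simp flip: of_real_diff\<close>)
    note ip = trig[OF trig_poly_of_polynomial[OF p(1)]]
    have "(\<lambda>x. of_real (G (cis x)) * h x) = (\<lambda>x. of_real (G (cis x) - p (cis x)) * h x + of_real (p (cis x)) * h x)"
      by (simp add: algebra_simps)
    then have "I = (LINT x:torus|lborel. of_real (G (cis x) - p (cis x)) * h x)"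
      using set_integral_add(2)[OF i] ip by (simp add: I_def)
    then have "cmod I \<le> (LINT x:torus|lborel. cmod (of_real (G (cis x) - p (cis x)) * h x))"
      using set_integral_norm_bound[OF i] by simp
    also have "\<dots> \<le> (LINT x:torus|lborel. e * cmod (h x))"
      using hn d set_integrable_norm[OF i] by (intro set_integral_mono) (auto simp: norm_mult simp flip: of_real_diff intro!: mult_right_mono)
    also have "\<dots> = e * N" by (simp add: N_def)
    also have "\<dots> < cmod I" using \<open>I \<noteq> 0\<close> N by (simp add: e_def field_simps add_nonneg_pos)
    finally show False by simp
  qed
  have seg: "(LINT y:{0..x}|lborel. h y) = 0" if x: "0 \<le> x" "x < 2 * pi" for x
  proof -
    define C where "C = cis ` {0..x}"
    have C: "compact C" "C \<noteq> {}" unfolding C_def using x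
      by (auto intro!: compact_continuous_image continuous_intros)
    \<comment> \<open>Continuous cutoffs that equal 1 on the arc \<open>C\<close> and decrease to
      its indicator. The point \<open>2 * pi\<close> is a null set to be excluded, since its image
      on the circle is that of 0 and lies in the arc.\<close>
    define G where "G n z = max 0 (1 - real n * infdist z C)" for n z
    have G: "continuous_on UNIV (G n)" for n unfolding G_def by (intro continuous_intros)
    have G01: "0 \<le> G n z" "G n z \<le> 1" for n z by (auto simp: G_def infdist_nonneg)
    have lim: "(\<lambda>n. G n (cis y)) \<longlonglongrightarrow> indicator {0..x} y" if y: "y \<in> torus" "y \<noteq> 2 * pi" for y
    proof (cases "y \<le> x")
      case True
      then have "cis y \<in> C" using y by (auto simp: C_def torus_def)
      then show ?thesis using True y by (simp add: G_def torus_def)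
    next
      case False
      have "cis y \<notin> C"
      proof
        assume "cis y \<in> C"
        then obtain z where z: "0 \<le> z" "z \<le> x" "cis y = cis z" by (auto simp: C_def)
        then obtain n where n: "y = z + 2 * of_int n * pi"
          using complex_eq_iff[of "cis y" "cis z"] sin_cos_eq_iff[of y z] by auto
        have "0 < y - z" "y - z < 2 * pi" using z False y by (auto simp: torus_def)
        then have "0 < of_int n * (2 * pi)" "of_int n * (2 * pi) < 1 * (2 * pi)" using n by auto
        then have "0 < n" "of_int n < (1::real)" by (auto simp: zero_less_mult_iff)
        then show False by linarith
      qed
      then have "0 < infdist (cis y) C"
        using C infdist_pos_not_in_closed[of C "cis y"] compact_imp_closed by blast
      then obtain N where N: "1 / infdist (cis y) C < real N" using reals_Archimedean2 by blast
      have "G n (cis y) = 0" if "n \<ge> N" for n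
      proof -
        have "1 / infdist (cis y) C \<le> real n" using N that by linarith
        then show ?thesis using \<open>0 < infdist (cis y) C\<close> by (simp add: G_def field_simps max_def)
      qed
      then have "(\<lambda>n. G n (cis y)) \<longlonglongrightarrow> 0" by (intro tendsto_eventually eventually_sequentiallyI[of N])
      then show ?thesis using False by simp
    qed
    have "(\<lambda>n. LINT y|lborel. indicator torus y *\<^sub>R (of_real (G n (cis y)) * h y)) \<longlonglongrightarrow>
       (LINT y|lborel. indicator {0..x} y *\<^sub>R h y)"
    proof (rule integral_dominated_convergence[where w = "\<lambda>y. indicator torus y *\<^sub>R cmod (h y)"])
      show "integrable lborel (\<lambda>y. indicator torus y *\<^sub>R cmod (h y))" using hn by (simp add: set_integrable_def)
      show "(\<lambda>y. indicator {0..x} y *\<^sub>R h y) \<in> borel_measurable lborel" using hm by measurable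
      show "(\<lambda>y. indicator torus y *\<^sub>R (complex_of_real (G n (cis y)) * h y)) \<in> borel_measurable lborel" for n
      proof -
        have "(\<lambda>y. complex_of_real (G n (cis y))) \<in> borel_measurable borel"
          by (intro borel_measurable_continuous_onI continuous_intros continuous_on_compose2[OF G]) auto
        then show ?thesis using hm by measurable
      qed
      have "AE y in lborel. y \<noteq> 2 * pi" by (rule AE_lborel_singleton)
      then show "AE y in lborel. (\<lambda>n. indicator torus y *\<^sub>R (complex_of_real (G n (cis y)) * h y)) \<longlonglongrightarrow> indicator {0..x} y *\<^sub>R h y"
      proof eventually_elim
        case (elim y)
        show ?case
        proof (cases "y \<in> torus")
          case True
          have "(\<lambda>n. complex_of_real (G n (cis y)) * h y) \<longlonglongrightarrow> of_real (indicator {0..x} y) * h y"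
            by (intro tendsto_intros lim True elim)
          then show ?thesis using True by (simp add: scaleR_conv_of_real)
        next
          case False
          then have "y \<notin> {0..x}" using x by (auto simp: torus_def)
          then show ?thesis using False by simp
        qed
      qed
      show "AE y in lborel. norm (indicator torus y *\<^sub>R (complex_of_real (G n (cis y)) * h y)) \<le> indicator torus y *\<^sub>R cmod (h y)" for n
        using G01 by (intro always_eventually) (auto simp: norm_mult indicator_def intro!: mult_left_le_one_le)
    qed
    moreover have "(LINT y|lborel. indicator torus y *\<^sub>R (of_real (G n (cis y)) * h y)) = 0" for n
      using cont[OF G] by (simp add: set_lebesgue_integral_def)
    ultimately show ?thesis
      using LIMSEQ_unique[OF _ tendsto_const] by (fastforce simp: set_lebesgue_integral_def)
  qed
  have tail: "(LINT y|lborel. indicator {x<..} y *\<^sub>R (indicator torus y *\<^sub>R h y)) = 0" for x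
  proof -
    have T0: "(LINT y:torus|lborel. h y) = 0" using zero[of 0] by simp
    consider "x < 0" | "2 * pi \<le> x" | "0 \<le> x" "x < 2 * pi" by linarith
    then show ?thesis
    proof cases
      case 1
      then have "(\<lambda>y. indicator {x<..} y *\<^sub>R (indicator torus y *\<^sub>R h y)) = (\<lambda>y. indicator torus y *\<^sub>R h y)"
        by (auto simp: fun_eq_iff indicator_def torus_def)
      then show ?thesis using T0 by (simp add: set_lebesgue_integral_def)
    next
      case 2
      then have "(\<lambda>y. indicator {x<..} y *\<^sub>R (indicator torus y *\<^sub>R h y)) = (\<lambda>y. 0)"
        by (auto simp: fun_eq_iff indicator_def torus_def)
      then show ?thesis by simp
    next
      case 3
      then have "(\<lambda>y. indicator {x<..} y *\<^sub>R (indicator torus y *\<^sub>R h y)) = (\<lambda>y. indicator torus y *\<^sub>R h y - indicator {0..x} y *\<^sub>R h y)"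
        by (auto simp: fun_eq_iff indicator_def torus_def)
      moreover have "set_integrable lborel {0..x} h"
        by (rule set_integrable_subset[OF h]) (use 3 in \<open>auto simp: torus_def\<close>)
      ultimately show ?thesis using T0 seg[OF 3] h by (simp add: set_lebesgue_integral_def set_integrable_def)
    qed
  qed
  \<comment> \<open>Vanishing tail integrals say that the measures with densities the positive and
    the negative part of \<open>f\<close> agree on all rays \<open>{x<..}\<close>, and rays
    determine these measures.\<close>
  have real: "AE x in lborel. f x = 0"
    if f: "integrable lborel f" and t: "\<And>x. (LINT y|lborel. indicator {x<..} y *\<^sub>R f y) = 0" for f :: "real \<Rightarrow> real"
  proof -
    have [measurable]: "f \<in> borel_measurable borel" using f by auto
    define D where "D g = density lborel (\<lambda>x. ennreal (max 0 (g x)))" for g :: "real \<Rightarrow> real"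
    have em: "emeasure (D g) {x<..} = ennreal (LINT y|lborel. indicator {x<..} y *\<^sub>R max 0 (g y))"
      if g: "integrable lborel g" for g x
    proof -
      have [measurable]: "g \<in> borel_measurable borel" using g by auto
      have gi: "integrable lborel (\<lambda>y. indicator {x<..} y *\<^sub>R max 0 (g y))"
        using g by (intro integrable_mult_indicator integrable_max) auto
      have "emeasure (D g) {x<..} = (\<integral>\<^sup>+y. ennreal (max 0 (g y)) * indicator {x<..} y \<partial>lborel)"
        unfolding D_def by (rule emeasure_density) auto
      also have "\<dots> = (\<integral>\<^sup>+y. ennreal (indicator {x<..} y *\<^sub>R max 0 (g y)) \<partial>lborel)"
        by (intro nn_integral_cong) (auto simp: indicator_def)
      also have "\<dots> = ennreal (LINT y|lborel. indicator {x<..} y *\<^sub>R max 0 (g y))"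
        by (rule nn_integral_eq_integral[OF gi]) auto
      finally show ?thesis .
    qed
    have "D f = D (\<lambda>x. - f x)"
    proof (rule measure_eqI_lessThan)
      fix x
      show "emeasure (D f) {x<..} < \<infinity>" using em[OF f] by simp
      have fm: "integrable lborel (\<lambda>x. - f x)" using f by simp
      have "(LINT y|lborel. indicator {x<..} y *\<^sub>R max 0 (f y)) - (LINT y|lborel. indicator {x<..} y *\<^sub>R max 0 (- f y))
        = (LINT y|lborel. indicator {x<..} y *\<^sub>R max 0 (f y) - indicator {x<..} y *\<^sub>R max 0 (- f y))"
        using f fm by (intro Bochner_Integration.integral_diff[symmetric] integrable_mult_indicator integrable_max) auto
      also have "\<dots> = (LINT y|lborel. indicator {x<..} y *\<^sub>R f y)"
        by (intro Bochner_Integration.integral_cong) (auto simp: indicator_def)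
      finally show "emeasure (D f) {x<..} = emeasure (D (\<lambda>x. - f x)) {x<..}"
        using t[of x] em[OF f] em[OF fm] by simp
    qed (auto simp: D_def)
    \<comment> \<open>At each point at least one of the two parts is zero, so their equality makes
      both vanish.\<close>
    then have "AE x in lborel. ennreal (max 0 (f x)) = ennreal (max 0 (- f x))"
      unfolding D_def by (intro sigma_finite_measure.density_unique sigma_finite_lborel) auto
    then show ?thesis by eventually_elim (auto simp: max_def split: if_splits)
  qed
  define H where "H y = indicator torus y *\<^sub>R h y" for y
  have H: "integrable lborel H" using h by (simp add: H_def[abs_def] set_integrable_def)
  have "AE x in lborel. Re (H x) = 0"
  proof (rule real)
    show "integrable lborel (\<lambda>x. Re (H x))" using H by simp
    fix x
    have "integrable lborel (\<lambda>y. indicator {x<..} y *\<^sub>R H y)" using H by (intro integrable_mult_indicator) auto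
    from integral_Re[OF this] show "(LINT y|lborel. indicator {x<..} y *\<^sub>R Re (H y)) = 0"
      using tail[of x] by (simp add: H_def mult.assoc)
  qed
  moreover have "AE x in lborel. Im (H x) = 0"
  proof (rule real)
    show "integrable lborel (\<lambda>x. Im (H x))" using H by simp
    fix x
    have "integrable lborel (\<lambda>y. indicator {x<..} y *\<^sub>R H y)" using H by (intro integrable_mult_indicator) auto
    from integral_Im[OF this] show "(LINT y|lborel. indicator {x<..} y *\<^sub>R Im (H y)) = 0"
      using tail[of x] by (simp add: H_def mult.assoc)
  qed
  ultimately show ?thesis by eventually_elim (auto simp: H_def complex_eq_iff)
qed

lemma fseries_fourier_AE:
  assumes f: "f \<in> L2_torus" and s: "l1 (fourier f)"
  shows "torus_ae_eq f (fseries (\<lambda>k. fourier f k / of_real (sqrt (2 * pi))))"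
proof -
  define a where "a k = fourier f k / of_real (sqrt (2 * pi))" for k
  have a: "l1 a"
    using summable_on_cmult_left[OF s, of "1 / sqrt (2 * pi)"] by (simp add: a_def[abs_def] norm_divide)
  have g: "fseries a \<in> L2_torus" by (rule fseries_L2[OF a])
  have fg: "(LINT x:torus|lborel. wave k x * (f x - fseries a x)) = 0" for k
  proof -
    note w = wave_mult_integrable[OF L2_torus_integrable]
    have "fourier f (- k) = fourier (fseries a) (- k)"
      using fourier_fseries[OF a, of "- k"] by (simp add: a_def[of "- k"])
    then have "(LINT x:torus|lborel. wave k x * f x) = (LINT x:torus|lborel. wave k x * fseries a x)"
      unfolding fourier_def exp_neg_eq_wave by simp
    then show ?thesis
      unfolding right_diff_distrib by (subst set_integral_diff(2)[OF w[OF f] w[OF g]]) simp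
  qed
  have "AE x in lborel. x \<in> torus \<longrightarrow> f x - fseries a x = 0"
    using f g by (intro fourier_zero_imp_zero_AE fg set_integral_diff(1) L2_torus_integrable) (auto simp: L2_torus_def)
  then show ?thesis unfolding torus_ae_eq_def a_def[abs_def] by eventually_elim auto
qed

section \<open>The terms of the equation in Fourier variables\<close>

lemma l1_product:
  assumes "l1 f" "l1 g"
  shows "l1 (\<lambda>(i, j). f i * g j)" "(\<Sum>\<^sub>\<infinity>(i, j). f i * g j) = (\<Sum>\<^sub>\<infinity>i. f i) * (\<Sum>\<^sub>\<infinity>j. g j)"
proof -
  have "(\<lambda>(i, j). cmod (f i) * cmod (g j)) summable_on UNIV"
    using has_sum_product_nonneg[OF has_sum_infsum[OF assms(1)] has_sum_infsum[OF assms(2)]] has_sum_imp_summable by auto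
  then show s: "l1 (\<lambda>(i, j). f i * g j)" by (simp add: case_prod_unfold norm_mult)
  have "(\<Sum>\<^sub>\<infinity>(i, j). f i * g j) = (\<Sum>\<^sub>\<infinity>i. \<Sum>\<^sub>\<infinity>j. f i * g j)"
    using infsum_Sigma_banach[of "\<lambda>(i, j). f i * g j" UNIV "\<lambda>_. UNIV"] abs_summable_summable[OF s] by simp
  also have "\<dots> = (\<Sum>\<^sub>\<infinity>i. f i) * (\<Sum>\<^sub>\<infinity>j. g j)"
    by (simp add: infsum_cmult_right' infsum_cmult_left')
  finally show "(\<Sum>\<^sub>\<infinity>(i, j). f i * g j) = (\<Sum>\<^sub>\<infinity>i. f i) * (\<Sum>\<^sub>\<infinity>j. g j)" .
qed

lemma fseries_mult:
  assumes a: "l1 a" and b: "l1 b"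
  shows "fseries a x * fseries b x = (\<Sum>\<^sub>\<infinity>(i, j). (a i * b j) * wave (i + j) x)"
proof -
  have "l1 (\<lambda>k. a k * wave k x)" "l1 (\<lambda>k. b k * wave k x)" using a b by (simp_all add: norm_mult)
  from l1_product(2)[OF this] show ?thesis
    by (simp add: fseries_def wave_mult[symmetric] mult_ac case_prod_unfold)
qed

lemma cnj_fseries: "cnj (fseries a x) = fseries (\<lambda>k. cnj (a (- k))) x"
proof -
  have "cnj (fseries a x) = (\<Sum>\<^sub>\<infinity>k. cnj (a k) * wave (- k) x)"
    unfolding fseries_def by (simp add: cnj_wave flip: infsum_cnj)
  also have "\<dots> = (\<Sum>\<^sub>\<infinity>k. cnj (a (- k)) * wave k x)"
    by (rule infsum_reindex_bij_witness[where i = uminus and j = uminus]) auto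
  finally show ?thesis by (simp add: fseries_def)
qed

lemma l1_cnj_reflect: "l1 (a :: int \<Rightarrow> complex) \<Longrightarrow> l1 (\<lambda>k. cnj (a (- k)))"
  using summable_on_reindex_bij_betw[OF bij_betw_byWitness[where f = uminus and f' = uminus and A = "UNIV :: int set" and A' = UNIV],
      of "\<lambda>k. cmod (a k)"] by simp

lemma fseries_abs_sq:
  assumes a: "l1 a"
  shows "of_real ((cmod (fseries a x))\<^sup>2) = (\<Sum>\<^sub>\<infinity>(j, l). (a j * cnj (a (- l))) * wave (j + l) x)"
  unfolding complex_norm_square cnj_fseries by (rule fseries_mult[OF a l1_cnj_reflect[OF a]])

text \<open>Conjugation reflects the coefficients, so the square of the modulus is a double series
  with frequencies \<open>j + l\<close>. Integration against \<open>wave (- n)\<close> keeps the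
  diagonal \<open>l = n - j\<close>, parametrised by \<open>j\<close>.\<close>

lemma fseries_abs_sq_integral:
  assumes a: "l1 a"
  shows "(LINT x:torus|lborel. of_real ((cmod (fseries a x))\<^sup>2) * wave (- n) x) = of_real (2 * pi) * (\<Sum>\<^sub>\<infinity>j. a j * cnj (a (j - n)))"
proof -
  define c where "c = (\<lambda>(j, l). a j * cnj (a (- l)))"
  have c: "l1 c" unfolding c_def by (rule l1_product(1)[OF a l1_cnj_reflect[OF a]])
  have "((\<lambda>p. c p * (LINT x:torus|lborel. wave (fst p + snd p) x * wave (- n) x)) has_sum
     (LINT x:torus|lborel. (\<Sum>\<^sub>\<infinity>p. c p * wave (fst p + snd p) x) * wave (- n) x)) UNIV"
    by (intro wave_sum_integral c continuous_intros)
  moreover have "(\<Sum>\<^sub>\<infinity>p. c p * wave (fst p + snd p) x) = of_real ((cmod (fseries a x))\<^sup>2)" for x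
    unfolding fseries_abs_sq[OF a] by (simp add: c_def case_prod_unfold)
  moreover have "(LINT x:torus|lborel. wave (fst p + snd p) x * wave (- n) x) = (if fst p + snd p = n then of_real (2 * pi) else 0)" for p
    by (simp add: wave_mult integral_wave del: wave_0)
  ultimately have "((\<lambda>p. c p * (if fst p + snd p = n then of_real (2 * pi) else 0)) has_sum
     (LINT x:torus|lborel. of_real ((cmod (fseries a x))\<^sup>2) * wave (- n) x)) UNIV"
    by (simp only:)
  moreover have "((\<lambda>p. c p * (if fst p + snd p = n then of_real (2 * pi) else 0)) has_sum I) UNIV \<longleftrightarrow>
      ((\<lambda>p. c p * of_real (2 * pi)) has_sum I) ((\<lambda>j. (j, n - j)) ` UNIV)" for I
    by (rule has_sum_cong_neutral) auto
  moreover have "((\<lambda>p. c p * of_real (2 * pi)) has_sum I) ((\<lambda>j. (j, n - j)) ` UNIV) \<longleftrightarrow>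
      ((\<lambda>j. a j * cnj (a (j - n)) * of_real (2 * pi)) has_sum I) UNIV" for I
    by (subst has_sum_reindex) (auto simp: inj_on_def c_def o_def)
  ultimately have s: "((\<lambda>j. a j * cnj (a (j - n)) * of_real (2 * pi)) has_sum
     (LINT x:torus|lborel. of_real ((cmod (fseries a x))\<^sup>2) * wave (- n) x)) UNIV" by simp
  show "(LINT x:torus|lborel. of_real ((cmod (fseries a x))\<^sup>2) * wave (- n) x) = of_real (2 * pi) * (\<Sum>\<^sub>\<infinity>j. a j * cnj (a (j - n)))"
    using infsumI[OF s] unfolding infsum_cmult_left' by (simp only: mult.commute)
qed

text \<open>Multiplying three series gives frequencies \<open>i\<close>, \<open>j\<close> and a
  reflected third one, \<open>k - i - j\<close>. The sum stays a single sum over triples so that it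
  can be integrated termwise before it is grouped by the output frequency \<open>k\<close>.\<close>

lemma fseries_cubic:
  assumes a: "l1 a"
  shows "l1 (\<lambda>(k, i, j). a i * a j * cnj (a (i + j - k)))" 
    and "of_real ((cmod (fseries a x))\<^sup>2) * fseries a x = (\<Sum>\<^sub>\<infinity>(k, i, j). (a i * a j * cnj (a (i + j - k))) * wave k x)"
proof -
  define c where "c = (\<lambda>(i, j, l). a i * (a j * cnj (a (- l))))"
  have c: "l1 c" unfolding c_def
    using l1_product(1)[OF a l1_product(1)[OF a l1_cnj_reflect[OF a]]] by (simp add: case_prod_unfold)
  have w: "l1 (\<lambda>k. a k * wave k x)" "l1 (\<lambda>(j, l). (a j * cnj (a (- l))) * wave (j + l) x)"
    using a l1_product(1)[OF a l1_cnj_reflect[OF a]] by (simp_all add: norm_mult case_prod_unfold)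
  have bij: "bij (\<lambda>(k, i, j). (i, j, k - i - j :: int))"
    by (rule bij_betw_byWitness[where f' = "\<lambda>(i, j, l). (i + j + l, i, j)"]) auto
  have "(\<lambda>p. cmod (c ((\<lambda>(k, i, j). (i, j, k - i - j)) p))) summable_on UNIV"
    by (subst summable_on_reindex_bij_betw[OF bij]) (rule c)
  then show "l1 (\<lambda>(k, i, j). a i * a j * cnj (a (i + j - k)))"
    by (simp add: c_def case_prod_unfold algebra_simps)
  have "fseries a x * of_real ((cmod (fseries a x))\<^sup>2) = (\<Sum>\<^sub>\<infinity>(i, j, l). c (i, j, l) * wave (i + j + l) x)"
    using l1_product(2)[OF w] unfolding fseries_abs_sq[OF a] 
    by (simp add: fseries_def c_def case_prod_unfold wave_mult[symmetric] mult_ac)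
  also have "\<dots> = (\<Sum>\<^sub>\<infinity>p. (\<lambda>(i, j, l). c (i, j, l) * wave (i + j + l) x) ((\<lambda>(k, i, j). (i, j, k - i - j)) p))"
    by (rule infsum_reindex_bij_betw[OF bij, symmetric])
  also have "\<dots> = (\<Sum>\<^sub>\<infinity>(k, i, j). (a i * a j * cnj (a (i + j - k))) * wave k x)"
    by (simp add: c_def case_prod_unfold algebra_simps)
  finally show "of_real ((cmod (fseries a x))\<^sup>2) * fseries a x = (\<Sum>\<^sub>\<infinity>(k, i, j). (a i * a j * cnj (a (i + j - k))) * wave k x)"
    by (simp add: mult.commute)
qed

text \<open>A pointwise bound with an explicit constant, so that one \<open>m\<close> serves all
  times of a curve. Any part of the rate \<open>r\<close> can be traded for summability or for
  powers of the frequency.\<close>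

definition decay :: "real \<Rightarrow> real \<Rightarrow> (int \<Rightarrow> complex) \<Rightarrow> bool" where
  "decay m r a \<longleftrightarrow> (\<forall>k. cmod (a k) \<le> m * exp (- (r * \<bar>real_of_int k\<bar>)))"

lemma decay_nonneg: "decay m r a \<Longrightarrow> 0 \<le> m"
  unfolding decay_def by (metis abs_zero exp_zero minus_zero mult.right_neutral mult_zero_right norm_ge_zero of_int_0 order_trans)

lemma decay_bound: "decay m r a \<Longrightarrow> 0 \<le> r \<Longrightarrow> cmod (a k) \<le> m"
  using mult_left_le[of "exp (- (r * \<bar>real_of_int k\<bar>))" m] decay_nonneg[of m r a]
  unfolding decay_def by (metis (no_types, opaque_lifting) abs_ge_zero exp_le_one_iff mult_nonneg_nonneg neg_le_0_iff_le order_trans)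

lemma decay_l1: "decay m r a \<Longrightarrow> 0 < r \<Longrightarrow> l1 a"
  by (rule summable_on_comparison_test[OF summable_on_cmult_right[OF summable_on_exp_neg_abs]])
     (auto simp: decay_def)

text \<open>Only half of each decay rate is kept. The other halves combine to
  \<open>exp (- (r / 2 * freq k i j))\<close>, which absorbs a multiplier of linear growth in
  \<open>freq\<close> at the price of \<open>2 / r\<close>.\<close>

definition cubic_majorant :: "real \<Rightarrow> real \<Rightarrow> int \<Rightarrow> int \<Rightarrow> int \<Rightarrow> real" where
  "cubic_majorant m r k i j = m * exp (- (r / 2 * \<bar>real_of_int i\<bar>)) * (m * exp (- (r / 2 * \<bar>real_of_int j\<bar>))) *
     (m * exp (- (r / 2 * \<bar>real_of_int (i + j - k)\<bar>)))"

lemma cubic_majorant_summable: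
  assumes "0 < r" "0 \<le> m"
  shows "(\<lambda>(k, i, j). cubic_majorant m r k i j) summable_on UNIV"
    "(\<lambda>(i, j). cubic_majorant m r k i j) summable_on UNIV"
    "(\<lambda>k. \<Sum>\<^sub>\<infinity>(i, j). cubic_majorant m r k i j) summable_on UNIV"
proof -
  define b where "b k = complex_of_real (m * exp (- (r / 2 * \<bar>real_of_int k\<bar>)))" for k
  have "l1 b" unfolding b_def using assms
    by (simp add: norm_mult summable_on_cmult_right summable_on_exp_neg_abs[of "r / 2", simplified])
  from fseries_cubic(1)[OF this] show s: "(\<lambda>(k, i, j). cubic_majorant m r k i j) summable_on UNIV"
    using assms by (simp add: b_def cubic_majorant_def norm_mult case_prod_unfold)
  have ss: "(\<lambda>(k, ij). case ij of (i, j) \<Rightarrow> cubic_majorant m r k i j) summable_on (SIGMA k:UNIV. UNIV)"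
    using s by simp
  show t: "(\<lambda>(i, j). cubic_majorant m r k i j) summable_on UNIV" for k
    using summable_on_SigmaD1[OF ss, of k] by (auto simp: cubic_majorant_def assms case_prod_unfold)
  show "(\<lambda>k. \<Sum>\<^sub>\<infinity>(i, j). cubic_majorant m r k i j) summable_on UNIV"
    using summable_on_SigmaD[OF ss] t by simp
qed

lemma cubic_le_majorant:
  assumes a: "decay m r a" and r: "0 < r" and g: "0 \<le> g1" "0 \<le> g2"
    and G: "cmod (G k i j) \<le> g1 + g2 * freq k i j"
  shows "cmod (G k i j * a i * a j * cnj (a (i + j - k))) \<le> (g1 + g2 * (2 / r)) * cubic_majorant m r k i j"
proof -
  note m = decay_nonneg[OF a]
  have "cmod (G k i j * a i * a j * cnj (a (i + j - k))) = cmod (G k i j) * (cmod (a i) * cmod (a j) * cmod (a (i + j - k)))"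
    by (simp add: norm_mult)
  also have "\<dots> \<le> (g1 + g2 * freq k i j) * ((m * exp (- (r * \<bar>real_of_int i\<bar>))) * (m * exp (- (r * \<bar>real_of_int j\<bar>))) * (m * exp (- (r * \<bar>real_of_int (i + j - k)\<bar>))))"
    using a m g freq_nonneg[of k i j] by (intro mult_mono G mult_nonneg_nonneg add_nonneg_nonneg) (auto simp: decay_def simp del: of_int_add of_int_diff)
  also have "\<dots> = (g1 + g2 * freq k i j) * exp (- (r / 2 * freq k i j)) * cubic_majorant m r k i j"
  proof -
    have e: "exp (- (r * x)) = exp (- (r / 2 * x)) * exp (- (r / 2 * x))" for x
      by (simp add: exp_add[symmetric])
    show ?thesis unfolding freq_def cubic_majorant_def 
      by (simp only: e distrib_left minus_add_distrib exp_add) (simp add: algebra_simps)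
  qed
  also have "\<dots> \<le> (g1 + g2 * (2 / r)) * cubic_majorant m r k i j"
  proof (rule mult_right_mono)
    have "(g1 + g2 * freq k i j) * exp (- (r / 2 * freq k i j)) = g1 * exp (- (r / 2 * freq k i j)) + g2 * (freq k i j * exp (- (r / 2 * freq k i j)))"
      by (simp add: algebra_simps)
    also have "\<dots> \<le> g1 * 1 + g2 * (1 / (r / 2))"
      using g r freq_nonneg[of k i j] by (intro add_mono mult_left_mono mult_exp_neg_le) auto
    finally show "(g1 + g2 * freq k i j) * exp (- (r / 2 * freq k i j)) \<le> g1 + g2 * (2 / r)" by simp
  qed (use m in \<open>simp add: cubic_majorant_def\<close>)
  finally show ?thesis .
qed

lemma trilin_decay_summable:
  assumes a: "decay m r a" and r: "0 < r" and g: "0 \<le> g1" "0 \<le> g2"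
    and G: "\<And>k i j. cmod (G k i j) \<le> g1 + g2 * freq k i j"
  shows "l1 (\<lambda>(k, i, j). G k i j * a i * a j * cnj (a (i + j - k)))"
    and "(\<lambda>(i, j). G k i j * a i * a j * cnj (a (i + j - k))) summable_on UNIV"
    and "cmod (trilin G a a a k) \<le> (g1 + g2 * (2 / r)) * (\<Sum>\<^sub>\<infinity>(i, j). cubic_majorant m r k i j)"
proof -
  note m = decay_nonneg[OF a]
  note S = cubic_majorant_summable[OF r m]
  have le: "cmod (G k i j * a i * a j * cnj (a (i + j - k))) \<le> (g1 + g2 * (2 / r)) * cubic_majorant m r k i j" for k i j
    by (rule cubic_le_majorant[OF a r g G])
  show "l1 (\<lambda>(k, i, j). G k i j * a i * a j * cnj (a (i + j - k)))"
    by (rule summable_on_comparison_test[OF summable_on_cmult_right[OF S(1)]]) (use le in auto)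
  show "(\<lambda>(i, j). G k i j * a i * a j * cnj (a (i + j - k))) summable_on UNIV"
    by (rule summable_on_dominated(1)[OF summable_on_cmult_right[OF S(2)]]) (use le in auto)
  show "cmod (trilin G a a a k) \<le> (g1 + g2 * (2 / r)) * (\<Sum>\<^sub>\<infinity>(i, j). cubic_majorant m r k i j)"
  proof -
    have "cmod (trilin G a a a k) \<le> (\<Sum>\<^sub>\<infinity>ij. (g1 + g2 * (2 / r)) * (case ij of (i, j) \<Rightarrow> cubic_majorant m r k i j))"
      unfolding trilin_def
      by (rule summable_on_dominated(2)[OF summable_on_cmult_right[OF S(2)]]) (use le in auto)
    then show ?thesis by (simp only: infsum_cmult_right')
  qed
qed

lemma trilin_sum:
  assumes a: "decay m r a" and r: "0 < r" and g: "0 \<le> g1" "0 \<le> g2"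
    and G: "\<And>k i j. cmod (G k i j) \<le> g1 + g2 * freq k i j" and P: "\<And>k. cmod (p k) \<le> P"
  shows "(\<Sum>\<^sub>\<infinity>(k, i, j). (G k i j * a i * a j * cnj (a (i + j - k))) * p k) = (\<Sum>\<^sub>\<infinity>k. trilin G a a a k * p k)"
proof -
  have "l1 (\<lambda>(k, i, j). (G k i j * a i * a j * cnj (a (i + j - k))) * p k)"
    by (rule summable_on_comparison_test[OF summable_on_cmult_left[OF trilin_decay_summable(1)[OF a r g G], of P]])
       (auto simp: norm_mult intro!: mult_left_mono P)
  then have "(\<lambda>(k, i, j). (G k i j * a i * a j * cnj (a (i + j - k))) * p k) summable_on UNIV"
    by (rule abs_summable_summable)
  then have "(\<Sum>\<^sub>\<infinity>(k, i, j). (G k i j * a i * a j * cnj (a (i + j - k))) * p k) =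
     (\<Sum>\<^sub>\<infinity>k. \<Sum>\<^sub>\<infinity>(i, j). (G k i j * a i * a j * cnj (a (i + j - k))) * p k)"
    using infsum_Sigma_banach[of "\<lambda>(k, i, j). (G k i j * a i * a j * cnj (a (i + j - k))) * p k" UNIV "\<lambda>_. UNIV"] by simp
  also have "\<dots> = (\<Sum>\<^sub>\<infinity>k. trilin G a a a k * p k)"
    unfolding trilin_def by (simp add: infsum_cmult_left'[symmetric] case_prod_unfold)
  finally show ?thesis .
qed

text \<open>This is \<open>sqrt (2 * pi) * fourier f (- k)\<close>: the weak formulation pairs
  bilinearly, so coefficient \<open>k\<close> of the solution meets frequency \<open>- k\<close> of
  the test function.\<close>

definition wave_integral :: "(real \<Rightarrow> complex) \<Rightarrow> int \<Rightarrow> complex" where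
  "wave_integral f k = (LINT x:torus|lborel. wave k x * f x)"

lemma wave_integral_bound:
  assumes f: "continuous_on torus f" and P: "\<And>x. x \<in> torus \<Longrightarrow> cmod (f x) \<le> P"
  shows "cmod (wave_integral f k) \<le> 2 * pi * P"
proof -
  have "cmod (integral {0..2 * pi} (\<lambda>x. wave k x * f x)) \<le> P * (2 * pi - 0)"
    by (rule integral_bound) (use f P in \<open>auto simp: torus_def norm_mult intro!: continuous_intros\<close>)
  then show ?thesis unfolding wave_integral_def
    using f by (subst torus_integral_eq) (auto simp: torus_def mult_ac intro!: continuous_intros)
qed

lemma wave_integral_deriv:
  assumes d: "\<And>x. (f has_vector_derivative f' x) (at x)" and f': "continuous_on UNIV f'" and per: "torus_periodic f"
  shows "wave_integral f' k = - \<i> * of_int k * wave_integral f k"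
proof -
  have f: "continuous_on UNIV f" using d
    by (meson continuous_at_imp_continuous_on has_vector_derivative_continuous)
  have "((\<lambda>x. wave k x * f' x + \<i> * of_int k * wave k x * f x) has_integral wave k (2 * pi) * f (2 * pi) - wave k 0 * f 0) {0..2 * pi}"
    by (intro fundamental_theorem_of_calculus has_vector_derivative_mult wave_has_vector_derivative
        has_vector_derivative_at_within[OF d]) simp
  moreover have "wave k (2 * pi) * f (2 * pi) = wave k 0 * f 0"
    using wave_period[of k 0] per[unfolded torus_periodic_def, rule_format, of 0] by simp
  ultimately have "integral {0..2 * pi} (\<lambda>x. wave k x * f' x + \<i> * of_int k * wave k x * f x) = 0"
    by (simp only: integral_unique diff_self)
  also have "integral {0..2 * pi} (\<lambda>x. wave k x * f' x + \<i> * of_int k * wave k x * f x) =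
     integral {0..2 * pi} (\<lambda>x. wave k x * f' x) + integral {0..2 * pi} (\<lambda>x. \<i> * of_int k * (wave k x * f x))"
    by (subst integral_add[symmetric])
       (auto intro!: integrable_continuous_real continuous_intros continuous_on_subset[OF f] continuous_on_subset[OF f'] simp: mult_ac)
  finally have "integral {0..2 * pi} (\<lambda>x. wave k x * f' x) + \<i> * of_int k * integral {0..2 * pi} (\<lambda>x. wave k x * f x) = 0"
    by simp
  moreover have "wave_integral g k = integral {0..2 * pi} (\<lambda>x. wave k x * g x)" if "continuous_on UNIV g" for g
    unfolding wave_integral_def
    by (rule torus_integral_eq) (intro continuous_intros continuous_on_subset[OF that] subset_UNIV)
  ultimately show ?thesis using f f' by (simp add: add_eq_0_iff2)
qed

lemma torus_integral_cong_AE: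
  fixes f g :: "real \<Rightarrow> complex"
  assumes "AE x in lborel. x \<in> torus \<longrightarrow> f x = g x" "f \<in> borel_measurable borel" "g \<in> borel_measurable borel"
  shows "(LINT x:torus|lborel. f x) = (LINT x:torus|lborel. g x)"
  unfolding set_lebesgue_integral_def
  by (rule integral_cong_AE) (use assms(2,3) in measurable, use assms(1) in \<open>auto elim!: eventually_mono simp: indicator_def\<close>)

lemma fseries_wave_integral:
  assumes a: "l1 a" and f: "continuous_on torus f" 
  shows "((\<lambda>k. a k * wave_integral f k) has_sum (LINT x:torus|lborel. fseries a x * f x)) UNIV"
  unfolding wave_integral_def by (rule fseries_integral[OF a f])

lemma cubic_integral:
  assumes a: "decay m r a" and r: "0 < r" and f: "continuous_on torus f"
  shows "(LINT x:torus|lborel. of_real ((cmod (fseries a x))\<^sup>2) * fseries a x * f x) = (\<Sum>\<^sub>\<infinity>k. trilin (\<lambda>k i j. 1) a a a k * wave_integral f k)"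
proof -
  note l = decay_l1[OF a r]
  obtain P where P: "\<And>x. x \<in> torus \<Longrightarrow> cmod (f x) \<le> P" using bounded_on_torus[OF f] by blast
  have "((\<lambda>p. (\<lambda>(k, i, j). a i * a j * cnj (a (i + j - k))) p * (LINT x:torus|lborel. wave (fst p) x * f x)) has_sum
    (LINT x:torus|lborel. (\<Sum>\<^sub>\<infinity>p. (\<lambda>(k, i, j). a i * a j * cnj (a (i + j - k))) p * wave (fst p) x) * f x)) UNIV"
    by (rule wave_sum_integral[OF fseries_cubic(1)[OF l] f])
  then have "(LINT x:torus|lborel. of_real ((cmod (fseries a x))\<^sup>2) * fseries a x * f x) = 
    (\<Sum>\<^sub>\<infinity>(k, i, j). 1 * a i * a j * cnj (a (i + j - k)) * wave_integral f k)"
    unfolding fseries_cubic(2)[OF l] by (simp add: infsumI wave_integral_def case_prod_unfold)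
  then show "(LINT x:torus|lborel. of_real ((cmod (fseries a x))\<^sup>2) * fseries a x * f x) = (\<Sum>\<^sub>\<infinity>k. trilin (\<lambda>k i j. 1) a a a k * wave_integral f k)"
    using trilin_sum[OF a r, of 1 0 "\<lambda>k i j. 1" "wave_integral f" "2 * pi * P"] wave_integral_bound[OF f P] by simp
qed

lemma distr_fourier_dx_abs_sq:
  assumes v: "v \<in> borel_measurable borel" and ae: "torus_ae_eq v (fseries a)" and a: "l1 a"
  shows "distr_fourier (dx_abs_sq v) n = of_real (sqrt (2 * pi)) * (\<i> * of_int n) * (\<Sum>\<^sub>\<infinity>j. a j * cnj (a (j - n)))"
proof -
  note fm = fseries_measurable[OF a]
  have vd: "vector_derivative (wave (- n)) (at x) = - (\<i> * of_int n) * wave (- n) x" for x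
    using vector_derivative_at[OF wave_has_vector_derivative[of "- n"]] by simp
  have "distr_fourier (dx_abs_sq v) n = of_real (1 / sqrt (2 * pi)) * - (LINT x:torus|lborel. of_real ((cmod (v x))\<^sup>2) * (- (\<i> * of_int n) * wave (- n) x))"
    unfolding distr_fourier_def dx_abs_sq_def distr_deriv_def distr_of_fun_def exp_neg_eq_wave by (simp only: vd)
  also have "(LINT x:torus|lborel. of_real ((cmod (v x))\<^sup>2) * (- (\<i> * of_int n) * wave (- n) x)) =
     (LINT x:torus|lborel. - (\<i> * of_int n) * (of_real ((cmod (fseries a x))\<^sup>2) * wave (- n) x))"
    using ae v fm wave_measurable by (intro torus_integral_cong_AE) (auto simp: torus_ae_eq_def elim!: eventually_mono)
  also have "\<dots> = - (\<i> * of_int n) * (of_real (2 * pi) * (\<Sum>\<^sub>\<infinity>j. a j * cnj (a (j - n))))"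
    by (subst set_integral_mult_right) (simp only: fseries_abs_sq_integral[OF a])
  finally have "distr_fourier (dx_abs_sq v) n = of_real (1 / sqrt (2 * pi)) * of_real (2 * pi) * (\<i> * of_int n) * (\<Sum>\<^sub>\<infinity>j. a j * cnj (a (j - n)))"
    by (simp add: mult_ac)
  moreover have "complex_of_real (1 / sqrt (2 * pi)) * of_real (2 * pi) = of_real (sqrt (2 * pi))"
    unfolding of_real_mult[symmetric] by (simp add: real_div_sqrt)
  ultimately show ?thesis by (simp only:)
qed

lemma abs_diff_le_freq: "\<bar>real_of_int (k - i)\<bar> \<le> freq k i j"
  by (simp add: freq_def)

text \<open>The derivative contributes the factor \<open>\<i> * n\<close> at its own frequency
  \<open>n\<close>, while \<open>v\<close> and \<open>f\<close> contribute coefficient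
  \<open>i\<close> and \<open>wave_integral f (i + n)\<close>. Substituting \<open>k = i + n\<close>
  turns the pairing into a trilinear form with multiplier \<open>\<i> * (k - i)\<close>.\<close>

lemma sobolev_pairing_cubic:
  assumes v: "v \<in> borel_measurable borel" and ae: "torus_ae_eq v (fseries a)"
    and a: "decay m r a" and r: "0 < r" and f: "continuous_on UNIV f"
  shows "sobolev_pairing (dx_abs_sq v) (\<lambda>x. v x * f x) = (\<Sum>\<^sub>\<infinity>k. trilin (\<lambda>k i j. \<i> * of_int (k - i)) a a a k * wave_integral f k)"
proof -
  note l = decay_l1[OF a r]
  have ft: "continuous_on torus f" using f continuous_on_subset by blast
  obtain P where P: "\<And>x. x \<in> torus \<Longrightarrow> cmod (f x) \<le> P" using bounded_on_torus[OF ft] by blast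
  note fm = fseries_measurable[OF l]
  have fm': "f \<in> borel_measurable borel" using f by (rule borel_measurable_continuous_onI)
  define F where "F k i j = (\<i> * of_int (k - i) * a i * a j * cnj (a (i + j - k))) * wave_integral f k" for k i j
  have b: "((\<lambda>i. a i * wave_integral f (i + n)) has_sum of_real (sqrt (2 * pi)) * fourier (\<lambda>x. v x * f x) (- n)) UNIV" for n
  proof -
    have "((\<lambda>i. a i * (LINT x:torus|lborel. wave i x * (wave n x * f x))) has_sum (LINT x:torus|lborel. fseries a x * (wave n x * f x))) UNIV"
      by (intro fseries_integral l continuous_intros ft)
    moreover have "(LINT x:torus|lborel. fseries a x * (wave n x * f x)) = (LINT x:torus|lborel. wave n x * (v x * f x))"
      using ae v fm wave_measurable fm' by (intro torus_integral_cong_AE) (auto simp: torus_ae_eq_def mult_ac elim!: eventually_mono)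
    moreover have "of_real (sqrt (2 * pi)) * fourier (\<lambda>x. v x * f x) (- n) = (LINT x:torus|lborel. wave n x * (v x * f x))"
      unfolding fourier_def exp_neg_eq_wave by simp
    ultimately show ?thesis by (simp add: wave_integral_def wave_mult mult.assoc[symmetric])
  qed
  have prod: "distr_fourier (dx_abs_sq v) n * fourier (\<lambda>x. v x * f x) (- n) = (\<Sum>\<^sub>\<infinity>(i, j). F (i + n) i j)" for n
  proof -
    have "l1 (\<lambda>j. a j * cnj (a (j - n)))" "l1 (\<lambda>i. a i * wave_integral f (i + n))"
    proof -
      show "l1 (\<lambda>i. a i * wave_integral f (i + n))"
        by (rule summable_on_comparison_test[OF summable_on_cmult_left[OF l, of "2 * pi * P"]])
           (auto simp: norm_mult intro!: mult_left_mono wave_integral_bound ft P)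
      show "l1 (\<lambda>j. a j * cnj (a (j - n)))"
        by (rule summable_on_comparison_test[OF summable_on_cmult_left[OF l, of m]])
           (use r in \<open>auto simp: norm_mult intro!: mult_left_mono decay_bound[OF a]\<close>)
    qed
    from l1_product(2)[OF this(2,1)]
    have "(\<Sum>\<^sub>\<infinity>(i, j). \<i> * of_int n * ((a i * wave_integral f (i + n)) * (a j * cnj (a (j - n))))) = 
      \<i> * of_int n * ((\<Sum>\<^sub>\<infinity>j. a j * cnj (a (j - n))) * (of_real (sqrt (2 * pi)) * fourier (\<lambda>x. v x * f x) (- n)))"
      using infsumI[OF b[of n]] by (simp add: case_prod_unfold infsum_cmult_right' mult_ac)
    then show ?thesis
      unfolding distr_fourier_dx_abs_sq[OF v ae l] F_def by (simp add: case_prod_unfold mult_ac)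
  qed
  have bij: "bij (\<lambda>(n, i, j). (i + n :: int, i :: int, j :: int))"
    by (rule bij_betw_byWitness[where f' = "\<lambda>(k, i, j). (k - i, i, j)"]) auto
  have G: "cmod (\<i> * of_int (k - i)) \<le> 0 + 1 * freq k i j" for k i j
    using abs_diff_le_freq[of k i j] by (simp add: norm_mult del: of_int_diff)
  have Fs: "(\<lambda>(k, i, j). F k i j) summable_on UNIV"
  proof (rule abs_summable_summable)
    show "l1 (\<lambda>(k, i, j). F k i j)"
      by (rule summable_on_comparison_test[OF summable_on_cmult_left[OF trilin_decay_summable(1)[OF a r _ _ G], of "2 * pi * P"]])
         (auto simp: F_def norm_mult intro!: mult_left_mono wave_integral_bound ft P)
  qed
  then have Fs': "(\<lambda>(n, i, j). F (i + n) i j) summable_on UNIV"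
    using summable_on_reindex_bij_betw[OF bij, of "\<lambda>(k, i, j). F k i j"] by (simp add: case_prod_unfold)
  have "sobolev_pairing (dx_abs_sq v) (\<lambda>x. v x * f x) = (\<Sum>\<^sub>\<infinity>n. \<Sum>\<^sub>\<infinity>(i, j). F (i + n) i j)"
    unfolding sobolev_pairing_def prod ..
  also have "\<dots> = (\<Sum>\<^sub>\<infinity>(n, i, j). F (i + n) i j)"
    using infsum_Sigma_banach[of "\<lambda>(n, i, j). F (i + n) i j" UNIV "\<lambda>_. UNIV"] Fs' by simp
  also have "\<dots> = (\<Sum>\<^sub>\<infinity>(k, i, j). F k i j)"
    using infsum_reindex_bij_betw[OF bij, of "\<lambda>(k, i, j). F k i j"] by (simp add: case_prod_unfold)
  also have "\<dots> = (\<Sum>\<^sub>\<infinity>k. trilin (\<lambda>k i j. \<i> * of_int (k - i)) a a a k * wave_integral f k)"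
    unfolding F_def by (rule trilin_sum[OF a r _ _ G wave_integral_bound[OF ft P]]) auto
  finally show ?thesis .
qed

section \<open>Half-open time intervals and test functions\<close>

lemma periodic_derivative:
  assumes "torus_periodic f" "\<And>x. (f has_vector_derivative f' x) (at x)"
  shows "torus_periodic f'"
  unfolding torus_periodic_def
proof
  fix x
  have "((\<lambda>x. x + 2 * pi) has_vector_derivative 1) (at x)"
    by (auto intro!: derivative_eq_intros)
  from vector_diff_chain_at[OF this assms(2)]
  have "(f has_vector_derivative f' (x + 2 * pi)) (at x)"
    using assms(1) by (simp add: o_def torus_periodic_def)
  then show "f' (x + 2 * pi) = f' x"
    using assms(2) vector_derivative_unique_at by blast
qed

text \<open>Both half-open intervals are treated at once. The sign \<open>\<sigma>\<close> is that
  of the initial term in the weak equation, and multiplication by \<open>\<sigma>\<close> maps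
  \<open>I\<close> onto \<open>{0..<T}\<close>.\<close>

locale half_interval =
  fixes T \<sigma> :: real and I :: "real set"
  assumes T: "0 < T" and I: "\<sigma> = 1 \<and> I = {0..<T} \<or> \<sigma> = -1 \<and> I = {-T<..0}"
begin

definition seg :: "real \<Rightarrow> real set" where
  "seg b = (if \<sigma> = 1 then {0..b} else {-b..0})"

lemma zero_in: "0 \<in> I"
  using I T by auto

lemma seg_subset: "b < T \<Longrightarrow> seg b \<subseteq> I"
  using I by (auto simp: seg_def)

lemma seg_iff: "0 \<le> b \<Longrightarrow> b < T \<Longrightarrow> t \<in> seg b \<longleftrightarrow> t \<in> I \<and> \<bar>t\<bar> \<le> b"
  using I by (auto simp: seg_def)

lemma compact_seg: "compact (seg b)"
  by (simp add: seg_def)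

lemma sets_I [measurable]: "I \<in> sets borel"
  using I by auto

lemma within_neq_bot: "t \<in> I \<Longrightarrow> at t within I \<noteq> bot"
proof -
  have "connected I" using I by auto
  moreover have "I \<noteq> {t}" for t
  proof -
    have "\<sigma> * T / 2 \<in> I" "\<sigma> * T / 2 \<noteq> 0" using I T by auto
    then show ?thesis using zero_in by auto
  qed
  ultimately show "t \<in> I \<Longrightarrow> at t within I \<noteq> bot"
    using connected_imp_perfect trivial_limit_within by blast
qed

lemma vector_derivative_within_I:
  "t \<in> I \<Longrightarrow> (f has_vector_derivative f') (at t within I) \<Longrightarrow> vector_derivative f (at t within I) = f'"
  using within_neq_bot by (rule vector_derivative_within)

text \<open>The bound is strict, so that a function supported in \<open>K\<close> already vanishes
  where \<open>\<bar>t\<bar> = b\<close>, in particular at the outer end of the segment.\<close>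

lemma compact_subset_seg:
  assumes "compact K" "K \<subseteq> I"
  obtains b where "0 < b" "b < T" "K \<subseteq> seg b" "\<And>t. t \<in> K \<Longrightarrow> \<bar>t\<bar> < b"
proof -
  have "\<exists>c. 0 \<le> c \<and> c < T \<and> (\<forall>t\<in>K. \<bar>t\<bar> \<le> c)"
  proof (cases "K = {}")
    case False
    have "continuous_on K abs" by (intro continuous_intros)
    then obtain t0 where t0: "t0 \<in> K" "\<And>t. t \<in> K \<Longrightarrow> \<bar>t\<bar> \<le> \<bar>t0\<bar>"
      using continuous_attains_sup[OF assms(1) False] by blast
    have "\<bar>t0\<bar> < T" using t0(1) assms(2) I by auto
    then show ?thesis using t0 by (intro exI[of _ "\<bar>t0\<bar>"]) auto
  qed (use T in auto)
  then obtain c where c: "0 \<le> c" "c < T" "\<And>t. t \<in> K \<Longrightarrow> \<bar>t\<bar> \<le> c" by blast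
  define b where "b = (c + T) / 2"
  have b: "0 < b" "b < T" "c < b" using c T by (auto simp: b_def)
  have lt: "\<bar>t\<bar> < b" if "t \<in> K" for t using c(3)[OF that] b by simp
  then have "K \<subseteq> seg b" using seg_iff[of b] b assms(2) less_imp_le by (metis subsetD subsetI)
  with b lt show ?thesis using that by blast
qed

lemma integral_supported:
  fixes f :: "real \<Rightarrow> complex"
  assumes f: "continuous_on I f" and b: "0 \<le> b" "b < T" and z: "\<And>t. t \<in> I \<Longrightarrow> b \<le> \<bar>t\<bar> \<Longrightarrow> f t = 0"
  shows "set_integrable lborel I f" "(LINT t:I|lborel. f t) = integral (seg b) f"
proof -
  have eq: "(\<lambda>t. indicator I t *\<^sub>R f t) = (\<lambda>t. indicator (seg b) t *\<^sub>R f t)"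
    using z seg_iff[OF b] by (force simp: fun_eq_iff indicator_def)
  have c: "continuous_on (seg b) f" using f seg_subset[OF b(2)] continuous_on_subset by blast
  have s: "set_integrable lborel (seg b) f"
    using c unfolding seg_def by (auto intro!: borel_integrable_atLeastAtMost')
  then show "set_integrable lborel I f" unfolding set_integrable_def eq .
  have "(LINT t:I|lborel. f t) = (LINT t:seg b|lborel. f t)"
    unfolding set_lebesgue_integral_def eq ..
  also have "\<dots> = integral (seg b) f" by (rule set_borel_integral_eq_integral(2)[OF s])
  finally show "(LINT t:I|lborel. f t) = integral (seg b) f" .
qed

text \<open>The boundary value at the outer end vanishes and only the one at 0 survives. Its sign is
  negative if 0 is the left end of the segment and positive if it is the right end; hence the factor
  \<open>- \<sigma>\<close>.\<close>

lemma integral_derivative: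
  fixes W :: "real \<Rightarrow> complex"
  assumes d: "\<And>t. t \<in> I \<Longrightarrow> (W has_vector_derivative W' t) (at t within I)"
    and b: "0 \<le> b" "b < T" and z: "\<And>t. t \<in> I \<Longrightarrow> b \<le> \<bar>t\<bar> \<Longrightarrow> W t = 0"
  shows "(W' has_integral - of_real \<sigma> * W 0) (seg b)"
proof -
  have d': "(W has_vector_derivative W' t) (at t within seg b)" if "t \<in> seg b" for t
    using d[of t] seg_subset[OF b(2)] that has_vector_derivative_within_subset by blast
  show ?thesis
  proof (cases "\<sigma> = 1")
    case True
    have sg: "seg b = {0..b}" unfolding seg_def using True by simp
    have "W b = 0" by (rule z) (use I b True in auto)
    then show ?thesis
      using fundamental_theorem_of_calculus[OF b(1), of W W'] d' True unfolding sg by simp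
  next
    case False
    have sg: "seg b = {-b..0}" unfolding seg_def using False by simp
    have "W (- b) = 0" by (rule z) (use I b False in auto)
    then show ?thesis
      using fundamental_theorem_of_calculus[of "- b" 0 W W'] b d' False I unfolding sg by auto
  qed
qed

definition smooth :: "(real \<Rightarrow> real \<Rightarrow> complex) \<Rightarrow> bool" where
  "smooth \<phi> \<longleftrightarrow> (\<forall>n. C_k n I \<phi>)"

abbreviation jcont :: "(real \<Rightarrow> real \<Rightarrow> complex) \<Rightarrow> bool" where
  "jcont \<phi> \<equiv> continuous_on (I \<times> UNIV) (\<lambda>p. \<phi> (fst p) (snd p))"

lemma smooth_continuous: "smooth \<phi> \<Longrightarrow> jcont \<phi>"
  unfolding smooth_def using C_k.simps(1)[of I \<phi>] by (simp add: case_prod_unfold del: C_k.simps)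

lemma smooth_d_t: "smooth \<phi> \<Longrightarrow> smooth (d_t I \<phi>)"
  and smooth_d_x: "smooth \<phi> \<Longrightarrow> smooth (d_x \<phi>)"
  unfolding smooth_def by (meson C_k.simps(2))+

lemma smooth_has_d_t: "smooth \<phi> \<Longrightarrow> t \<in> I \<Longrightarrow> ((\<lambda>\<tau>. \<phi> \<tau> x) has_vector_derivative d_t I \<phi> t x) (at t within I)"
  and smooth_has_d_x: "smooth \<phi> \<Longrightarrow> t \<in> I \<Longrightarrow> (\<phi> t has_vector_derivative d_x \<phi> t x) (at x)"
  unfolding smooth_def d_t_def d_x_def
  by (metis C_k.simps(2) vector_derivative_works)+

lemma jcont_slice:
  assumes "jcont \<phi>" "t \<in> I"
  shows "continuous_on UNIV (\<phi> t)"
proof -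
  have "continuous_on UNIV (\<lambda>x::real. (t, x))" by (intro continuous_intros)
  from continuous_on_compose2[OF assms(1) this] assms(2) show ?thesis by auto
qed

lemma test_function:
  assumes "\<phi> \<in> test_functions I"
  shows test_smooth: "smooth \<phi>" and test_periodic: "\<And>t. t \<in> I \<Longrightarrow> torus_periodic (\<phi> t)"
    and "\<exists>b. 0 < b \<and> b < T \<and> (\<forall>t\<in>I. b \<le> \<bar>t\<bar> \<longrightarrow> (\<forall>x. \<phi> t x = 0 \<and> d_t I \<phi> t x = 0))"
proof -
  show s: "smooth \<phi>" and "\<And>t. t \<in> I \<Longrightarrow> torus_periodic (\<phi> t)"
    using assms by (auto simp: test_functions_def smooth_def)
  obtain K where K: "compact K" "K \<subseteq> I" "\<And>t x. t \<in> I \<Longrightarrow> t \<notin> K \<Longrightarrow> \<phi> t x = 0"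
    using assms unfolding test_functions_def by blast
  obtain b where b: "0 < b" "b < T" "\<And>t. t \<in> K \<Longrightarrow> \<bar>t\<bar> < b"
    using compact_subset_seg[OF K(1,2)] by metis
  have "\<phi> t x = 0 \<and> d_t I \<phi> t x = 0" if t: "t \<in> I" "b \<le> \<bar>t\<bar>" for t x
  proof
    have tK: "t \<notin> K" using b(3) t by force
    then show "\<phi> t x = 0" using K t by blast
    have "open (- K)" using K(1) compact_imp_closed by blast
    \<comment> \<open>The complement of the support is open, so the function vanishes at all times
      of \<open>I\<close> near \<open>t\<close>, and the derivative within \<open>I\<close> vanishes
      too.\<close>
    then obtain e where e: "0 < e" "ball t e \<subseteq> - K" using tK open_contains_ball by blast
    have "((\<lambda>\<tau>. \<phi> \<tau> x) has_vector_derivative 0) (at t within I)"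
    proof (rule has_vector_derivative_transform_within[OF has_vector_derivative_const e(1) t(1)])
      fix s assume "s \<in> I" "dist s t < e"
      then have "s \<in> ball t e" by (simp add: dist_commute)
      then have "s \<notin> K" using e(2) by blast
      then show "0 = \<phi> s x" using K(3) \<open>s \<in> I\<close> by simp
    qed
    then show "d_t I \<phi> t x = 0" unfolding d_t_def by (rule vector_derivative_within_I[OF t(1)])
  qed
  with b show "\<exists>b. 0 < b \<and> b < T \<and> (\<forall>t\<in>I. b \<le> \<bar>t\<bar> \<longrightarrow> (\<forall>x. \<phi> t x = 0 \<and> d_t I \<phi> t x = 0))" by blast
qed

lemma jcont_bounded:
  assumes s: "jcont \<phi>" and b: "0 < b" "b < T" and z: "\<And>t x. t \<in> I \<Longrightarrow> b \<le> \<bar>t\<bar> \<Longrightarrow> \<phi> t x = 0"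
  obtains P where "0 < P" "\<And>t x. t \<in> I \<Longrightarrow> x \<in> torus \<Longrightarrow> cmod (\<phi> t x) \<le> P"
proof -
  have "continuous_on (seg b \<times> torus) (\<lambda>p. \<phi> (fst p) (snd p))"
    by (rule continuous_on_subset[OF s]) (use seg_subset[OF b(2)] in auto)
  then have "bounded ((\<lambda>p. \<phi> (fst p) (snd p)) ` (seg b \<times> torus))"
    by (intro compact_imp_bounded compact_continuous_image compact_Times compact_seg) (simp_all add: torus_def)
  then obtain P where P: "0 < P" "\<And>t x. t \<in> seg b \<Longrightarrow> x \<in> torus \<Longrightarrow> cmod (\<phi> t x) \<le> P"
    unfolding bounded_pos by force
  have "cmod (\<phi> t x) \<le> P" if "t \<in> I" "x \<in> torus" for t x
    using P z[of t x] that seg_iff[of b t] b by (cases "\<bar>t\<bar> \<le> b") auto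
  with P(1) show ?thesis using that by blast
qed

lemma wave_integral_continuous:
  assumes s: "jcont \<phi>"
  shows "continuous_on I (\<lambda>t. wave_integral (\<phi> t) k)"
proof -
  have c: "continuous_on (I \<times> cbox 0 (2 * pi)) (\<lambda>p. wave k (snd p) * \<phi> (fst p) (snd p))"
    by (intro continuous_intros continuous_on_subset[OF s]) auto
  from c have "continuous_on I (\<lambda>t. integral (cbox 0 (2 * pi)) (\<lambda>x. wave k x * \<phi> t x))"
    by (intro integral_continuous_on_param) (simp add: case_prod_unfold)
  moreover have "wave_integral (\<phi> t) k = integral (cbox 0 (2 * pi)) (\<lambda>x. wave k x * \<phi> t x)" if "t \<in> I" for t
    unfolding wave_integral_def
    by (subst torus_integral_eq) (auto intro!: continuous_intros continuous_on_subset[OF jcont_slice[OF s that]])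
  ultimately show ?thesis by (simp cong: continuous_on_cong)
qed

lemma wave_integral_has_d_t:
  assumes s: "smooth \<phi>" and t: "t \<in> I"
  shows "((\<lambda>t. wave_integral (\<phi> t) k) has_vector_derivative wave_integral (d_t I \<phi> t) k) (at t within I)"
proof -
  have eq: "wave_integral (\<psi> t) k = integral (cbox 0 (2 * pi)) (\<lambda>x. wave k x * \<psi> t x)" if "smooth \<psi>" "t \<in> I" for \<psi> t
    unfolding wave_integral_def
    by (subst torus_integral_eq) (auto intro!: continuous_intros continuous_on_subset[OF jcont_slice[OF smooth_continuous, OF that]])
  note c = smooth_continuous[OF smooth_d_t[OF s]]
  have "((\<lambda>t. integral (cbox 0 (2 * pi)) (\<lambda>x. wave k x * \<phi> t x)) has_vector_derivative
      integral (cbox 0 (2 * pi)) (\<lambda>x. wave k x * d_t I \<phi> t x)) (at t within I)"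
  proof (rule leibniz_rule_vector_derivative)
    show "((\<lambda>t. wave k x * \<phi> t x) has_vector_derivative wave k x * d_t I \<phi> t x) (at t within I)" if "t \<in> I" for t x
      by (intro has_vector_derivative_mult_right smooth_has_d_t s that)
    show "(\<lambda>x. wave k x * \<phi> t x) integrable_on cbox 0 (2 * pi)" if "t \<in> I" for t
      by (intro integrable_continuous continuous_intros continuous_on_subset[OF jcont_slice[OF smooth_continuous[OF s] that]]) auto
    show "continuous_on (I \<times> cbox 0 (2 * pi)) (\<lambda>(t, x). wave k x * d_t I \<phi> t x)"
      unfolding case_prod_unfold by (intro continuous_intros continuous_on_subset[OF c]) auto
    show "convex I" using I by auto
  qed (rule t)
  then show ?thesis
    unfolding eq[OF smooth_d_t[OF s] t]
    by (rule has_vector_derivative_transform[OF t, rotated]) (simp add: eq[OF s])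
qed

end

section \<open>Bump functions\<close>

text \<open>An infinite chain of derivatives, read as a greatest fixed point: to establish
  smoothness it suffices to exhibit a class of functions closed under differentiation.\<close>

coinductive smooth_fun :: "(real \<Rightarrow> real) \<Rightarrow> bool" where
  "(\<And>t. (g has_real_derivative g' t) (at t)) \<Longrightarrow> smooth_fun g' \<Longrightarrow> smooth_fun g"

text \<open>The classical function \<open>exp (- 1 / x)\<close>, flat at 0. The polynomial in
  \<open>1 / x\<close> is left arbitrary so that differentiation stays in the class: with
  \<open>y = 1 / x\<close> it replaces \<open>p\<close> by \<open>y ^ 2 * (p - p')\<close>.\<close>

definition flat :: "real poly \<Rightarrow> real \<Rightarrow> real" where
  "flat p x = (if x > 0 then poly p (1 / x) * exp (- (1 / x)) else 0)"

lemma poly_exp_tendsto_0: "((\<lambda>y. poly p y * exp (- y)) \<longlongrightarrow> 0) at_top" for p :: "real poly"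
proof -
  have "((\<lambda>y. \<Sum>i\<le>degree p. coeff p i * (y ^ i / exp y)) \<longlongrightarrow> (\<Sum>i\<le>degree p. coeff p i * 0)) at_top"
    by (intro tendsto_intros tendsto_power_div_exp_0)
  then show ?thesis
    by (simp add: poly_altdef exp_minus field_simps sum_distrib_left sum_divide_distrib)
qed

lemma flat_tendsto_0: "((\<lambda>h. flat p h / h) \<longlongrightarrow> 0) (at 0)"
proof -
  \<comment> \<open>\<open>pCons 0 p\<close> is \<open>p\<close> multiplied by its variable, here
    \<open>1 / h\<close>; this accounts for the division by \<open>h\<close>.\<close>
  have "((\<lambda>h. poly (pCons 0 p) (inverse h) * exp (- inverse h)) \<longlongrightarrow> 0) (at_right (0::real))"
    by (rule filterlim_compose[OF poly_exp_tendsto_0 filterlim_inverse_at_top_right])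
  moreover have "\<forall>\<^sub>F h in at_right 0. poly (pCons 0 p) (inverse h) * exp (- inverse h) = flat p h / h"
    by (auto simp: eventually_at_filter flat_def field_simps)
  ultimately have "((\<lambda>h. flat p h / h) \<longlongrightarrow> 0) (at_right 0)"
    using tendsto_cong by force
  moreover have "((\<lambda>h. flat p h / h) \<longlongrightarrow> 0) (at_left 0)"
    by (rule tendsto_eventually) (auto simp: eventually_at_filter flat_def)
  ultimately show ?thesis by (simp add: filterlim_at_split)
qed

lemma flat_has_derivative:
  "(flat p has_real_derivative flat (monom 1 2 * (p - pderiv p)) x) (at x)"
proof -
  consider "x > 0" | "x < 0" | "x = 0" by linarith
  then show ?thesis
  proof cases
    case 1
    have "((\<lambda>x. poly p (1 / x) * exp (- (1 / x))) has_real_derivative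
       poly (pderiv p) (1 / x) * (- 1 / x\<^sup>2) * exp (- (1 / x)) + exp (- (1 / x)) * (1 / x\<^sup>2) * poly p (1 / x)) (at x)"
      using 1 by (auto intro!: derivative_eq_intros DERIV_chain2[OF poly_DERIV] simp: power2_eq_square)
    then have "((\<lambda>x. poly p (1 / x) * exp (- (1 / x))) has_real_derivative flat (monom 1 2 * (p - pderiv p)) x) (at x)"
      using 1 by (simp add: flat_def poly_monom field_simps)
    then show ?thesis
      by (rule has_field_derivative_transform_within[where d = x]) (use 1 in \<open>auto simp: flat_def dist_real_def\<close>)
  next
    case 2
    have "((\<lambda>x. 0) has_real_derivative 0) (at x)" by simp
    then have "(flat p has_real_derivative 0) (at x)"
      by (rule has_field_derivative_transform_within[where d = "- x"]) (use 2 in \<open>auto simp: flat_def dist_real_def\<close>)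
    then show ?thesis using 2 by (simp add: flat_def)
  next
    case 3
    then show ?thesis using flat_tendsto_0[of p] by (simp add: has_field_derivative_iff flat_def)
  qed
qed

text \<open>A class closed under differentiation: by the product rule the derivative of one product
  is a sum of two such products. This is the invariant for the coinduction in
  \<open>bumpy_smooth\<close>.\<close>

inductive bumpy :: "real \<Rightarrow> real \<Rightarrow> (real \<Rightarrow> real) \<Rightarrow> bool" for a b where
  flat: "bumpy a b (\<lambda>t. flat p (t - a) * flat q (b - t))"
| add: "bumpy a b f \<Longrightarrow> bumpy a b g \<Longrightarrow> bumpy a b (\<lambda>t. f t + g t)"

lemma bumpy_derivative:
  assumes "bumpy a b f"
  shows "\<exists>f'. bumpy a b f' \<and> (\<forall>t. (f has_real_derivative f' t) (at t))"
  using assms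
proof induction
  case (flat p q)
  define p' q' where "p' = monom 1 2 * (p - pderiv p)" and "q' = - (monom 1 2 * (q - pderiv q))"
  have q': "flat q' x = - flat (monom 1 2 * (q - pderiv q)) x" for x
    by (simp add: q'_def flat_def)
  have "((\<lambda>t. flat p (t - a) * flat q (b - t)) has_real_derivative
     flat p' (t - a) * flat q (b - t) + flat p (t - a) * flat q' (b - t)) (at t)" for t
  proof -
    have "((\<lambda>t. flat p (t - a)) has_real_derivative flat p' (t - a) * 1) (at t)"
      unfolding p'_def by (rule DERIV_chain2[OF flat_has_derivative]) (auto intro!: derivative_eq_intros)
    moreover have "((\<lambda>t. flat q (b - t)) has_real_derivative flat (monom 1 2 * (q - pderiv q)) (b - t) * (- 1)) (at t)"
      by (rule DERIV_chain2[OF flat_has_derivative]) (auto intro!: derivative_eq_intros)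
    ultimately show ?thesis
      using DERIV_mult by (fastforce simp: q' algebra_simps)
  qed
  then show ?case using bumpy.add[OF bumpy.flat bumpy.flat] by blast
next
  case (add f g)
  then obtain f' g' where *: "bumpy a b f'" "bumpy a b g'"
    "\<And>t. (f has_real_derivative f' t) (at t)" "\<And>t. (g has_real_derivative g' t) (at t)" by blast
  then show ?case
    by (intro exI[of _ "\<lambda>t. f' t + g' t"]) (auto intro!: bumpy.add derivative_intros)
qed

lemma bumpy_smooth: "bumpy a b f \<Longrightarrow> smooth_fun f"
  by (coinduction arbitrary: f rule: smooth_fun.coinduct) (use bumpy_derivative in blast)

definition bump :: "real \<Rightarrow> real \<Rightarrow> real \<Rightarrow> real" where
  "bump a b t = flat 1 (t - a) * flat 1 (b - t)"

lemma bump_pos_iff: "0 < bump a b t \<longleftrightarrow> a < t \<and> t < b"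
  and bump_zero: "\<not> (a < t \<and> t < b) \<Longrightarrow> bump a b t = 0"
  by (auto simp: bump_def flat_def)

lemma bumpy_bump: "bumpy a b (bump a b)"
  unfolding bump_def by (rule bumpy.flat)

lemma bump_smooth: "smooth_fun (bump a b)" "smooth_fun (\<lambda>t. - bump a b t)"
proof -
  show "smooth_fun (bump a b)" by (rule bumpy_smooth[OF bumpy_bump])
  have "bumpy a b (\<lambda>t. flat (- 1) (t - a) * flat 1 (b - t))" by (rule bumpy.flat)
  moreover have "(\<lambda>t. flat (- 1) (t - a) * flat 1 (b - t)) = (\<lambda>t. - bump a b t)"
    by (auto simp: fun_eq_iff bump_def flat_def)
  ultimately show "smooth_fun (\<lambda>t. - bump a b t)"
    using bumpy_smooth by fastforce
qed

lemma bump_continuous: "continuous_on S (bump a b)"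
  using bumpy_derivative[OF bumpy_bump] by (meson DERIV_continuous continuous_at_imp_continuous_on)

lemma bump_antiderivative:
  obtains E where "\<And>t. (E has_real_derivative bump \<alpha> \<beta> t) (at t)"
proof -
  have "((\<lambda>u. LBINT y=0..u. bump \<alpha> \<beta> y) has_real_derivative bump \<alpha> \<beta> x) (at x)" for x
  proof -
    have "((\<lambda>u. LBINT y=(0::real)..u. bump \<alpha> \<beta> y) has_vector_derivative bump \<alpha> \<beta> x) (at x within {-\<bar>x\<bar> - 1..\<bar>x\<bar> + 1})"
      by (rule interval_integral_FTC2) (auto intro: bump_continuous)
    moreover have "at x within {-\<bar>x\<bar> - 1..\<bar>x\<bar> + 1} = at x" by (rule at_within_Icc_at) auto
    ultimately show ?thesis by (simp add: has_real_derivative_iff_has_vector_derivative zero_ereal_def)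
  qed
  then show ?thesis by (rule that)
qed

section \<open>Test functions that are products of a time cutoff and a wave\<close>

context half_interval
begin

text \<open>\<open>d_t I\<close> is computed explicitly only at times of \<open>I\<close>, so a
  derivative can be replaced by its formula only after showing that \<open>C_k\<close> depends on
  the values over \<open>I\<close> alone.\<close>

lemma C_k_cong:
  "(\<And>t x. t \<in> I \<Longrightarrow> \<phi> t x = \<psi> t x) \<Longrightarrow> C_k n I \<phi> \<Longrightarrow> C_k n I \<psi>"
proof (induction n arbitrary: \<phi> \<psi>)
  case 0
  have "continuous_on (I \<times> UNIV) (\<lambda>(t, x). \<phi> t x) = continuous_on (I \<times> UNIV) (\<lambda>(t, x). \<psi> t x)"
    by (rule continuous_on_cong) (use 0 in auto)
  then show ?case using 0 by simp
next
  case (Suc n)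
  have dt: "((\<lambda>\<tau>. \<psi> \<tau> x) has_vector_derivative d_t I \<phi> t x) (at t within I)" if "t \<in> I" for t x
  proof (rule has_vector_derivative_transform[OF that])
    show "((\<lambda>\<tau>. \<phi> \<tau> x) has_vector_derivative d_t I \<phi> t x) (at t within I)"
      using Suc.prems(2) that by (simp add: d_t_def vector_derivative_works[symmetric])
  qed (use Suc.prems(1) in simp)
  have p: "\<phi> t = \<psi> t" if "t \<in> I" for t using Suc.prems(1) that by auto
  have "C_k n I (d_t I \<psi>)"
  proof (rule Suc.IH)
    show "C_k n I (d_t I \<phi>)" using Suc.prems(2) by simp
    show "d_t I \<phi> t x = d_t I \<psi> t x" if "t \<in> I" for t x
      using vector_derivative_within_I[OF that dt[OF that]] by (simp add: d_t_def)
  qed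
  moreover have "C_k n I (d_x \<psi>)"
    by (rule Suc.IH[of "d_x \<phi>"]) (use Suc.prems(2) p in \<open>simp_all add: d_x_def\<close>)
  moreover have "continuous_on (I \<times> UNIV) (\<lambda>(t, x). \<psi> t x)"
  proof -
    have "continuous_on (I \<times> UNIV) (\<lambda>(t, x). \<phi> t x) = continuous_on (I \<times> UNIV) (\<lambda>(t, x). \<psi> t x)"
      by (rule continuous_on_cong) (use Suc.prems in auto)
    then show ?thesis using Suc.prems(2) by simp
  qed
  moreover have "(\<lambda>\<tau>. \<psi> \<tau> x) differentiable (at t within I)" if "t \<in> I" for t x
    using dt[OF that] by (rule differentiableI_vector)
  moreover have "\<psi> t differentiable (at x)" if "t \<in> I" for t x
    using Suc.prems(2) that p by auto
  ultimately show ?case by simp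
qed

text \<open>The time derivative replaces \<open>g\<close> by its derivative and the space derivative
  multiplies by \<open>\<i> * k\<close>; the induction therefore runs over all \<open>g\<close> and
  all constants \<open>c\<close>.\<close>

lemma C_k_wave:
  assumes "smooth_fun g"
  shows "C_k n I (\<lambda>t x. c * of_real (g t) * wave k x)"
  using assms
proof (induction n arbitrary: g c)
  case 0
  then have "\<And>t. isCont g t" by (meson DERIV_isCont smooth_fun.cases)
  then have "continuous_on UNIV g" by (simp add: continuous_at_imp_continuous_on)
  then show ?case
    by (auto simp: case_prod_unfold intro!: continuous_intros continuous_on_compose2[of UNIV g])
next
  case (Suc n)
  from Suc.prems obtain g' where g': "\<And>t. (g has_real_derivative g' t) (at t)" "smooth_fun g'"
    by (metis smooth_fun.cases)
  have dt: "((\<lambda>\<tau>. c * of_real (g \<tau>) * wave k x) has_vector_derivative c * of_real (g' t) * wave k x) (at t within I)" for t x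
  proof -
    have "((\<lambda>\<tau>. complex_of_real (g \<tau>)) has_vector_derivative of_real (g' t)) (at t within I)"
      using has_vector_derivative_of_real[OF has_field_derivative_at_within[OF g'(1)]] .
    then show ?thesis by (intro has_vector_derivative_mult_left has_vector_derivative_mult_right)
  qed
  have dx: "((\<lambda>x. c * of_real (g t) * wave k x) has_vector_derivative (c * (\<i> * of_int k)) * of_real (g t) * wave k x) (at x)" for t x
    using has_vector_derivative_mult_right[OF wave_has_vector_derivative, of "c * of_real (g t)" k x UNIV] by (simp add: mult_ac)
  have "C_k n I (d_t I (\<lambda>t x. c * of_real (g t) * wave k x))"
    by (rule C_k_cong[OF _ Suc.IH[OF g'(2), of c]])
       (simp add: d_t_def vector_derivative_within_I[OF _ dt])
  moreover have "d_x (\<lambda>t x. c * of_real (g t) * wave k x) = (\<lambda>t x. (c * (\<i> * of_int k)) * of_real (g t) * wave k x)"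
    by (simp add: d_x_def vector_derivative_at[OF dx])
  then have "C_k n I (d_x (\<lambda>t x. c * of_real (g t) * wave k x))"
    using Suc.IH[OF Suc.prems] by simp
  moreover have "continuous_on (I \<times> UNIV) (\<lambda>(t, x). c * of_real (g t) * wave k x)"
  proof -
    have "continuous_on UNIV g" using g'(1) by (meson DERIV_isCont continuous_at_imp_continuous_on)
    then show ?thesis by (auto simp: case_prod_unfold intro!: continuous_intros continuous_on_compose2[of UNIV g])
  qed
  ultimately show ?case
    using differentiableI_vector[OF dt] differentiableI_vector[OF dx] by simp
qed

lemma wave_test_function:
  assumes g: "smooth_fun g" and b: "0 \<le> b" "b < T" "\<And>t. t \<in> I \<Longrightarrow> b < \<bar>t\<bar> \<Longrightarrow> g t = 0"
  shows "(\<lambda>t x. of_real (g t) * wave k x) \<in> test_functions I"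
proof -
  have "C_k n I (\<lambda>t x. of_real (g t) * wave k x)" for n using C_k_wave[OF g, of n 1] by simp
  moreover have "\<exists>K. compact K \<and> K \<subseteq> I \<and> (\<forall>t\<in>I - K. \<forall>x. of_real (g t) * wave k x = 0)"
    using seg_iff[OF b(1,2)] b(3) seg_subset[OF b(2)]
    by (intro exI[of _ "seg b"] conjI compact_seg) (auto simp: not_le)
  ultimately show ?thesis by (simp add: test_functions_def torus_periodic_def wave_period)
qed

end

section \<open>The weak equation in Fourier variables\<close>

text \<open>The dispersion relation: the linear part of the equation has Fourier symbol
  \<open>- \<i> * omega\<close>, since \<open>(\<i> * k) ^ 3 = - \<i> * k ^ 3\<close> and
  \<open>(\<i> * k) ^ 2 = - k ^ 2\<close>.\<close>

definition omega :: "real \<Rightarrow> real \<Rightarrow> int \<Rightarrow> real" where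
  "omega \<alpha>1 \<alpha>2 k = \<alpha>1 * of_int k ^ 3 + \<alpha>2 * (of_int k)\<^sup>2"

text \<open>The last term is \<open>- \<i> * \<Gamma>\<close> times \<open>\<i> * (k - i)\<close>:
  the derivative falls on the factor with coefficients \<open>j\<close> and
  \<open>l = i + j - k\<close>, whose frequency is \<open>j - l = k - i\<close>.\<close>

definition nonlin :: "real \<Rightarrow> real \<Rightarrow> real \<Rightarrow> int \<Rightarrow> int \<Rightarrow> int \<Rightarrow> complex" where
  "nonlin \<gamma>1 \<gamma>2 \<Gamma> k i j = \<i> * of_real \<gamma>1 + \<i> * of_real \<gamma>2 * of_int k + of_real \<Gamma> * of_int (k - i)"

definition mode_rhs :: "real \<Rightarrow> real \<Rightarrow> real \<Rightarrow> real \<Rightarrow> real \<Rightarrow> (int \<Rightarrow> complex) \<Rightarrow> int \<Rightarrow> complex" where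
  "mode_rhs \<alpha>1 \<alpha>2 \<gamma>1 \<gamma>2 \<Gamma> a k = - \<i> * of_real (omega \<alpha>1 \<alpha>2 k) * a k + trilin (nonlin \<gamma>1 \<gamma>2 \<Gamma>) a a a k"

lemma nonlin_bound: "cmod (nonlin \<gamma>1 \<gamma>2 \<Gamma> k i j) \<le> \<bar>\<gamma>1\<bar> + (\<bar>\<gamma>2\<bar> + \<bar>\<Gamma>\<bar>) * freq k i j"
proof -
  have "cmod (nonlin \<gamma>1 \<gamma>2 \<Gamma> k i j) \<le> cmod (\<i> * of_real \<gamma>1) + cmod (\<i> * of_real \<gamma>2 * of_int k) + cmod (of_real \<Gamma> * of_int (k - i))"
    unfolding nonlin_def by (meson add_mono_thms_linordered_semiring(3) norm_triangle_ineq norm_triangle_le order_refl)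
  also have "\<dots> = \<bar>\<gamma>1\<bar> + \<bar>\<gamma>2\<bar> * \<bar>real_of_int k\<bar> + \<bar>\<Gamma>\<bar> * \<bar>real_of_int (k - i)\<bar>"
    by (simp add: norm_mult del: of_int_diff)
  also have "\<dots> \<le> \<bar>\<gamma>1\<bar> + \<bar>\<gamma>2\<bar> * freq k i j + \<bar>\<Gamma>\<bar> * freq k i j"
    using abs_le_freq[of k i j] abs_diff_le_freq[of k i j] by (intro add_mono mult_left_mono) auto
  finally show ?thesis by (simp add: algebra_simps)
qed

lemma one_bound: "cmod ((\<lambda>k i j. 1) k i j) \<le> 1 + 0 * freq k i j"
  and diff_bound: "cmod (\<i> * of_int (k - i)) \<le> 0 + 1 * freq k i j"
  using abs_diff_le_freq[of k i j] by (simp_all add: norm_mult del: of_int_diff)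

lemma trilin_nonlin:
  assumes a: "decay m r a" and r: "0 < r"
  shows "trilin (nonlin \<gamma>1 \<gamma>2 \<Gamma>) a a a k = (\<i> * of_real \<gamma>1 + \<i> * of_real \<gamma>2 * of_int k) * trilin (\<lambda>k i j. 1) a a a k
     - \<i> * of_real \<Gamma> * trilin (\<lambda>k i j. \<i> * of_int (k - i)) a a a k"
proof -
  note s = trilin_decay_summable(2)[OF a r _ _ one_bound, of k] trilin_decay_summable(2)[OF a r _ _ diff_bound, of k]
  let ?c = "\<i> * of_real \<gamma>1 + \<i> * of_real \<gamma>2 * of_int k" and ?d = "- \<i> * of_real \<Gamma>"
  have "?c * trilin (\<lambda>k i j. 1) a a a k + ?d * trilin (\<lambda>k i j. \<i> * of_int (k - i)) a a a k = 
     (\<Sum>\<^sub>\<infinity>ij. ?c * (case ij of (i, j) \<Rightarrow> 1 * a i * a j * cnj (a (i + j - k))) + 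
        ?d * (case ij of (i, j) \<Rightarrow> \<i> * of_int (k - i) * a i * a j * cnj (a (i + j - k))))"
    unfolding trilin_def infsum_cmult_right'[symmetric]
    by (rule infsum_add[symmetric]) (intro summable_on_cmult_right s; simp)+
  also have "\<dots> = trilin (nonlin \<gamma>1 \<gamma>2 \<Gamma>) a a a k"
    unfolding trilin_def nonlin_def by (rule infsum_cong) (auto simp: algebra_simps)
  finally show ?thesis by simp
qed

context half_interval
begin

definition curve :: "real \<Rightarrow> real \<Rightarrow> (real \<Rightarrow> int \<Rightarrow> complex) \<Rightarrow> bool" where
  "curve m r a \<longleftrightarrow> (\<forall>k. continuous_on I (\<lambda>t. a t k)) \<and> (\<forall>t\<in>I. decay m r (a t))"

lemma curve_decay: "curve m r a \<Longrightarrow> t \<in> I \<Longrightarrow> decay m r (a t)"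
  and curve_continuous: "curve m r a \<Longrightarrow> continuous_on I (\<lambda>t. a t k)"
  by (simp_all add: curve_def)

lemma curve_trilin_continuous:
  assumes a: "curve m r a" and r: "0 < r" and g: "0 \<le> g1" "0 \<le> g2"
    and G: "\<And>k i j. cmod (G k i j) \<le> g1 + g2 * freq k i j"
  shows "continuous_on I (\<lambda>t. trilin G (a t) (a t) (a t) k)"
  unfolding trilin_def
proof (rule infsum_continuous_on_dominated)
  have m: "0 \<le> m" using decay_nonneg[OF curve_decay[OF a zero_in]] .
  show "(\<lambda>ij. (g1 + g2 * (2 / r)) * (case ij of (i, j) \<Rightarrow> cubic_majorant m r k i j)) summable_on UNIV"
    by (intro summable_on_cmult_right cubic_majorant_summable r m)
  show "continuous_on I (\<lambda>t. case ij of (i, j) \<Rightarrow> G k i j * a t i * a t j * cnj (a t (i + j - k)))" for ij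
    unfolding case_prod_unfold by (intro continuous_intros curve_continuous[OF a])
  show "norm (case ij of (i, j) \<Rightarrow> G k i j * a t i * a t j * cnj (a t (i + j - k))) \<le>
      (g1 + g2 * (2 / r)) * (case ij of (i, j) \<Rightarrow> cubic_majorant m r k i j)" if "t \<in> I" for ij t
  proof -
    have "cmod (G k i j * a t i * a t j * cnj (a t (i + j - k))) \<le> (g1 + g2 * (2 / r)) * cubic_majorant m r k i j" for i j
      by (rule cubic_le_majorant[OF curve_decay[OF a that] r g G])
    then show ?thesis by (auto simp: case_prod_unfold)
  qed
qed

text \<open>The function \<open>f\<close> vanishes for times beyond \<open>b\<close>, so the
  integral over the half-open interval is one over a compact segment, where the sum over modes is
  dominated uniformly in time and can be interchanged with it.\<close>

lemma mode_sum:
  assumes c: "\<And>k. continuous_on I (\<lambda>t. c t k)" and C: "\<And>t k. t \<in> I \<Longrightarrow> cmod (c t k) \<le> C k" "C summable_on UNIV"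
    and f: "jcont f" and b: "0 < b" "b < T" and z: "\<And>t x. t \<in> I \<Longrightarrow> b \<le> \<bar>t\<bar> \<Longrightarrow> f t x = 0"
  shows "set_integrable lborel I (\<lambda>t. \<Sum>\<^sub>\<infinity>k. c t k * wave_integral (f t) k)"
    and "((\<lambda>k. integral (seg b) (\<lambda>t. c t k * wave_integral (f t) k)) has_sum
      (LINT t:I|lborel. (\<Sum>\<^sub>\<infinity>k. c t k * wave_integral (f t) k))) UNIV"
proof -
  obtain P where P: "0 < P" "\<And>t x. t \<in> I \<Longrightarrow> x \<in> torus \<Longrightarrow> cmod (f t x) \<le> P" using jcont_bounded[OF f b z] by metis
  have le: "norm (c t k * wave_integral (f t) k) \<le> C k * (2 * pi * P)" if "t \<in> I" for t k
  proof -
    have "continuous_on torus (f t)" using jcont_slice[OF f that] continuous_on_subset by blast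
    then have "cmod (wave_integral (f t) k) \<le> 2 * pi * P" by (rule wave_integral_bound[OF _ P(2)[OF that]])
    then show ?thesis unfolding norm_mult by (intro mult_mono C that order_trans[OF norm_ge_zero C(1)[OF that]]) auto
  qed
  have s: "(\<lambda>k. C k * (2 * pi * P)) summable_on UNIV" by (rule summable_on_cmult_left[OF C(2)])
  have ck: "continuous_on I (\<lambda>t. c t k * wave_integral (f t) k)" for k
    by (intro continuous_intros c wave_integral_continuous f)
  have ct: "continuous_on I (\<lambda>t. \<Sum>\<^sub>\<infinity>k. c t k * wave_integral (f t) k)"
    by (rule infsum_continuous_on_dominated[OF ck le s])
  have zs: "(\<Sum>\<^sub>\<infinity>k. c t k * wave_integral (f t) k) = 0" if "t \<in> I" "b \<le> \<bar>t\<bar>" for t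
    using z[OF that] by (simp add: wave_integral_def)
  show "set_integrable lborel I (\<lambda>t. \<Sum>\<^sub>\<infinity>k. c t k * wave_integral (f t) k)"
    by (rule integral_supported[OF ct _ b(2) zs]) (use b in auto)
  have "((\<lambda>k. integral (seg b) (\<lambda>t. c t k * wave_integral (f t) k)) has_sum
      integral (seg b) (\<lambda>t. \<Sum>\<^sub>\<infinity>k. c t k * wave_integral (f t) k)) UNIV"
  proof (cases "\<sigma> = 1")
    case True
    then have sg: "seg b = {0..b}" unfolding seg_def by simp
    show ?thesis using seg_subset[OF b(2)] unfolding sg
      by (intro infsum_has_integral_dominated[OF _ _ s] continuous_on_subset[OF ck] le) auto
  next
    case False
    then have sg: "seg b = {-b..0}" unfolding seg_def by simp
    show ?thesis using seg_subset[OF b(2)] unfolding sg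
      by (intro infsum_has_integral_dominated[OF _ _ s] continuous_on_subset[OF ck] le) auto
  qed
  moreover have "(LINT t:I|lborel. (\<Sum>\<^sub>\<infinity>k. c t k * wave_integral (f t) k)) = integral (seg b) (\<lambda>t. \<Sum>\<^sub>\<infinity>k. c t k * wave_integral (f t) k)"
    by (rule integral_supported[OF ct _ b(2) zs]) (use b in auto)
  ultimately show "((\<lambda>k. integral (seg b) (\<lambda>t. c t k * wave_integral (f t) k)) has_sum
      (LINT t:I|lborel. (\<Sum>\<^sub>\<infinity>k. c t k * wave_integral (f t) k))) UNIV" by simp
qed

text \<open>The contribution of mode \<open>k\<close> to the weak equation after all terms are moved
  to one side.\<close>

definition mode_defect ::
  "real \<Rightarrow> real \<Rightarrow> real \<Rightarrow> real \<Rightarrow> real \<Rightarrow> real \<Rightarrow> (int \<Rightarrow> complex) \<Rightarrow> (real \<Rightarrow> int \<Rightarrow> complex) \<Rightarrow> (real \<Rightarrow> real \<Rightarrow> complex) \<Rightarrow> int \<Rightarrow> complex" where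
  "mode_defect \<alpha>1 \<alpha>2 \<gamma>1 \<gamma>2 \<Gamma> b a0 a \<phi> k =
     integral (seg b) (\<lambda>t. a t k * wave_integral (d_t I \<phi> t) k) + of_real \<sigma> * (a0 k * wave_integral (\<phi> 0) k)
     + integral (seg b) (\<lambda>t. mode_rhs \<alpha>1 \<alpha>2 \<gamma>1 \<gamma>2 \<Gamma> (a t) k * wave_integral (\<phi> t) k)"

lemma integrable_seg:
  fixes f :: "real \<Rightarrow> complex"
  shows "continuous_on I f \<Longrightarrow> b < T \<Longrightarrow> f integrable_on (seg b)"
  using seg_subset[of b] unfolding seg_def by (auto intro!: integrable_continuous_real intro: continuous_on_subset)

text \<open>Each of the time integrals in the weak equation is expanded by \<open>mode_sum\<close>.
  Integration by parts in space turns the derivatives of the test function into the symbols in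
  \<open>mode_rhs\<close>, and what remains is one sum over modes.\<close>

lemma weak_equation_modes:
  assumes \<phi>: "\<phi> \<in> test_functions I" and a: "curve m r a" and r: "0 < r"
    and v: "\<And>t. t \<in> I \<Longrightarrow> v t \<in> borel_measurable borel" "\<And>t. t \<in> I \<Longrightarrow> torus_ae_eq (v t) (fseries (a t))"
    and u0: "u0 \<in> borel_measurable borel" "torus_ae_eq u0 (fseries a0)" "l1 a0"
    and b: "0 < b" "b < T" and z: "\<And>t x. t \<in> I \<Longrightarrow> b \<le> \<bar>t\<bar> \<Longrightarrow> \<phi> t x = 0 \<and> d_t I \<phi> t x = 0"
  shows "weak_equation \<alpha>1 \<alpha>2 \<gamma>1 \<gamma>2 \<Gamma> I \<sigma> u0 v \<phi> \<longleftrightarrow> (mode_defect \<alpha>1 \<alpha>2 \<gamma>1 \<gamma>2 \<Gamma> b a0 a \<phi> has_sum 0) UNIV"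
proof -
  note s = test_smooth[OF \<phi>]
  note sx = smooth_d_x[OF s] and sxx = smooth_d_x[OF smooth_d_x[OF s]] and sxxx = smooth_d_x[OF smooth_d_x[OF smooth_d_x[OF s]]]
  note st = smooth_d_t[OF s]
  note J = s[THEN smooth_continuous] sx[THEN smooth_continuous] sxx[THEN smooth_continuous] sxxx[THEN smooth_continuous]
  define m' where "m' = (\<lambda>t x. - of_real \<alpha>1 * d_x (d_x (d_x \<phi>)) t x + \<i> * of_real \<alpha>2 * d_x (d_x \<phi>) t x)"
  define n' where "n' = (\<lambda>t x. \<i> * of_real \<gamma>1 * \<phi> t x - of_real \<gamma>2 * d_x \<phi> t x)"
  have Jm: "jcont m'" and Jn: "jcont n'" unfolding m'_def n'_def by (intro continuous_intros J)+
  have mz: "m' t x = 0" and nz: "n' t x = 0" if "t \<in> I" "b \<le> \<bar>t\<bar>" for t x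
  proof -
    have p: "\<phi> t = (\<lambda>x. 0)" using z that by auto
    then have px: "d_x \<phi> t = (\<lambda>x. 0)" by (simp add: d_x_def)
    then have pxx: "d_x (d_x \<phi>) t = (\<lambda>x. 0)" by (subst d_x_def) simp
    then have "d_x (d_x (d_x \<phi>)) t = (\<lambda>x. 0)" by (subst d_x_def) simp
    then show "m' t x = 0" "n' t x = 0" by (simp_all add: m'_def n'_def p px pxx)
  qed
  have l1: "l1 (a t)" if "t \<in> I" for t using decay_l1[OF curve_decay[OF a that] r] .
  have fm: "fseries (a t) \<in> borel_measurable borel" if "t \<in> I" for t
    by (intro fseries_measurable l1 that)
  have jm: "f t \<in> borel_measurable borel" if "jcont f" "t \<in> I" for f t
    by (intro borel_measurable_continuous_onI jcont_slice that)
  have jt: "continuous_on torus (f t)" if "jcont f" "t \<in> I" for f t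
    by (rule continuous_on_subset[OF jcont_slice[OF that]]) simp
  have I1: "(LINT x:torus|lborel. v t x * d_t I \<phi> t x) = (\<Sum>\<^sub>\<infinity>k. a t k * wave_integral (d_t I \<phi> t) k)" if t: "t \<in> I" for t
  proof -
    have "(LINT x:torus|lborel. v t x * d_t I \<phi> t x) = (LINT x:torus|lborel. fseries (a t) x * d_t I \<phi> t x)"
      using v(2)[OF t] v(1)[OF t] fm[OF t] jm[OF smooth_continuous[OF st] t]
      by (intro torus_integral_cong_AE) (auto simp: torus_ae_eq_def elim!: eventually_mono)
    then show ?thesis
      using infsumI[OF fseries_wave_integral[OF l1[OF t] jt[OF smooth_continuous[OF st] t]]] by simp
  qed
  have S0: "((\<lambda>k. a0 k * wave_integral (\<phi> 0) k) has_sum (LINT x:torus|lborel. u0 x * \<phi> 0 x)) UNIV"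
  proof -
    have "fseries a0 \<in> borel_measurable borel" by (rule fseries_measurable[OF u0(3)])
    then have "(LINT x:torus|lborel. u0 x * \<phi> 0 x) = (LINT x:torus|lborel. fseries a0 x * \<phi> 0 x)"
      using u0 jm[OF J(1) zero_in]
      by (intro torus_integral_cong_AE) (auto simp: torus_ae_eq_def elim!: eventually_mono)
    then show "((\<lambda>k. a0 k * wave_integral (\<phi> 0) k) has_sum (LINT x:torus|lborel. u0 x * \<phi> 0 x)) UNIV"
      using fseries_wave_integral[OF u0(3) jt[OF J(1) zero_in]] by simp
  qed
  let ?c1 = "\<lambda>t. trilin (\<lambda>k i j. 1) (a t) (a t) (a t)" and ?c3 = "\<lambda>t. trilin (\<lambda>k i j. \<i> * of_int (k - i)) (a t) (a t) (a t)"
  have I2: "(LINT x:torus|lborel. v t x * m' t x + of_real ((cmod (v t x))\<^sup>2) * v t x * n' t x)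
      = (\<Sum>\<^sub>\<infinity>k. a t k * wave_integral (m' t) k) + (\<Sum>\<^sub>\<infinity>k. ?c1 t k * wave_integral (n' t) k)" if t: "t \<in> I" for t
  proof -
    have "(LINT x:torus|lborel. v t x * m' t x + of_real ((cmod (v t x))\<^sup>2) * v t x * n' t x) =
      (LINT x:torus|lborel. fseries (a t) x * m' t x + of_real ((cmod (fseries (a t) x))\<^sup>2) * fseries (a t) x * n' t x)"
      using v(2)[OF t] v(1)[OF t] fm[OF t] jm[OF Jm t] jm[OF Jn t]
      by (intro torus_integral_cong_AE) (auto simp: torus_ae_eq_def elim!: eventually_mono)
    also have "\<dots> = (LINT x:torus|lborel. fseries (a t) x * m' t x) + (LINT x:torus|lborel. of_real ((cmod (fseries (a t) x))\<^sup>2) * fseries (a t) x * n' t x)"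
      by (intro set_integral_add set_integrable_torus_continuous continuous_intros fseries_continuous l1 t jt Jm Jn)
    finally show ?thesis
      using infsumI[OF fseries_wave_integral[OF l1[OF t] jt[OF Jm t]]] cubic_integral[OF curve_decay[OF a t] r jt[OF Jn t]]
      by simp
  qed
  have I3: "sobolev_pairing (dx_abs_sq (v t)) (\<lambda>x. v t x * \<phi> t x) = (\<Sum>\<^sub>\<infinity>k. ?c3 t k * wave_integral (\<phi> t) k)" if t: "t \<in> I" for t
    by (rule sobolev_pairing_cubic[OF v(1)[OF t] v(2)[OF t] curve_decay[OF a t] r jcont_slice[OF J(1) t]])
  have m: "0 \<le> m" using decay_nonneg[OF curve_decay[OF a zero_in]] .
  define C where "C k = (\<Sum>\<^sub>\<infinity>(i, j). cubic_majorant m r k i j)" for k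
  have C: "C summable_on UNIV" unfolding C_def by (rule cubic_majorant_summable[OF r m])
  define A where "A k = m * exp (- (r * \<bar>real_of_int k\<bar>))" for k :: int
  have A: "A summable_on UNIV" unfolding A_def by (intro summable_on_cmult_right summable_on_exp_neg_abs r)
  have leA: "cmod (a t k) \<le> A k" if "t \<in> I" for t k using curve_decay[OF a that] by (simp add: decay_def A_def)
  have le1: "cmod (?c1 t k) \<le> C k" if "t \<in> I" for t k
    using trilin_decay_summable(3)[OF curve_decay[OF a that] r _ _ one_bound] by (simp add: C_def)
  have le3: "cmod (?c3 t k) \<le> (2 / r) * C k" if "t \<in> I" for t k
    using trilin_decay_summable(3)[OF curve_decay[OF a that] r _ _ diff_bound, of k] by (simp add: C_def)
  have cont1: "continuous_on I (\<lambda>t. ?c1 t k)" for k by (rule curve_trilin_continuous[OF a r _ _ one_bound]) auto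
  have cont3: "continuous_on I (\<lambda>t. ?c3 t k)" for k by (rule curve_trilin_continuous[OF a r _ _ diff_bound]) auto
  note M1 = mode_sum[OF curve_continuous[OF a] leA A smooth_continuous[OF st] b conjunct2[OF z]]
  note M2 = mode_sum[OF curve_continuous[OF a] leA A Jm b mz]
  note M3 = mode_sum[OF cont1 le1 C Jn b nz]
  note M4 = mode_sum[OF cont3 le3 summable_on_cmult_right[OF C] J(1) b conjunct1[OF z]]
  have W: "weak_equation \<alpha>1 \<alpha>2 \<gamma>1 \<gamma>2 \<Gamma> I \<sigma> u0 v \<phi> \<longleftrightarrow>
     - (LINT t:I|lborel. (\<Sum>\<^sub>\<infinity>k. a t k * wave_integral (d_t I \<phi> t) k)) - of_real \<sigma> * (LINT x:torus|lborel. u0 x * \<phi> 0 x) =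
     (LINT t:I|lborel. (\<Sum>\<^sub>\<infinity>k. a t k * wave_integral (m' t) k)) + (LINT t:I|lborel. (\<Sum>\<^sub>\<infinity>k. ?c1 t k * wave_integral (n' t) k))
     - \<i> * of_real \<Gamma> * (LINT t:I|lborel. (\<Sum>\<^sub>\<infinity>k. ?c3 t k * wave_integral (\<phi> t) k))"
  proof -
    have L1: "(LINT t:I|lborel. (LINT x:torus|lborel. v t x * d_t I \<phi> t x)) = (LINT t:I|lborel. (\<Sum>\<^sub>\<infinity>k. a t k * wave_integral (d_t I \<phi> t) k))"
      by (rule set_lebesgue_integral_cong) (use I1 in auto)
    have L2: "(LINT t:I|lborel. (LINT x:torus|lborel. v t x * m' t x + of_real ((cmod (v t x))\<^sup>2) * v t x * n' t x)) =
      (LINT t:I|lborel. (\<Sum>\<^sub>\<infinity>k. a t k * wave_integral (m' t) k) + (\<Sum>\<^sub>\<infinity>k. ?c1 t k * wave_integral (n' t) k))"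
      by (rule set_lebesgue_integral_cong) (use I2 in auto)
    have L3: "(LINT t:I|lborel. sobolev_pairing (dx_abs_sq (v t)) (\<lambda>x. v t x * \<phi> t x)) = (LINT t:I|lborel. (\<Sum>\<^sub>\<infinity>k. ?c3 t k * wave_integral (\<phi> t) k))"
      by (rule set_lebesgue_integral_cong) (use I3 in auto)
    have "weak_equation \<alpha>1 \<alpha>2 \<gamma>1 \<gamma>2 \<Gamma> I \<sigma> u0 v \<phi> \<longleftrightarrow>
      - (LINT t:I|lborel. (LINT x:torus|lborel. v t x * d_t I \<phi> t x)) - of_real \<sigma> * (LINT x:torus|lborel. u0 x * \<phi> 0 x) =
      (LINT t:I|lborel. (LINT x:torus|lborel. v t x * m' t x + of_real ((cmod (v t x))\<^sup>2) * v t x * n' t x))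
      - \<i> * of_real \<Gamma> * (LINT t:I|lborel. sobolev_pairing (dx_abs_sq (v t)) (\<lambda>x. v t x * \<phi> t x))"
      unfolding weak_equation_def m'_def n'_def ..
    moreover have "(LINT t:I|lborel. (\<Sum>\<^sub>\<infinity>k. a t k * wave_integral (m' t) k) + (\<Sum>\<^sub>\<infinity>k. ?c1 t k * wave_integral (n' t) k)) =
      (LINT t:I|lborel. (\<Sum>\<^sub>\<infinity>k. a t k * wave_integral (m' t) k)) + (LINT t:I|lborel. (\<Sum>\<^sub>\<infinity>k. ?c1 t k * wave_integral (n' t) k))"
      by (rule set_integral_add(2)) (rule M2(1) M3(1); assumption)+
    ultimately show ?thesis by (simp only: L1 L2 L3)
  qed
  let ?D = "\<lambda>k. integral (seg b) (\<lambda>t. a t k * wave_integral (d_t I \<phi> t) k) + of_real \<sigma> * (a0 k * wave_integral (\<phi> 0) k)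
     + (integral (seg b) (\<lambda>t. a t k * wave_integral (m' t) k) + integral (seg b) (\<lambda>t. ?c1 t k * wave_integral (n' t) k)
       + (- \<i> * of_real \<Gamma>) * integral (seg b) (\<lambda>t. ?c3 t k * wave_integral (\<phi> t) k))"
  have S: "(?D has_sum ((LINT t:I|lborel. (\<Sum>\<^sub>\<infinity>k. a t k * wave_integral (d_t I \<phi> t) k)) + of_real \<sigma> * (LINT x:torus|lborel. u0 x * \<phi> 0 x) +
     ((LINT t:I|lborel. (\<Sum>\<^sub>\<infinity>k. a t k * wave_integral (m' t) k)) + (LINT t:I|lborel. (\<Sum>\<^sub>\<infinity>k. ?c1 t k * wave_integral (n' t) k))
     + (- \<i> * of_real \<Gamma>) * (LINT t:I|lborel. (\<Sum>\<^sub>\<infinity>k. ?c3 t k * wave_integral (\<phi> t) k))))) UNIV"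
    by (intro has_sum_add has_sum_cmult_right M1(2) M2(2) M3(2) M4(2) S0)
  have D: "?D k = mode_defect \<alpha>1 \<alpha>2 \<gamma>1 \<gamma>2 \<Gamma> b a0 a \<phi> k" for k
  proof -
    have i: "(\<lambda>t. c t * wave_integral (f t) k) integrable_on (seg b)" if "continuous_on I c" "jcont f" for c f
      by (intro integrable_seg b continuous_intros wave_integral_continuous that)
    have "integral (seg b) (\<lambda>t. a t k * wave_integral (m' t) k) + integral (seg b) (\<lambda>t. ?c1 t k * wave_integral (n' t) k)
       + (- \<i> * of_real \<Gamma>) * integral (seg b) (\<lambda>t. ?c3 t k * wave_integral (\<phi> t) k)
      = integral (seg b) (\<lambda>t. a t k * wave_integral (m' t) k + ?c1 t k * wave_integral (n' t) k + (- \<i> * of_real \<Gamma>) * (?c3 t k * wave_integral (\<phi> t) k))"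
    proof -
      note i2 = i[OF curve_continuous[OF a] Jm] and i3 = i[OF cont1 Jn] and i4 = i[OF cont3 J(1)]
      have i4': "(\<lambda>t. (- \<i> * of_real \<Gamma>) * (?c3 t k * wave_integral (\<phi> t) k)) integrable_on (seg b)"
        by (intro integrable_seg b continuous_intros wave_integral_continuous cont3 J)
      show ?thesis
        unfolding integral_add[OF integrable_add[OF i2 i3] i4'] integral_add[OF i2 i3]
        by (simp only: integral_mult_right)
    qed
    also have "\<dots> = integral (seg b) (\<lambda>t. mode_rhs \<alpha>1 \<alpha>2 \<gamma>1 \<gamma>2 \<Gamma> (a t) k * wave_integral (\<phi> t) k)"
    proof (rule integral_cong)
      fix t assume "t \<in> seg b"
      then have t: "t \<in> I" using seg_subset[OF b(2)] by blast
      note per = test_periodic[OF \<phi> t]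
      note px = periodic_derivative[OF per smooth_has_d_x[OF s t]]
      note pxx = periodic_derivative[OF px smooth_has_d_x[OF sx t]]
      note w1 = wave_integral_deriv[OF smooth_has_d_x[OF s t] jcont_slice[OF J(2) t] per]
      note w2 = wave_integral_deriv[OF smooth_has_d_x[OF sx t] jcont_slice[OF J(3) t] px]
      note w3 = wave_integral_deriv[OF smooth_has_d_x[OF sxx t] jcont_slice[OF J(4) t] pxx]
      have lin: "wave_integral (\<lambda>x. p * f t x + q * g t x) k = p * wave_integral (f t) k + q * wave_integral (g t) k"
        if "jcont f" "jcont g" for p q f g
      proof -
        have "wave_integral (\<lambda>x. p * f t x + q * g t x) k = (LINT x:torus|lborel. p * (wave k x * f t x) + q * (wave k x * g t x))"
          unfolding wave_integral_def by (simp add: algebra_simps)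
        also have "\<dots> = (LINT x:torus|lborel. p * (wave k x * f t x)) + (LINT x:torus|lborel. q * (wave k x * g t x))"
          by (intro set_integral_add set_integrable_torus_continuous continuous_intros jt that t)
        finally show ?thesis by (simp add: wave_integral_def)
      qed
      \<comment> \<open>Each space derivative of the test function contributes a factor
        \<open>- \<i> * k\<close>; the powers 3 and 2, with the signs in \<open>m'\<close>, combine
        to \<open>- \<i> * omega\<close>.\<close>
      have Wm: "wave_integral (m' t) k = (- \<i> * of_real (omega \<alpha>1 \<alpha>2 k)) * wave_integral (\<phi> t) k"
        using lin[OF J(4) J(3), of "- of_real \<alpha>1" "\<i> * of_real \<alpha>2"]
        unfolding m'_def w3 w2 w1 omega_def by (simp add: algebra_simps power2_eq_square power3_eq_cube)
      have Wn: "wave_integral (n' t) k = (\<i> * of_real \<gamma>1 + \<i> * of_real \<gamma>2 * of_int k) * wave_integral (\<phi> t) k"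
        using lin[OF J(1) J(2), of "\<i> * of_real \<gamma>1" "- of_real \<gamma>2"]
        unfolding n'_def w1 by (simp add: algebra_simps)
      show "a t k * wave_integral (m' t) k + ?c1 t k * wave_integral (n' t) k + (- \<i> * of_real \<Gamma>) * (?c3 t k * wave_integral (\<phi> t) k)
        = mode_rhs \<alpha>1 \<alpha>2 \<gamma>1 \<gamma>2 \<Gamma> (a t) k * wave_integral (\<phi> t) k"
        unfolding mode_rhs_def trilin_nonlin[OF curve_decay[OF a t] r] Wm Wn by (simp add: algebra_simps)
    qed
    finally show ?thesis by (simp add: mode_defect_def)
  qed
  then have "?D = mode_defect \<alpha>1 \<alpha>2 \<gamma>1 \<gamma>2 \<Gamma> b a0 a \<phi>" by blast
  with S have S': "(mode_defect \<alpha>1 \<alpha>2 \<gamma>1 \<gamma>2 \<Gamma> b a0 a \<phi> has_sum ((LINT t:I|lborel. (\<Sum>\<^sub>\<infinity>k. a t k * wave_integral (d_t I \<phi> t) k)) + of_real \<sigma> * (LINT x:torus|lborel. u0 x * \<phi> 0 x) +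
     ((LINT t:I|lborel. (\<Sum>\<^sub>\<infinity>k. a t k * wave_integral (m' t) k)) + (LINT t:I|lborel. (\<Sum>\<^sub>\<infinity>k. ?c1 t k * wave_integral (n' t) k))
     + (- \<i> * of_real \<Gamma>) * (LINT t:I|lborel. (\<Sum>\<^sub>\<infinity>k. ?c3 t k * wave_integral (\<phi> t) k))))) UNIV" by simp
  have alg: "- p - q = x + y - \<i> * of_real \<Gamma> * w \<longleftrightarrow> p + q + (x + y + (- \<i> * of_real \<Gamma>) * w) = 0" for p q x y w :: complex
    using neg_eq_iff_add_eq_0[of "p + q" "x + y - \<i> * of_real \<Gamma> * w"] by simp
  show ?thesis
    unfolding W alg
  proof
    assume "(mode_defect \<alpha>1 \<alpha>2 \<gamma>1 \<gamma>2 \<Gamma> b a0 a \<phi> has_sum 0) UNIV"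
    with S' show "(LINT t:I|lborel. (\<Sum>\<^sub>\<infinity>k. a t k * wave_integral (d_t I \<phi> t) k)) + of_real \<sigma> * (LINT x:torus|lborel. u0 x * \<phi> 0 x) +
     ((LINT t:I|lborel. (\<Sum>\<^sub>\<infinity>k. a t k * wave_integral (m' t) k)) + (LINT t:I|lborel. (\<Sum>\<^sub>\<infinity>k. ?c1 t k * wave_integral (n' t) k))
     + (- \<i> * of_real \<Gamma>) * (LINT t:I|lborel. (\<Sum>\<^sub>\<infinity>k. ?c3 t k * wave_integral (\<phi> t) k))) = 0"
      by (rule has_sum_unique)
  qed (use S' in simp)
qed

end

section \<open>Weak solutions and the equations of the Fourier modes\<close>

context half_interval
begin

lemma mode_rhs_continuous:
  assumes a: "curve m r a" and r: "0 < r"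
  shows "continuous_on I (\<lambda>t. mode_rhs \<alpha>1 \<alpha>2 \<gamma>1 \<gamma>2 \<Gamma> (a t) k)"
  unfolding mode_rhs_def
  by (intro continuous_intros curve_continuous[OF a] curve_trilin_continuous[OF a r _ _ nonlin_bound]) auto

text \<open>The two time integrands add up to the derivative of
  \<open>a t k * wave_integral (\<phi> t) k\<close>, so their integral is a boundary term that
  cancels the initial value. Every mode thus balances by itself.\<close>

lemma mode_defect_zero:
  assumes \<phi>: "\<phi> \<in> test_functions I" and a: "curve m r a" and r: "0 < r"
    and d: "\<And>t. t \<in> I \<Longrightarrow> ((\<lambda>t. a t k) has_vector_derivative mode_rhs \<alpha>1 \<alpha>2 \<gamma>1 \<gamma>2 \<Gamma> (a t) k) (at t within I)"
    and a0: "a 0 k = a0 k"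
    and b: "0 < b" "b < T" and z: "\<And>t x. t \<in> I \<Longrightarrow> b \<le> \<bar>t\<bar> \<Longrightarrow> \<phi> t x = 0"
  shows "mode_defect \<alpha>1 \<alpha>2 \<gamma>1 \<gamma>2 \<Gamma> b a0 a \<phi> k = 0"
proof -
  note s = test_smooth[OF \<phi>]
  let ?W' = "\<lambda>t. a t k * wave_integral (d_t I \<phi> t) k + mode_rhs \<alpha>1 \<alpha>2 \<gamma>1 \<gamma>2 \<Gamma> (a t) k * wave_integral (\<phi> t) k"
  have "(?W' has_integral - of_real \<sigma> * (a 0 k * wave_integral (\<phi> 0) k)) (seg b)"
  proof (rule integral_derivative)
    show "((\<lambda>t. a t k * wave_integral (\<phi> t) k) has_vector_derivative ?W' t) (at t within I)" if "t \<in> I" for t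
      by (rule has_vector_derivative_mult[OF d[OF that] wave_integral_has_d_t[OF s that]])
    show "a t k * wave_integral (\<phi> t) k = 0" if "t \<in> I" "b \<le> \<bar>t\<bar>" for t
      using z[OF that] by (simp add: wave_integral_def)
  qed (use b in auto)
  then have "integral (seg b) ?W' = - of_real \<sigma> * (a 0 k * wave_integral (\<phi> 0) k)" by (rule integral_unique)
  moreover have "integral (seg b) ?W' = integral (seg b) (\<lambda>t. a t k * wave_integral (d_t I \<phi> t) k) +
      integral (seg b) (\<lambda>t. mode_rhs \<alpha>1 \<alpha>2 \<gamma>1 \<gamma>2 \<Gamma> (a t) k * wave_integral (\<phi> t) k)"
    by (intro integral_add integrable_seg b continuous_intros curve_continuous[OF a] mode_rhs_continuous[OF a r]
        wave_integral_continuous smooth_continuous smooth_d_t s)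
  moreover have "x + y + z = 0" if "w = - y" "w = x + z" for w x y z :: complex
  proof -
    have *: "x + y + z = (x + z) + y" by (simp only: ac_simps)
    show ?thesis unfolding * that(2)[symmetric] that(1) by simp
  qed
  ultimately show ?thesis by (simp only: mode_defect_def a0 mult_minus_left)
qed

text \<open>An admissible time factor whose derivative is a prescribed bump up to sign. It lets the
  weak equation be integrated against arbitrary bumps without losing the initial value.\<close>

lemma cutoff:
  assumes "\<alpha> < \<beta>" "{\<alpha>..\<beta>} \<subseteq> I - {0}"
  obtains \<eta> b where "smooth_fun \<eta>" "\<And>t. (\<eta> has_real_derivative - \<sigma> * bump \<alpha> \<beta> t) (at t)"
    "0 < b" "b < T" "\<And>t. t \<in> I \<Longrightarrow> b \<le> \<bar>t\<bar> \<Longrightarrow> \<eta> t = 0"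
proof -
  obtain E where E: "\<And>t. (E has_real_derivative bump \<alpha> \<beta> t) (at t)" using bump_antiderivative by blast
  \<comment> \<open>The end of \<open>{\<alpha>..\<beta>}\<close> farther from 0. The antiderivative
    of the bump is constant beyond it, so subtracting from the value there gives a function that
    vanishes for all later times.\<close>
  define e where "e = (if \<sigma> = 1 then \<beta> else \<alpha>)"
  define \<eta> where "\<eta> t = \<sigma> * (E e - E t)" for t
  have d: "(\<eta> has_real_derivative - \<sigma> * bump \<alpha> \<beta> t) (at t)" for t
    unfolding \<eta>_def using E by (auto intro!: derivative_eq_intros)
  have s: "smooth_fun \<eta>"
  proof (rule smooth_fun.intros[OF d])
    have "\<sigma> = 1 \<or> \<sigma> = -1" using I by blast
    then show "smooth_fun (\<lambda>t. - \<sigma> * bump \<alpha> \<beta> t)"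
      using bump_smooth[of \<alpha> \<beta>] by auto
  qed
  have e: "e \<in> I" "e \<noteq> 0"
    using subsetD[OF assms(2), of \<alpha>] subsetD[OF assms(2), of \<beta>] assms(1) by (auto simp: e_def)
  have const: "E y = E x" if "x \<le> y" "\<And>t. t \<in> {x..y} \<Longrightarrow> bump \<alpha> \<beta> t = 0" for x y
  proof -
    have "(bump \<alpha> \<beta> has_integral E y - E x) {x..y}"
      by (rule fundamental_theorem_of_calculus[OF that(1)])
         (use E in \<open>auto simp: has_real_derivative_iff_has_vector_derivative[symmetric] intro: has_field_derivative_at_within\<close>)
    moreover have "(bump \<alpha> \<beta> has_integral 0) {x..y}"
      using has_integral_is_0[of "{x..y}" "bump \<alpha> \<beta>"] that(2) by blast
    ultimately have "E y - E x = 0" by (rule has_integral_unique)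
    then show ?thesis by simp
  qed
  show ?thesis
  proof (rule that[OF s d, of "\<bar>e\<bar>"])
    show "0 < \<bar>e\<bar>" "\<bar>e\<bar> < T" using e I by auto
    show "\<eta> t = 0" if t: "t \<in> I" "\<bar>e\<bar> \<le> \<bar>t\<bar>" for t
    proof (cases "\<sigma> = 1")
      case True
      then have "e = \<beta>" "\<beta> \<le> t" using I e t by (auto simp: e_def)
      then have "E t = E \<beta>" by (intro const bump_zero) auto
      then show ?thesis using \<open>e = \<beta>\<close> by (simp add: \<eta>_def)
    next
      case False
      then have "e = \<alpha>" "t \<le> \<alpha>" using I e t by (auto simp: e_def)
      then have "E \<alpha> = E t" by (intro const bump_zero) auto
      then show ?thesis using \<open>e = \<alpha>\<close> by (simp add: \<eta>_def)
    qed
  qed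
qed

lemma antiderivative:
  fixes R :: "real \<Rightarrow> complex"
  assumes R: "continuous_on I R"
  obtains P where "P 0 = 0" "\<And>t. t \<in> I \<Longrightarrow> (P has_vector_derivative R t) (at t within I)"
proof (rule that[of "\<lambda>t. LBINT y=ereal 0..ereal t. R y"])
  let ?P = "\<lambda>t. LBINT y=ereal 0..ereal t. R y"
  show "?P 0 = 0" by simp
  fix t assume t: "t \<in> I"
  define b where "b = (\<bar>t\<bar> + T) / 2"
  have b: "0 < b" "b < T" "\<bar>t\<bar> < b" using t I T by (auto simp: b_def)
  define l u where "l = (if \<sigma> = 1 then 0 else - b)" and "u = (if \<sigma> = 1 then b else 0)"
  have lu: "seg b = {l..u}" unfolding seg_def l_def u_def by auto
  have "t \<in> {l..u}" using seg_iff[of b t] b t unfolding lu by simp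
  then have tl: "l \<le> t" "t \<le> u" by auto
  have l0: "l \<le> 0" "0 \<le> u" using b by (auto simp: l_def u_def)
  have "continuous_on {l..u} R" using continuous_on_subset[OF R seg_subset[OF b(2)]] unfolding lu .
  then have "(?P has_vector_derivative R t) (at t within {l..u})"
    by (rule interval_integral_FTC2[OF l0 _ tl])
  moreover have "at t within {l..u} = at t within I"
  proof (rule at_within_nhd[where S = "{-b<..<b}"])
    have "s \<in> {l..u} \<longleftrightarrow> s \<in> I" if "s \<in> {- b<..<b}" for s
      using seg_iff[of b s] b that unfolding lu by (simp add: abs_le_iff)
    then show "{l..u} \<inter> {- b<..<b} - {t} = I \<inter> {- b<..<b} - {t}" by blast
    show "t \<in> {-b<..<b}" using b by auto
  qed auto
  ultimately show "(?P has_vector_derivative R t) (at t within I)" by simp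
qed

text \<open>The fundamental lemma of the calculus of variations. Only bumps supported away from 0
  are at hand, so the value at 0 is recovered by continuity.\<close>

lemma continuous_zero_of_bumps:
  fixes G :: "real \<Rightarrow> complex"
  assumes G: "continuous_on I G"
    and zero: "\<And>\<alpha> \<beta>. \<alpha> < \<beta> \<Longrightarrow> {\<alpha>..\<beta>} \<subseteq> I - {0} \<Longrightarrow> \<exists>b<T. {\<alpha>..\<beta>} \<subseteq> seg b \<and> integral (seg b) (\<lambda>t. G t * of_real (bump \<alpha> \<beta> t)) = 0"
    and t: "t \<in> I"
  shows "G t = 0"
proof -
  have inner: "G t0 = 0" if t0: "t0 \<in> I" "t0 \<noteq> 0" for t0
  proof (rule ccontr)
    assume G0: "G t0 \<noteq> 0"
    obtain d where d: "0 < d" "\<And>s. s \<in> I \<Longrightarrow> dist s t0 < d \<Longrightarrow> dist (G s) (G t0) < cmod (G t0)"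
      using G t0(1) G0 unfolding continuous_on_iff by (meson zero_less_norm_iff)
    define e where "e = min (d / 2) (min (\<bar>t0\<bar> / 2) ((T - \<bar>t0\<bar>) / 2))"
    have e: "0 < e" "e \<le> d / 2" "e \<le> \<bar>t0\<bar> / 2" "e \<le> (T - \<bar>t0\<bar>) / 2"
    proof -
      have "0 < \<bar>t0\<bar>" "\<bar>t0\<bar> < T" using t0 I by auto
      then show "0 < e" using d(1) by (simp add: e_def)
    qed (unfold e_def, linarith+)
    have sub: "{t0 - e..t0 + e} \<subseteq> I - {0}" using e t0 I by auto
    obtain b where b: "b < T" "{t0 - e..t0 + e} \<subseteq> seg b" "integral (seg b) (\<lambda>t. G t * of_real (bump (t0 - e) (t0 + e) t)) = 0"
      using zero[OF _ sub] e(1) by auto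
    \<comment> \<open>The bump is concentrated where \<open>G\<close> stays closer than
      \<open>cmod (G t0)\<close> to \<open>G t0\<close>, so this real part is nonnegative on
      \<open>I\<close> and positive at \<open>t0\<close>. Its integral being zero is then
      impossible.\<close>
    define f where "f t = Re (cnj (G t0) * (G t * of_real (bump (t0 - e) (t0 + e) t)))" for t
    have gi: "(\<lambda>t. G t * of_real (bump (t0 - e) (t0 + e) t)) integrable_on (seg b)"
      by (intro integrable_seg b continuous_intros G bump_continuous)
    have "((\<lambda>t. G t * of_real (bump (t0 - e) (t0 + e) t)) has_integral 0) (seg b)"
      using integrable_integral[OF gi] b(3) by simp
    from has_integral_Re[OF has_integral_mult_right[OF this, of "cnj (G t0)"]]
    have fi: "integral (seg b) f = 0" unfolding f_def by (simp add: integral_unique)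
    have fn: "0 \<le> f t \<and> (t = t0 \<longrightarrow> 0 < f t)" if "t \<in> I" for t
    proof (cases "t0 - e < t \<and> t < t0 + e")
      case True
      then have "dist (G t) (G t0) < cmod (G t0)"
        using e d(1) by (intro d that) (auto simp: dist_real_def)
      then have l: "cmod (G t - G t0) < cmod (G t0)" by (simp add: dist_norm)
      have "Re (cnj (G t0) * G t) = (cmod (G t0))\<^sup>2 + Re (cnj (G t0) * (G t - G t0))"
        by (simp add: cmod_power2 algebra_simps) (simp add: power2_eq_square)
      moreover have "\<bar>Re (cnj (G t0) * (G t - G t0))\<bar> \<le> cmod (G t0) * cmod (G t - G t0)"
        using abs_Re_le_cmod[of "cnj (G t0) * (G t - G t0)"] by (simp add: norm_mult)
      moreover have "cmod (G t0) * cmod (G t - G t0) < cmod (G t0) * cmod (G t0)"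
        using l G0 by (intro mult_strict_left_mono) auto
      ultimately have "0 < Re (cnj (G t0) * G t)" by (simp add: power2_eq_square)
      moreover have "0 < bump (t0 - e) (t0 + e) t" using True by (simp add: bump_pos_iff)
      moreover have "f t = Re (cnj (G t0) * G t) * bump (t0 - e) (t0 + e) t"
        by (simp add: f_def mult.assoc[symmetric])
      ultimately have "0 < f t" by (simp only: mult_pos_pos)
      then show ?thesis by auto
    next
      case False
      then have "f t = 0" "t \<noteq> t0" using bump_zero[OF False] e(1) by (auto simp: f_def)
      then show ?thesis by simp
    qed
    have fc: "continuous_on I f" unfolding f_def by (intro continuous_intros G bump_continuous)
    obtain l u where lu: "seg b = {l..u}" unfolding seg_def by metis
    have "t0 - e \<in> {l..u}" "t0 + e \<in> {l..u}" "t0 \<in> {l..u}" using b(2) e(1) unfolding lu[symmetric] by auto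
    then have "l < u" using e(1) by auto
    have "\<forall>t\<in>{l..u}. f t = 0"
      using fi fn seg_subset[OF b(1)] unfolding lu
      by (subst integral_eq_0_iff[symmetric]) (auto intro: continuous_on_subset[OF fc] \<open>l < u\<close>)
    then have "f t0 = 0" using \<open>t0 \<in> {l..u}\<close> by blast
    then show False using fn[OF t0(1)] by simp
  qed
  have "G 0 = 0"
  proof (rule tendsto_unique[OF within_neq_bot[OF zero_in]])
    show "(G \<longlongrightarrow> G 0) (at 0 within I)" using G zero_in by (auto simp: continuous_on_def)
    show "(G \<longlongrightarrow> 0) (at 0 within I)"
      by (rule tendsto_eventually) (use inner in \<open>auto simp: eventually_at_filter intro!: always_eventually\<close>)
  qed
  then show ?thesis using inner t by blast
qed

text \<open>A du Bois-Reymond argument. With \<open>P\<close> an antiderivative of the right-hand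
  side, the weak equation says that \<open>G = a - a0 - P\<close> integrates to zero against every
  bump, so \<open>G\<close> vanishes. This gives the initial value and the differential equation
  together.\<close>

lemma weak_solution_modes:
  assumes a: "curve m r a" and r: "0 < r"
    and v: "\<And>t. t \<in> I \<Longrightarrow> v t \<in> borel_measurable borel" "\<And>t. t \<in> I \<Longrightarrow> torus_ae_eq (v t) (fseries (a t))"
    and u0: "u0 \<in> borel_measurable borel" "torus_ae_eq u0 (fseries a0)" "l1 a0"
    and weak: "\<And>\<phi>. \<phi> \<in> test_functions I \<Longrightarrow> weak_equation \<alpha>1 \<alpha>2 \<gamma>1 \<gamma>2 \<Gamma> I \<sigma> u0 v \<phi>"
  shows "a 0 k = a0 k" "t \<in> I \<Longrightarrow> ((\<lambda>t. a t k) has_vector_derivative mode_rhs \<alpha>1 \<alpha>2 \<gamma>1 \<gamma>2 \<Gamma> (a t) k) (at t within I)"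
proof -
  define R where "R t = mode_rhs \<alpha>1 \<alpha>2 \<gamma>1 \<gamma>2 \<Gamma> (a t) k" for t
  have Rc: "continuous_on I R" unfolding R_def by (rule mode_rhs_continuous[OF a r])
  obtain P where P: "P 0 = 0" "\<And>t. t \<in> I \<Longrightarrow> (P has_vector_derivative R t) (at t within I)"
    using antiderivative[OF Rc] by blast
  have Pc: "continuous_on I P" using P(2) by (meson continuous_on_eq_continuous_within has_vector_derivative_continuous)
  define G where "G t = a t k - a0 k - P t" for t
  have Gc: "continuous_on I G" unfolding G_def by (intro continuous_intros curve_continuous[OF a] Pc)
  have "G t = 0" if "t \<in> I" for t
  proof (rule continuous_zero_of_bumps[OF Gc _ that])
    fix \<alpha> \<beta> :: real assume \<alpha>\<beta>: "\<alpha> < \<beta>" "{\<alpha>..\<beta>} \<subseteq> I - {0}"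
    obtain \<eta> c where \<eta>: "smooth_fun \<eta>" "\<And>t. (\<eta> has_real_derivative - \<sigma> * bump \<alpha> \<beta> t) (at t)"
      and c: "0 < c" "c < T" "\<And>t. t \<in> I \<Longrightarrow> c \<le> \<bar>t\<bar> \<Longrightarrow> \<eta> t = 0"
      using cutoff[OF \<alpha>\<beta>] by metis
    define b where "b = max c (max \<bar>\<alpha>\<bar> \<bar>\<beta>\<bar>)"
    have "\<alpha> \<in> I" "\<beta> \<in> I"
      using subsetD[OF \<alpha>\<beta>(2), of \<alpha>] subsetD[OF \<alpha>\<beta>(2), of \<beta>] \<alpha>\<beta>(1) by auto
    then have b: "0 < b" "b < T" using c I by (auto simp: b_def)
    have sub: "{\<alpha>..\<beta>} \<subseteq> seg b" 
    proof
      fix x assume x: "x \<in> {\<alpha>..\<beta>}"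
      then have "\<bar>x\<bar> \<le> b" by (auto simp: b_def)
      moreover have "x \<in> I" using \<alpha>\<beta>(2) x by blast
      ultimately show "x \<in> seg b" using seg_iff[of b x] b by simp
    qed
    have bz: "bump \<alpha> \<beta> t = 0" if "b \<le> \<bar>t\<bar>" for t
      using that by (intro bump_zero) (auto simp: b_def)
    have cz: "\<eta> t = 0" if "t \<in> I" "b \<le> \<bar>t\<bar>" for t using c(3) that by (auto simp: b_def)
    define \<eta>' where "\<eta>' t = - \<sigma> * bump \<alpha> \<beta> t" for t
    have \<eta>c: "((\<lambda>t. complex_of_real (\<eta> t)) has_vector_derivative of_real (\<eta>' t)) (at t within I)" for t
      unfolding \<eta>'_def by (rule has_vector_derivative_of_real[OF has_field_derivative_at_within[OF \<eta>(2)]])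
    \<comment> \<open>Against \<open>wave (- k)\<close> all modes other than \<open>k\<close>
      integrate to zero, so the sum of the mode defects reduces to a single term.\<close>
    define \<phi> where "\<phi> = (\<lambda>t x. of_real (\<eta> t) * wave (- k) x)"
    have \<phi>: "\<phi> \<in> test_functions I"
      unfolding \<phi>_def by (rule wave_test_function[OF \<eta>(1), of b]) (use b cz in auto)
    have dt: "d_t I \<phi> t x = of_real (\<eta>' t) * wave (- k) x" if "t \<in> I" for t x
    proof -
      have "((\<lambda>\<tau>. of_real (\<eta> \<tau>) * wave (- k) x) has_vector_derivative of_real (\<eta>' t) * wave (- k) x) (at t within I)"
        by (rule has_vector_derivative_mult_left[OF \<eta>c])
      from vector_derivative_within_I[OF that this] show ?thesis by (simp only: d_t_def \<phi>_def)
    qed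
    have wi: "wave_integral (\<lambda>x. c * wave (- k) x) j = (if j = k then c * of_real (2 * pi) else 0)" for c j
      using integral_wave[of "j - k"] by (simp add: wave_integral_def wave_mult mult.left_commute)
    have w1: "wave_integral (\<phi> t) j = (if j = k then of_real (\<eta> t) * of_real (2 * pi) else 0)" for t j
      unfolding \<phi>_def by (rule wi)
    have w2: "wave_integral (d_t I \<phi> t) j = (if j = k then of_real (\<eta>' t) * of_real (2 * pi) else 0)" if "t \<in> I" for t j
      using wi[of "of_real (\<eta>' t)" j] dt[OF that] by (metis (no_types, lifting) ext)
    have "(mode_defect \<alpha>1 \<alpha>2 \<gamma>1 \<gamma>2 \<Gamma> b a0 a \<phi> has_sum 0) UNIV"
    proof (subst weak_equation_modes[OF \<phi> a r v u0 b, symmetric])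
      show "\<phi> t x = 0 \<and> d_t I \<phi> t x = 0" if "t \<in> I" "b \<le> \<bar>t\<bar>" for t x
        using dt[OF that(1)] cz[OF that] bz[OF that(2)] by (simp add: \<phi>_def \<eta>'_def)
    qed (use weak[OF \<phi>] in auto)
    moreover have "mode_defect \<alpha>1 \<alpha>2 \<gamma>1 \<gamma>2 \<Gamma> b a0 a \<phi> j = 0" if "j \<noteq> k" for j
    proof -
      have "integral (seg b) (\<lambda>t. a t j * wave_integral (d_t I \<phi> t) j) = integral (seg b) (\<lambda>t. 0)"
        by (rule integral_cong) (use w2 seg_subset[OF b(2)] that in auto)
      then show ?thesis using that by (simp add: mode_defect_def w1)
    qed
    then have "(mode_defect \<alpha>1 \<alpha>2 \<gamma>1 \<gamma>2 \<Gamma> b a0 a \<phi> has_sum mode_defect \<alpha>1 \<alpha>2 \<gamma>1 \<gamma>2 \<Gamma> b a0 a \<phi> k) UNIV"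
      by (intro has_sum_finite_neutralI[where B = "{k}"]) auto
    ultimately have D: "mode_defect \<alpha>1 \<alpha>2 \<gamma>1 \<gamma>2 \<Gamma> b a0 a \<phi> k = 0" using has_sum_unique by blast
    have i: "(\<lambda>t. f t * of_real (\<eta>' t)) integrable_on (seg b)" if "continuous_on I f" for f :: "real \<Rightarrow> complex"
      unfolding \<eta>'_def by (intro integrable_seg b continuous_intros that bump_continuous)
    have \<eta>cont: "continuous_on I (\<lambda>t. complex_of_real (\<eta> t))"
      using \<eta>c by (meson continuous_on_eq_continuous_within has_vector_derivative_continuous)
    have j: "(\<lambda>t. R t * of_real (\<eta> t)) integrable_on (seg b)"
      by (intro integrable_seg b continuous_intros Rc \<eta>cont)
    have E1: "integral (seg b) (\<lambda>t. a t k * of_real (\<eta>' t)) + of_real \<sigma> * (a0 k * of_real (\<eta> 0)) + integral (seg b) (\<lambda>t. R t * of_real (\<eta> t)) = 0"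
    proof -
      have "integral (seg b) (\<lambda>t. a t k * wave_integral (d_t I \<phi> t) k) = integral (seg b) (\<lambda>t. (a t k * of_real (\<eta>' t)) * of_real (2 * pi))"
        by (rule integral_cong) (use w2 seg_subset[OF b(2)] in auto)
      then have "integral (seg b) (\<lambda>t. a t k * wave_integral (d_t I \<phi> t) k) = integral (seg b) (\<lambda>t. a t k * of_real (\<eta>' t)) * of_real (2 * pi)"
        by (simp only: integral_mult_left)
      moreover have "integral (seg b) (\<lambda>t. mode_rhs \<alpha>1 \<alpha>2 \<gamma>1 \<gamma>2 \<Gamma> (a t) k * wave_integral (\<phi> t) k) = integral (seg b) (\<lambda>t. R t * of_real (\<eta> t)) * of_real (2 * pi)"
        by (simp only: w1 R_def if_True refl mult.assoc[symmetric] integral_mult_left)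
      ultimately have "(integral (seg b) (\<lambda>t. a t k * of_real (\<eta>' t)) + of_real \<sigma> * (a0 k * of_real (\<eta> 0)) + integral (seg b) (\<lambda>t. R t * of_real (\<eta> t))) * of_real (2 * pi) = 0"
        using D unfolding mode_defect_def w1 by (simp only: if_True refl distrib_right mult.assoc)
      then show ?thesis by simp
    qed
    \<comment> \<open>Integration by parts moves the derivative from \<open>P\<close> to the cutoff,
      where \<open>P 0 = 0\<close> removes the boundary term; together with \<open>E3\<close>, which
      handles the initial value, all terms carry the factor \<open>\<eta>'\<close>.\<close>
    have E2: "((\<lambda>t. P t * of_real (\<eta>' t) + R t * of_real (\<eta> t)) has_integral - of_real \<sigma> * (P 0 * of_real (\<eta> 0))) (seg b)"
      by (rule integral_derivative) (use b cz in \<open>auto intro: has_vector_derivative_mult[OF P(2) \<eta>c]\<close>)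
    have E3: "((\<lambda>t. complex_of_real (\<eta>' t)) has_integral - of_real \<sigma> * of_real (\<eta> 0)) (seg b)"
      by (rule integral_derivative[OF \<eta>c]) (use b cz in auto)
    have "integral (seg b) (\<lambda>t. P t * of_real (\<eta>' t)) + integral (seg b) (\<lambda>t. R t * of_real (\<eta> t)) = 0"
      using integral_unique[OF E2] P(1) by (simp add: integral_add[OF i[OF Pc] j])
    moreover have "integral (seg b) (\<lambda>t. a0 k * of_real (\<eta>' t)) = a0 k * (- of_real \<sigma> * of_real (\<eta> 0))"
      using integral_unique[OF has_integral_mult_right[OF E3, of "a0 k"]] .
    moreover have "integral (seg b) (\<lambda>t. G t * of_real (\<eta>' t)) = integral (seg b) (\<lambda>t. a t k * of_real (\<eta>' t)) 
      - integral (seg b) (\<lambda>t. a0 k * of_real (\<eta>' t)) - integral (seg b) (\<lambda>t. P t * of_real (\<eta>' t))"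
      unfolding G_def left_diff_distrib
      by (simp only: Henstock_Kurzweil_Integration.integral_diff[OF integrable_diff[OF i[OF curve_continuous[OF a]] i[OF continuous_on_const]] i[OF Pc]]
          Henstock_Kurzweil_Integration.integral_diff[OF i[OF curve_continuous[OF a]] i[OF continuous_on_const]])
    ultimately have "integral (seg b) (\<lambda>t. G t * of_real (\<eta>' t)) = 0"
      using E1 by (simp add: algebra_simps add_eq_0_iff)
    moreover have "(\<lambda>t. G t * of_real (\<eta>' t)) = (\<lambda>t. (G t * of_real (bump \<alpha> \<beta> t)) * (- of_real \<sigma>))"
      by (simp add: fun_eq_iff \<eta>'_def)
    ultimately have "integral (seg b) (\<lambda>t. G t * of_real (bump \<alpha> \<beta> t)) * (- of_real \<sigma>) = 0"
      by (simp only: integral_mult_left)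
    moreover have "\<sigma> \<noteq> 0" using I by auto
    ultimately have "integral (seg b) (\<lambda>t. G t * of_real (bump \<alpha> \<beta> t)) = 0" by simp
    then show "\<exists>b<T. {\<alpha>..\<beta>} \<subseteq> seg b \<and> integral (seg b) (\<lambda>t. G t * of_real (bump \<alpha> \<beta> t)) = 0"
      using b sub by blast
  qed
  then have eq: "a t k = a0 k + P t" if "t \<in> I" for t using that by (simp add: G_def algebra_simps)
  then show "a 0 k = a0 k" using zero_in P(1) by simp
  show "((\<lambda>t. a t k) has_vector_derivative mode_rhs \<alpha>1 \<alpha>2 \<gamma>1 \<gamma>2 \<Gamma> (a t) k) (at t within I)" if t: "t \<in> I"
  proof (rule has_vector_derivative_transform[OF t])
    show "((\<lambda>t. a0 k + P t) has_vector_derivative mode_rhs \<alpha>1 \<alpha>2 \<gamma>1 \<gamma>2 \<Gamma> (a t) k) (at t within I)"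
      using has_vector_derivative_add[OF has_vector_derivative_const P(2)[OF t]] by (simp add: R_def)
  qed (rule eq)
qed

end

section \<open>Solving the equations of the Fourier modes\<close>

text \<open>Multiplication by \<open>cis (t * omega k)\<close> removes the dispersive part, whose growth in \<open>k\<close> the
  abstract Cauchy problem cannot absorb.\<close>

definition phase_symbol :: "real \<Rightarrow> real \<Rightarrow> real \<Rightarrow> real \<Rightarrow> real \<Rightarrow> real \<Rightarrow> int \<Rightarrow> int \<Rightarrow> int \<Rightarrow> complex" where
  "phase_symbol \<alpha>1 \<alpha>2 \<gamma>1 \<gamma>2 \<Gamma> s k i j = nonlin \<gamma>1 \<gamma>2 \<Gamma> k i j *
     cis (s * (omega \<alpha>1 \<alpha>2 k - omega \<alpha>1 \<alpha>2 i - omega \<alpha>1 \<alpha>2 j + omega \<alpha>1 \<alpha>2 (i + j - k)))"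

lemma symbol_phase_symbol:
  "0 \<le> T \<Longrightarrow> symbol (phase_symbol \<alpha>1 \<alpha>2 \<gamma>1 \<gamma>2 \<Gamma>) \<bar>\<gamma>1\<bar> (\<bar>\<gamma>2\<bar> + \<bar>\<Gamma>\<bar>) T"
  by unfold_locales (auto simp: phase_symbol_def norm_mult nonlin_bound intro!: continuous_intros)

lemma trilin_phase:
  "trilin (phase_symbol \<alpha>1 \<alpha>2 \<gamma>1 \<gamma>2 \<Gamma> s) (\<lambda>k. cis (s * omega \<alpha>1 \<alpha>2 k) * a k) (\<lambda>k. cis (s * omega \<alpha>1 \<alpha>2 k) * a k)
      (\<lambda>k. cis (s * omega \<alpha>1 \<alpha>2 k) * a k) k
   = cis (s * omega \<alpha>1 \<alpha>2 k) * trilin (nonlin \<gamma>1 \<gamma>2 \<Gamma>) a a a k"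
proof -
  have eq: "phase_symbol \<alpha>1 \<alpha>2 \<gamma>1 \<gamma>2 \<Gamma> s k i j * (cis (s * omega \<alpha>1 \<alpha>2 i) * a i) * (cis (s * omega \<alpha>1 \<alpha>2 j) * a j) *
     cnj (cis (s * omega \<alpha>1 \<alpha>2 (i + j - k)) * a (i + j - k)) =
     cis (s * omega \<alpha>1 \<alpha>2 k) * (nonlin \<gamma>1 \<gamma>2 \<Gamma> k i j * a i * a j * cnj (a (i + j - k)))" for i j
  proof -
    define w where "w = omega \<alpha>1 \<alpha>2"
    have "cis (s * (w k - w i - w j + w (i + j - k))) * cis (s * w i) * cis (s * w j) * cis (- (s * w (i + j - k))) = cis (s * w k)"
      by (simp add: cis_mult algebra_simps)
    then show ?thesis
      unfolding phase_symbol_def w_def[symmetric] by (simp add: cis_cnj mult_ac)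
  qed
  show ?thesis
    unfolding trilin_def infsum_cmult_right'[symmetric]
    by (rule infsum_cong) (simp only: split_paired_all prod.case eq)
qed

text \<open>The equation is required in the open interval only, and both end points are reached by
  continuity. For weak solutions nothing is known about the derivative at the outer end
  point.\<close>

definition mode_solution ::
  "real \<Rightarrow> real \<Rightarrow> real \<Rightarrow> real \<Rightarrow> real \<Rightarrow> real \<Rightarrow> (int \<Rightarrow> complex) \<Rightarrow> (real \<Rightarrow> int \<Rightarrow> complex) \<Rightarrow> bool" where
  "mode_solution \<alpha>1 \<alpha>2 \<gamma>1 \<gamma>2 \<Gamma> T a0 a \<longleftrightarrow> (\<forall>k. a 0 k = a0 k) \<and> (\<forall>k. continuous_on {0..T} (\<lambda>t. a t k)) \<and>
     (\<forall>t\<in>{0<..<T}. \<forall>k. ((\<lambda>t. a t k) has_vector_derivative mode_rhs \<alpha>1 \<alpha>2 \<gamma>1 \<gamma>2 \<Gamma> (a t) k) (at t))"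

lemma cis_has_vector_derivative:
  "((\<lambda>t. cis (t * w)) has_vector_derivative \<i> * of_real w * cis (t * w)) (at t within S)"
  unfolding cis_conv_exp of_real_mult
  by (rule has_vector_derivative_real_field[of "\<lambda>z. exp (\<i> * (z * of_real w))"])
     (auto intro!: derivative_eq_intros simp: mult_ac)

lemma mode_solution_mild:
  assumes T: "0 \<le> T" and a: "mode_solution \<alpha>1 \<alpha>2 \<gamma>1 \<gamma>2 \<Gamma> T a0 a"
  shows "symbol.mild (phase_symbol \<alpha>1 \<alpha>2 \<gamma>1 \<gamma>2 \<Gamma>) T a0 (\<lambda>t k. cis (t * omega \<alpha>1 \<alpha>2 k) * a t k)"
proof -
  interpret symbol "phase_symbol \<alpha>1 \<alpha>2 \<gamma>1 \<gamma>2 \<Gamma>" "\<bar>\<gamma>1\<bar>" "\<bar>\<gamma>2\<bar> + \<bar>\<Gamma>\<bar>" T by (rule symbol_phase_symbol[OF T])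
  show ?thesis
    unfolding mild_def trilin_phase
  proof (intro ballI allI)
    fix t k assume t: "t \<in> {0..T}"
    have "((\<lambda>s. cis (s * omega \<alpha>1 \<alpha>2 k) * trilin (nonlin \<gamma>1 \<gamma>2 \<Gamma>) (a s) (a s) (a s) k) has_integral
      cis (t * omega \<alpha>1 \<alpha>2 k) * a t k - cis (0 * omega \<alpha>1 \<alpha>2 k) * a 0 k) {0..t}"
    proof (rule fundamental_theorem_of_calculus_interior)
      show "continuous_on {0..t} (\<lambda>s. cis (s * omega \<alpha>1 \<alpha>2 k) * a s k)"
      proof (intro continuous_intros)
        show "continuous_on {0..t} (\<lambda>s. a s k)"
          by (rule continuous_on_subset[of "{0..T}"]) (use a t in \<open>auto simp: mode_solution_def\<close>)
      qed
      fix s assume s: "s \<in> {0<..<t}"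
      have "((\<lambda>s. a s k) has_vector_derivative mode_rhs \<alpha>1 \<alpha>2 \<gamma>1 \<gamma>2 \<Gamma> (a s) k) (at s)"
        using a s t by (auto simp: mode_solution_def)
      from has_vector_derivative_mult[OF cis_has_vector_derivative[of "omega \<alpha>1 \<alpha>2 k"] this]
      show "((\<lambda>s. cis (s * omega \<alpha>1 \<alpha>2 k) * a s k) has_vector_derivative
         cis (s * omega \<alpha>1 \<alpha>2 k) * trilin (nonlin \<gamma>1 \<gamma>2 \<Gamma>) (a s) (a s) (a s) k) (at s)"
        by (simp add: mode_rhs_def algebra_simps)
    qed (use t in auto)
    from integral_unique[OF this]
    show "cis (t * omega \<alpha>1 \<alpha>2 k) * a t k = a0 k + integral {0..t} (\<lambda>s. cis (s * omega \<alpha>1 \<alpha>2 k) * trilin (nonlin \<gamma>1 \<gamma>2 \<Gamma>) (a s) (a s) (a s) k)"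
      using a by (simp add: mode_solution_def)
  qed
qed

lemma mode_solution_unique:
  assumes T: "0 \<le> T" and r: "0 < r"
    and a: "mode_solution \<alpha>1 \<alpha>2 \<gamma>1 \<gamma>2 \<Gamma> T a0 a" "\<And>t. t \<in> {0..T} \<Longrightarrow> decay m r (a t)"
    and b: "mode_solution \<alpha>1 \<alpha>2 \<gamma>1 \<gamma>2 \<Gamma> T a0 b" "\<And>t. t \<in> {0..T} \<Longrightarrow> decay m r (b t)"
    and t: "t \<in> {0..T}"
  shows "a t k = b t k"
proof -
  interpret symbol "phase_symbol \<alpha>1 \<alpha>2 \<gamma>1 \<gamma>2 \<Gamma>" "\<bar>\<gamma>1\<bar>" "\<bar>\<gamma>2\<bar> + \<bar>\<Gamma>\<bar>" T by (rule symbol_phase_symbol[OF T])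
  have "cis (t * omega \<alpha>1 \<alpha>2 k) * a t k = cis (t * omega \<alpha>1 \<alpha>2 k) * b t k"
    by (rule mild_unique[OF r _ _ _ _ mode_solution_mild[OF T b(1)] mode_solution_mild[OF T a(1)] t, of m])
       (use a b in \<open>auto simp: mode_solution_def norm_mult decay_def intro!: continuous_intros\<close>)
  then show ?thesis by simp
qed

lemma mode_solution_exists:
  assumes T0: "0 < T" and r: "0 < r" and R: "((\<lambda>k. exp (r * \<bar>real_of_int k\<bar>) * cmod (a0 k)) has_sum R) UNIV"
    and small: "(\<bar>\<gamma>1\<bar> * T + (\<bar>\<gamma>2\<bar> + \<bar>\<Gamma>\<bar>) * (2 * T / r)) * (8 * R\<^sup>2) \<le> 1"
  obtains a B where "a 0 = a0" "\<And>t k. t \<in> {0..T} \<Longrightarrow> cmod (a t k) \<le> exp (- (r / 2 * \<bar>real_of_int k\<bar>)) * B k"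
    "B summable_on UNIV"
    "\<And>t k. t \<in> {0..T} \<Longrightarrow> ((\<lambda>t. a t k) has_vector_derivative mode_rhs \<alpha>1 \<alpha>2 \<gamma>1 \<gamma>2 \<Gamma> (a t) k) (at t within {0..T})"
proof -
  interpret symbol "phase_symbol \<alpha>1 \<alpha>2 \<gamma>1 \<gamma>2 \<Gamma>" "\<bar>\<gamma>1\<bar>" "\<bar>\<gamma>2\<bar> + \<bar>\<Gamma>\<bar>" T
    by (rule symbol_phase_symbol) (use T0 in simp)
  \<comment> \<open>With this slope the radius falls from \<open>r\<close> to exactly
    \<open>r / 2\<close> at time \<open>T\<close>, and the gain \<open>1 / l\<close> becomes the
    term \<open>2 * T / r\<close> of the smallness condition.\<close>
  define l where "l = r / (2 * T)"
  have l: "0 < l" "0 < r - l * T" "l * T = r / 2" "1 / l = 2 * T / r" using T0 r by (auto simp: l_def)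
  have small': "(\<bar>\<gamma>1\<bar> * T + (\<bar>\<gamma>2\<bar> + \<bar>\<Gamma>\<bar>) / l) * (8 * R\<^sup>2) \<le> 1"
    using small unfolding l(4)[symmetric] by simp
  have "0 \<le> exp (r * \<bar>real_of_int k\<bar>) * cmod (a0 k)"
    and "cmod (a0 k) \<le> exp (- (r * \<bar>real_of_int k\<bar>)) * (exp (r * \<bar>real_of_int k\<bar>) * cmod (a0 k))" for k
    by (simp_all add: mult.assoc[symmetric] exp_add[symmetric])
  then obtain z B where z: "majorised r l B z" "mild a0 z"
    using mild_exists[OF l(1,2) R _ _ small', of a0] by blast
  define a where "a t k = cis (- (t * omega \<alpha>1 \<alpha>2 k)) * z t k" for t k
  have za: "z t = (\<lambda>k. cis (t * omega \<alpha>1 \<alpha>2 k) * a t k)" for t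
    by (simp add: a_def mult.assoc[symmetric] cis_mult)
  show ?thesis
  proof (rule that)
    show "a 0 = a0" using z(2) T0 by (auto simp: a_def mild_def)
    show "B summable_on UNIV" by (rule majorised_summable[OF z(1)])
    fix t k assume t: "t \<in> {0..T}"
    have "l * t \<le> l * T" using t l by auto
    then have "r / 2 \<le> r - l * t" using l by linarith
    then have "r / 2 * \<bar>real_of_int k\<bar> \<le> (r - l * t) * \<bar>real_of_int k\<bar>" by (intro mult_right_mono) auto
    then have "exp (- ((r - l * t) * \<bar>real_of_int k\<bar>)) \<le> exp (- (r / 2 * \<bar>real_of_int k\<bar>))" by simp
    from mult_right_mono[OF this majorised_nonneg[OF z(1)]]
    show "cmod (a t k) \<le> exp (- (r / 2 * \<bar>real_of_int k\<bar>)) * B k"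
      using majorised_bound[OF z(1) t, of k] by (simp add: a_def norm_mult) (meson order_trans)
    let ?f = "\<lambda>s. trilin (phase_symbol \<alpha>1 \<alpha>2 \<gamma>1 \<gamma>2 \<Gamma> s) (z s) (z s) (z s) k"
    have "((\<lambda>t. a0 k + integral {0..t} ?f) has_vector_derivative 0 + ?f t) (at t within {0..T})"
      by (intro has_vector_derivative_add has_vector_derivative_const integral_has_vector_derivative t
            trilin_continuous[OF l(1,2) z(1) z(1) z(1)])
    then have "((\<lambda>t. z t k) has_vector_derivative 0 + ?f t) (at t within {0..T})"
      by (rule has_vector_derivative_transform[OF t, rotated]) (use z(2) in \<open>auto simp: mild_def\<close>)
    moreover have "((\<lambda>t. cis (t * - omega \<alpha>1 \<alpha>2 k)) has_vector_derivative \<i> * of_real (- omega \<alpha>1 \<alpha>2 k) * cis (t * - omega \<alpha>1 \<alpha>2 k)) (at t within {0..T})"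
      by (rule cis_has_vector_derivative)
    ultimately have "((\<lambda>t. cis (t * - omega \<alpha>1 \<alpha>2 k) * z t k) has_vector_derivative
       cis (t * - omega \<alpha>1 \<alpha>2 k) * (0 + ?f t) + \<i> * of_real (- omega \<alpha>1 \<alpha>2 k) * cis (t * - omega \<alpha>1 \<alpha>2 k) * z t k) (at t within {0..T})"
      by (intro has_vector_derivative_mult)
    moreover have "cis (t * - omega \<alpha>1 \<alpha>2 k) * (0 + ?f t) = trilin (nonlin \<gamma>1 \<gamma>2 \<Gamma>) (a t) (a t) (a t) k"
      unfolding za trilin_phase by (simp add: mult.assoc[symmetric] cis_mult)
    ultimately show "((\<lambda>t. a t k) has_vector_derivative mode_rhs \<alpha>1 \<alpha>2 \<gamma>1 \<gamma>2 \<Gamma> (a t) k) (at t within {0..T})"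
      by (simp add: a_def mode_rhs_def mult.assoc add.commute)
  qed
qed

text \<open>Applied with the sign \<open>\<sigma>\<close>: under the substitution of
  \<open>\<sigma> * t\<close> for \<open>t\<close>, the factor from the chain rule goes into the
  constants of the equation.\<close>

lemma mode_rhs_scale:
  "mode_rhs (c * \<alpha>1) (c * \<alpha>2) (c * \<gamma>1) (c * \<gamma>2) (c * \<Gamma>) a k = of_real c * mode_rhs \<alpha>1 \<alpha>2 \<gamma>1 \<gamma>2 \<Gamma> a k"
proof -
  have "omega (c * \<alpha>1) (c * \<alpha>2) k = c * omega \<alpha>1 \<alpha>2 k" by (simp add: omega_def algebra_simps)
  moreover have "trilin (nonlin (c * \<gamma>1) (c * \<gamma>2) (c * \<Gamma>)) a a a k = of_real c * trilin (nonlin \<gamma>1 \<gamma>2 \<Gamma>) a a a k"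
    unfolding trilin_def infsum_cmult_right'[symmetric] nonlin_def
    by (rule infsum_cong) (auto simp: algebra_simps)
  ultimately show ?thesis by (simp add: mode_rhs_def algebra_simps)
qed

context half_interval
begin

lemma sigma_sq: "\<sigma> * \<sigma> = 1" "\<bar>\<sigma>\<bar> = 1" "\<sigma> * (\<sigma> * t) = t"
  using I by auto

text \<open>Reversing time amounts to negating all constants, so both half intervals reduce to \<open>{0..T}\<close>.\<close>

lemma half_mode_unique:
  assumes r: "0 < r"
    and a: "\<And>k. continuous_on {-T..T} (\<lambda>t. a t k)" "\<And>t. t \<in> {-T..T} \<Longrightarrow> decay m r (a t)"
      "\<And>t k. t \<in> I \<Longrightarrow> ((\<lambda>t. a t k) has_vector_derivative mode_rhs \<alpha>1 \<alpha>2 \<gamma>1 \<gamma>2 \<Gamma> (a t) k) (at t within I)"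
    and b: "\<And>k. continuous_on {-T..T} (\<lambda>t. b t k)" "\<And>t. t \<in> {-T..T} \<Longrightarrow> decay m r (b t)"
      "\<And>t k. t \<in> I \<Longrightarrow> ((\<lambda>t. b t k) has_vector_derivative mode_rhs \<alpha>1 \<alpha>2 \<gamma>1 \<gamma>2 \<Gamma> (b t) k) (at t within I)"
    and ab: "a 0 = b 0" and t: "t \<in> {-T..T}" "0 \<le> \<sigma> * t"
  shows "a t k = b t k"
proof -
  have sol: "mode_solution (\<sigma> * \<alpha>1) (\<sigma> * \<alpha>2) (\<sigma> * \<gamma>1) (\<sigma> * \<gamma>2) (\<sigma> * \<Gamma>) T (f 0) (\<lambda>s. f (\<sigma> * s))"
    if f: "\<And>k. continuous_on {-T..T} (\<lambda>t. f t k)"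
      "\<And>t k. t \<in> I \<Longrightarrow> ((\<lambda>t. f t k) has_vector_derivative mode_rhs \<alpha>1 \<alpha>2 \<gamma>1 \<gamma>2 \<Gamma> (f t) k) (at t within I)" for f
    unfolding mode_solution_def mode_rhs_scale
  proof (intro conjI allI ballI)
    show "continuous_on {0..T} (\<lambda>t. f (\<sigma> * t) k)" for k
      by (rule continuous_on_compose2[OF f(1)]) (use I in \<open>auto intro!: continuous_intros\<close>)
    fix s k assume s: "s \<in> {0<..<T}"
    have i: "\<sigma> * s \<in> interior I" using I s by auto
    then have "\<sigma> * s \<in> I" using interior_subset by blast
    from f(2)[OF this, of k] have "((\<lambda>t. f t k) has_vector_derivative mode_rhs \<alpha>1 \<alpha>2 \<gamma>1 \<gamma>2 \<Gamma> (f (\<sigma> * s)) k) (at (\<sigma> * s))"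
      using at_within_interior[OF i] by simp
    moreover have "((\<lambda>s. \<sigma> * s) has_vector_derivative \<sigma>) (at s)"
      by (auto intro!: derivative_eq_intros simp: has_real_derivative_iff_has_vector_derivative[symmetric])
    ultimately show "((\<lambda>t. f (\<sigma> * t) k) has_vector_derivative of_real \<sigma> * mode_rhs \<alpha>1 \<alpha>2 \<gamma>1 \<gamma>2 \<Gamma> (f (\<sigma> * s)) k) (at s)"
      using vector_diff_chain_at[of "\<lambda>s. \<sigma> * s" \<sigma> s "\<lambda>t. f t k"] by (simp add: o_def scaleR_conv_of_real)
  qed simp
  have in_T: "\<sigma> * s \<in> {-T..T}" if "s \<in> {0..T}" for s using that I by auto
  have "a (\<sigma> * (\<sigma> * t)) k = b (\<sigma> * (\<sigma> * t)) k"
  proof (rule mode_solution_unique[OF _ r sol[OF a(1,3)] _ sol[OF b(1,3), folded ab]])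
    show "\<sigma> * t \<in> {0..T}" using t I by auto
  qed (use T a(2) b(2) in_T in auto)
  then show ?thesis by (simp add: sigma_sq)
qed

lemma half_mode_exists:
  assumes r: "0 < r" and R: "((\<lambda>k. exp (r * \<bar>real_of_int k\<bar>) * cmod (a0 k)) has_sum R) UNIV"
    and small: "(\<bar>\<gamma>1\<bar> * T + (\<bar>\<gamma>2\<bar> + \<bar>\<Gamma>\<bar>) * (2 * T / r)) * (8 * R\<^sup>2) \<le> 1"
  obtains a B where "a 0 = a0" "\<And>t k. t \<in> {-T..T} \<Longrightarrow> 0 \<le> \<sigma> * t \<Longrightarrow> cmod (a t k) \<le> exp (- (r / 2 * \<bar>real_of_int k\<bar>)) * B k"
    "B summable_on UNIV" "\<And>k. continuous_on {t\<in>{-T..T}. 0 \<le> \<sigma> * t} (\<lambda>t. a t k)"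
    "\<And>t k. t \<in> I \<Longrightarrow> ((\<lambda>t. a t k) has_vector_derivative mode_rhs \<alpha>1 \<alpha>2 \<gamma>1 \<gamma>2 \<Gamma> (a t) k) (at t within I)"
proof -
  have "(\<bar>\<sigma> * \<gamma>1\<bar> * T + (\<bar>\<sigma> * \<gamma>2\<bar> + \<bar>\<sigma> * \<Gamma>\<bar>) * (2 * T / r)) * (8 * R\<^sup>2) \<le> 1"
    using small by (simp add: abs_mult sigma_sq)
  then obtain f B where f: "f 0 = a0" "\<And>t k. t \<in> {0..T} \<Longrightarrow> cmod (f t k) \<le> exp (- (r / 2 * \<bar>real_of_int k\<bar>)) * B k"
    "B summable_on UNIV"
    "\<And>t k. t \<in> {0..T} \<Longrightarrow> ((\<lambda>t. f t k) has_vector_derivative mode_rhs (\<sigma> * \<alpha>1) (\<sigma> * \<alpha>2) (\<sigma> * \<gamma>1) (\<sigma> * \<gamma>2) (\<sigma> * \<Gamma>) (f t) k) (at t within {0..T})"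
    using mode_solution_exists[OF T r R] by metis
  have in_T: "\<sigma> * t \<in> {0..T}" if "t \<in> {-T..T}" "0 \<le> \<sigma> * t" for t using that I by auto
  have inI: "\<sigma> * t \<in> {0..T}" if "t \<in> I" for t using that I T by auto
  have d: "((\<lambda>t. f (\<sigma> * t) k) has_vector_derivative mode_rhs \<alpha>1 \<alpha>2 \<gamma>1 \<gamma>2 \<Gamma> (f (\<sigma> * t)) k) (at t within S)"
    if "\<sigma> * t \<in> {0..T}" "\<And>s. s \<in> S \<Longrightarrow> \<sigma> * s \<in> {0..T}" for t k S
  proof -
    have "((\<lambda>t. f t k) has_vector_derivative of_real \<sigma> * mode_rhs \<alpha>1 \<alpha>2 \<gamma>1 \<gamma>2 \<Gamma> (f (\<sigma> * t)) k) (at (\<sigma> * t) within (\<lambda>s. \<sigma> * s) ` S)"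
      using f(4)[OF that(1), of k] that(2) unfolding mode_rhs_scale
      by (rule_tac has_vector_derivative_within_subset) auto
    moreover have "((\<lambda>s. \<sigma> * s) has_vector_derivative \<sigma>) (at t within S)"
      by (auto intro!: derivative_eq_intros simp: has_real_derivative_iff_has_vector_derivative[symmetric])
    ultimately have "((\<lambda>t. f t k) \<circ> (\<lambda>s. \<sigma> * s) has_vector_derivative \<sigma> *\<^sub>R (of_real \<sigma> * mode_rhs \<alpha>1 \<alpha>2 \<gamma>1 \<gamma>2 \<Gamma> (f (\<sigma> * t)) k)) (at t within S)"
      by (intro vector_diff_chain_within)
    moreover have "\<sigma> *\<^sub>R (of_real \<sigma> * x) = x" for x :: complex
      using sigma_sq(1) by (simp add: scaleR_conv_of_real mult.assoc[symmetric] flip: of_real_mult)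
    ultimately show ?thesis by (simp add: o_def)
  qed
  show ?thesis
  proof (rule that[of "\<lambda>t. f (\<sigma> * t)" B])
    show "continuous_on {t\<in>{-T..T}. 0 \<le> \<sigma> * t} (\<lambda>t. f (\<sigma> * t) k)" for k
      unfolding continuous_on_eq_continuous_within
      by (intro ballI has_vector_derivative_continuous[OF d]) (use in_T in blast)+
  qed (use f d inI in_T in auto)
qed

end

section \<open>Regularity of functions with exponentially decaying Fourier coefficients\<close>

lemma decay_mono: "decay m r a \<Longrightarrow> m \<le> m' \<Longrightarrow> decay m' r a"
  unfolding decay_def by (meson exp_ge_zero mult_right_mono order_trans)

lemma bessel_powr_le_exp:
  assumes r: "0 < r"
  obtains C where "0 \<le> C" "\<And>k::int. (1 + (real_of_int k)\<^sup>2) powr s \<le> C * exp (r * \<bar>real_of_int k\<bar>)"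
proof (cases "0 \<le> s")
  case True
  \<comment> \<open>\<open>d \<le> 1\<close> gives \<open>d * (1 + x) \<le> exp (d * x)\<close>. The
    other bound makes the exponent \<open>2 * d * s\<close> that arises from the squared estimate at
    most \<open>r\<close>.\<close>
  define d where "d = min 1 (r / (2 * (s + 1)))"
  have d: "0 < d" "d \<le> 1" using r True by (auto simp: d_def)
  have "d \<le> r / (2 * (s + 1))" by (simp add: d_def)
  then have ds: "d * (2 * (s + 1)) \<le> r" using True by (subst (asm) pos_le_divide_eq) auto
  have le: "(1 + (real_of_int k)\<^sup>2) powr s \<le> (1 / d ^ 2) powr s * exp (r * \<bar>real_of_int k\<bar>)" for k
  proof -
    define x where "x = \<bar>real_of_int k\<bar>"
    have x: "0 \<le> x" by (simp add: x_def)
    have "d * (1 + x) \<le> 1 + d * x" using d x by (simp add: algebra_simps)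
    also have "\<dots> \<le> exp (d * x)" by (rule exp_ge_add_one_self)
    finally have "1 + x \<le> exp (d * x) / d" using d by (simp add: field_simps)
    then have "(1 + x)\<^sup>2 \<le> (exp (d * x) / d)\<^sup>2" using x by (intro power_mono) auto
    moreover have "1 + (real_of_int k)\<^sup>2 \<le> (1 + x)\<^sup>2" by (simp add: x_def power2_eq_square algebra_simps)
    moreover have "(exp (d * x) / d)\<^sup>2 = 1 / d ^ 2 * exp (2 * d * x)"
      by (simp add: power_divide power2_eq_square exp_add[symmetric])
    ultimately have "1 + (real_of_int k)\<^sup>2 \<le> 1 / d ^ 2 * exp (2 * d * x)" by linarith
    then have "(1 + (real_of_int k)\<^sup>2) powr s \<le> (1 / d ^ 2 * exp (2 * d * x)) powr s"
      using True by (intro powr_mono2) auto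
    also have "\<dots> = (1 / d ^ 2) powr s * exp (2 * d * x * s)"
    proof -
      have "(1 / d ^ 2 * exp (2 * d * x)) powr s = (1 / d ^ 2) powr s * exp (2 * d * x) powr s"
        by (rule powr_mult; simp)
      then show ?thesis by (simp only: exp_powr_real)
    qed
    also have "\<dots> \<le> (1 / d ^ 2) powr s * exp (r * x)"
    proof (intro mult_left_mono)
      have "2 * d * s \<le> r" using d(1) ds by (simp add: algebra_simps)
      then have "2 * d * s * x \<le> r * x" using x by (rule mult_right_mono)
      then show "exp (2 * d * x * s) \<le> exp (r * x)" by (simp add: mult_ac)
    qed auto
    finally show ?thesis by (simp add: x_def)
  qed
  show ?thesis by (rule that[OF _ le]) simp
next
  case False
  have "(1 + (real_of_int k)\<^sup>2) powr s \<le> 1 * exp (r * \<bar>real_of_int k\<bar>)" for k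
  proof -
    have "(1 + (real_of_int k)\<^sup>2) powr s \<le> (1 + (real_of_int k)\<^sup>2) powr 0"
      using False by (intro powr_mono) auto
    also have "\<dots> \<le> 1" by simp
    also have "1 \<le> exp (r * \<bar>real_of_int k\<bar>)" using r by simp
    finally show ?thesis by simp
  qed
  then show ?thesis by (intro that[of 1]) auto
qed

text \<open>The square of a decaying coefficient carries the rate \<open>2 * r\<close>: one half
  beats the Sobolev weight, the other keeps the terms summable. The constant is common to all
  sequences with the same \<open>m\<close> and \<open>r\<close>, which makes Sobolev norms depend
  continuously on time.\<close>

lemma sobolev_majorant:
  assumes r: "0 < r"
  obtains C where "\<And>a k. decay m r a \<Longrightarrow> (1 + (real_of_int k)\<^sup>2) powr s * (cmod (a k))\<^sup>2 \<le> C * exp (- (r * \<bar>real_of_int k\<bar>))"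
proof -
  obtain C where C: "0 \<le> C" "\<And>k::int. (1 + (real_of_int k)\<^sup>2) powr s \<le> C * exp (r * \<bar>real_of_int k\<bar>)"
    using bessel_powr_le_exp[OF r] by metis
  have "(1 + (real_of_int k)\<^sup>2) powr s * (cmod (a k))\<^sup>2 \<le> (C * m\<^sup>2) * exp (- (r * \<bar>real_of_int k\<bar>))"
    if a: "decay m r a" for a k
  proof -
    define e where "e = exp (r * \<bar>real_of_int k\<bar>)"
    have e: "0 < e" "exp (- (r * \<bar>real_of_int k\<bar>)) = 1 / e" by (simp_all add: e_def exp_minus field_simps)
    have "cmod (a k) \<le> m * (1 / e)"
      using a unfolding decay_def e(2)[symmetric] by blast
    then have "(cmod (a k))\<^sup>2 \<le> (m * (1 / e))\<^sup>2" by (intro power_mono) auto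
    then have "(1 + (real_of_int k)\<^sup>2) powr s * (cmod (a k))\<^sup>2 \<le> (C * e) * (m * (1 / e))\<^sup>2"
      using C(2)[of k] C(1) e by (intro mult_mono) (auto simp: e_def)
    also have "\<dots> = (C * m\<^sup>2) * (1 / e)" using e by (simp add: power2_eq_square field_simps)
    finally show ?thesis by (simp add: e)
  qed
  then show ?thesis by (rule that)
qed

lemma decay_sobolev:
  assumes r: "0 < r"
  obtains C where "\<And>a. decay m r a \<Longrightarrow> sobolev_summable s a \<and> sobolev_norm s a \<le> C"
proof -
  obtain C where C: "\<And>a k. decay m r a \<Longrightarrow> (1 + (real_of_int k)\<^sup>2) powr s * (cmod (a k))\<^sup>2 \<le> C * exp (- (r * \<bar>real_of_int k\<bar>))"
    using sobolev_majorant[OF r] by metis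
  have s: "(\<lambda>k::int. C * exp (- (r * \<bar>real_of_int k\<bar>))) summable_on UNIV"
    by (intro summable_on_cmult_right summable_on_exp_neg_abs r)
  have "sobolev_summable s a \<and> sobolev_norm s a \<le> sqrt (\<Sum>\<^sub>\<infinity>k::int. C * exp (- (r * \<bar>real_of_int k\<bar>)))" if a: "decay m r a" for a
  proof
    show *: "sobolev_summable s a"
      unfolding sobolev_summable_def by (rule summable_on_comparison_test[OF s]) (use C[OF a] in auto)
    show "sobolev_norm s a \<le> sqrt (\<Sum>\<^sub>\<infinity>k::int. C * exp (- (r * \<bar>real_of_int k\<bar>)))"
      unfolding sobolev_norm_def
      by (intro real_sqrt_le_mono infsum_mono s C[OF a] *[unfolded sobolev_summable_def])
  qed
  then show ?thesis by (rule that)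
qed

text \<open>Both \<open>\<bar>n\<bar>\<close> and \<open>\<bar>j\<bar>\<close> are at most
  \<open>\<bar>j\<bar> + \<bar>j - n\<bar>\<close>, so the joint decay splits into decay in
  \<open>n\<close> and summability in \<open>j\<close>, each at half the rate.\<close>

lemma abs_sq_coeff_bound:
  assumes a: "decay m r a" and r: "0 < r"
  shows "cmod (a j * cnj (a (j - n))) \<le> m\<^sup>2 * exp (- (r / 2 * \<bar>real_of_int n\<bar>)) * exp (- (r / 2 * \<bar>real_of_int j\<bar>))"
proof -
  have "cmod (a j * cnj (a (j - n))) \<le> (m * exp (- (r * \<bar>real_of_int j\<bar>))) * (m * exp (- (r * \<bar>real_of_int (j - n)\<bar>)))"
    unfolding norm_mult using a decay_nonneg[OF a] by (intro mult_mono) (auto simp: decay_def simp del: of_int_diff)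
  also have "\<dots> = m\<^sup>2 * exp (- (r * (\<bar>real_of_int j\<bar> + \<bar>real_of_int (j - n)\<bar>)))"
    by (simp add: power2_eq_square exp_add[symmetric] distrib_left del: of_int_diff)
  also have "\<dots> \<le> m\<^sup>2 * exp (- (r / 2 * \<bar>real_of_int n\<bar> + r / 2 * \<bar>real_of_int j\<bar>))"
  proof (intro mult_left_mono)
    have "r / 2 * (\<bar>real_of_int n\<bar> + \<bar>real_of_int j\<bar>) \<le> r / 2 * (2 * (\<bar>real_of_int j\<bar> + \<bar>real_of_int (j - n)\<bar>))"
    proof (intro mult_left_mono)
      have "\<bar>real_of_int n\<bar> \<le> \<bar>real_of_int j\<bar> + \<bar>real_of_int (j - n)\<bar>" by simp
      moreover have "x + y \<le> 2 * (y + z)" if "x \<le> y + z" "0 \<le> z" for x y z :: real using that by simp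
      ultimately show "\<bar>real_of_int n\<bar> + \<bar>real_of_int j\<bar> \<le> 2 * (\<bar>real_of_int j\<bar> + \<bar>real_of_int (j - n)\<bar>)"
        using abs_ge_zero by blast
    qed (use r in simp)
    then show "exp (- (r * (\<bar>real_of_int j\<bar> + \<bar>real_of_int (j - n)\<bar>))) \<le> exp (- (r / 2 * \<bar>real_of_int n\<bar> + r / 2 * \<bar>real_of_int j\<bar>))"
      by (simp add: distrib_left)
  qed simp
  finally show ?thesis by (simp only: minus_add_distrib exp_add mult.assoc)
qed

definition dx_abs_sq_coeff :: "(int \<Rightarrow> complex) \<Rightarrow> int \<Rightarrow> complex" where
  "dx_abs_sq_coeff a n = of_real (sqrt (2 * pi)) * (\<i> * of_int n) * (\<Sum>\<^sub>\<infinity>j. a j * cnj (a (j - n)))"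

text \<open>The convolution decays at rate \<open>r / 2\<close>; half of this absorbs the factor
  \<open>n\<close> of the derivative, which leaves \<open>r / 4\<close>.\<close>

lemma dx_abs_sq_coeff_decay:
  assumes r: "0 < r"
  obtains m' where "\<And>a. decay m r a \<Longrightarrow> decay m' (r / 4) (dx_abs_sq_coeff a)"
proof -
  define S where "S = (\<Sum>\<^sub>\<infinity>j::int. exp (- (r / 2 * \<bar>real_of_int j\<bar>)))"
  have s: "(\<lambda>j::int. exp (- (r / 2 * \<bar>real_of_int j\<bar>))) summable_on UNIV"
    by (intro summable_on_exp_neg_abs) (use r in simp)
  have S: "0 \<le> S" unfolding S_def by (intro infsum_nonneg) auto
  have "decay (sqrt (2 * pi) * (4 / r) * m\<^sup>2 * S) (r / 4) (dx_abs_sq_coeff a)" if a: "decay m r a" for a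
    unfolding decay_def
  proof
    fix n
    have "cmod (\<Sum>\<^sub>\<infinity>j. a j * cnj (a (j - n))) \<le> (\<Sum>\<^sub>\<infinity>j. m\<^sup>2 * exp (- (r / 2 * \<bar>real_of_int n\<bar>)) * exp (- (r / 2 * \<bar>real_of_int j\<bar>)))"
      by (rule summable_on_dominated(2)[OF summable_on_cmult_right[OF s]]) (rule abs_sq_coeff_bound[OF a r])
    also have "\<dots> = m\<^sup>2 * exp (- (r / 2 * \<bar>real_of_int n\<bar>)) * S"
      unfolding S_def by (rule infsum_cmult_right')
    finally have "cmod (dx_abs_sq_coeff a n) \<le> sqrt (2 * pi) * \<bar>real_of_int n\<bar> * (m\<^sup>2 * exp (- (r / 2 * \<bar>real_of_int n\<bar>)) * S)"
      unfolding dx_abs_sq_coeff_def norm_mult by (intro mult_mono) auto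
    also have "exp (- (r / 2 * \<bar>real_of_int n\<bar>)) = exp (- (r / 4 * \<bar>real_of_int n\<bar>)) * exp (- (r / 4 * \<bar>real_of_int n\<bar>))"
      by (simp add: exp_add[symmetric])
    also have "sqrt (2 * pi) * \<bar>real_of_int n\<bar> * (m\<^sup>2 * (exp (- (r / 4 * \<bar>real_of_int n\<bar>)) * exp (- (r / 4 * \<bar>real_of_int n\<bar>))) * S) =
       (sqrt (2 * pi) * m\<^sup>2 * S * exp (- (r / 4 * \<bar>real_of_int n\<bar>))) * (\<bar>real_of_int n\<bar> * exp (- (r / 4 * \<bar>real_of_int n\<bar>)))"
      by (simp only: mult_ac)
    also have "\<dots> \<le> (sqrt (2 * pi) * m\<^sup>2 * S * exp (- (r / 4 * \<bar>real_of_int n\<bar>))) * (1 / (r / 4))"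
      using r S by (intro mult_left_mono mult_exp_neg_le) auto
    finally show "cmod (dx_abs_sq_coeff a n) \<le> sqrt (2 * pi) * (4 / r) * m\<^sup>2 * S * exp (- (r / 4 * \<bar>real_of_int n\<bar>))"
      by (simp add: mult_ac)
  qed
  then show ?thesis by (rule that)
qed

context half_interval
begin

lemma dx_abs_sq_coeff_continuous:
  assumes a: "curve m r a" and r: "0 < r"
  shows "continuous_on I (\<lambda>t. dx_abs_sq_coeff (a t) n)"
proof -
  have "continuous_on I (\<lambda>t. \<Sum>\<^sub>\<infinity>j. a t j * cnj (a t (j - n)))"
  proof (rule infsum_continuous_on_dominated)
    show "(\<lambda>j. m\<^sup>2 * exp (- (r / 2 * \<bar>real_of_int n\<bar>)) * exp (- (r / 2 * \<bar>real_of_int j\<bar>))) summable_on UNIV"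
      by (intro summable_on_cmult_right summable_on_exp_neg_abs) (use r in simp)
  qed (use abs_sq_coeff_bound[OF curve_decay[OF a] r] in \<open>auto intro!: continuous_intros curve_continuous[OF a]\<close>)
  then show ?thesis unfolding dx_abs_sq_coeff_def by (intro continuous_intros)
qed

lemma fseries_curve_jcont:
  assumes a: "curve m r a" and r: "0 < r"
  shows "jcont (\<lambda>t. fseries (a t))"
  unfolding fseries_def
proof (rule infsum_continuous_on_dominated)
  show "(\<lambda>k. m * exp (- (r * \<bar>real_of_int k\<bar>))) summable_on UNIV"
    by (intro summable_on_cmult_right summable_on_exp_neg_abs r)
  show "continuous_on (I \<times> UNIV) (\<lambda>p. a (fst p) k * wave k (snd p))" for k
    by (intro continuous_intros continuous_on_compose2[OF curve_continuous[OF a]]) auto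
qed (use curve_decay[OF a] in \<open>auto simp: norm_mult decay_def\<close>)

text \<open>The exponent \<open>s\<close> is arbitrary because exponential decay dominates every
  Sobolev weight. Measurability and local integrability come from joint continuity of the series,
  and the weak equation holds because every single mode defect is zero.\<close>

lemma solution_on_of_modes:
  assumes a: "curve m r a" and r: "0 < r"
    and d: "\<And>t k. t \<in> I \<Longrightarrow> ((\<lambda>t. a t k) has_vector_derivative mode_rhs \<alpha>1 \<alpha>2 \<gamma>1 \<gamma>2 \<Gamma> (a t) k) (at t within I)"
    and u: "\<And>t. t \<in> I \<Longrightarrow> u t = fseries (a t)"
    and u0: "u0 \<in> L2_torus" "torus_ae_eq u0 (fseries (a 0))" "decay m0 r0 (fourier u0)" "0 < r0"
  shows "solution_on \<alpha>1 \<alpha>2 \<gamma>1 \<gamma>2 \<Gamma> I \<sigma> s u0 u"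
proof -
  have l1: "l1 (a t)" if "t \<in> I" for t using decay_l1[OF curve_decay[OF a that] r] .
  have um: "u t \<in> borel_measurable borel" if "t \<in> I" for t
    unfolding u[OF that] by (intro fseries_measurable l1 that)
  have uj: "jcont u"
    using fseries_curve_jcont[OF a r] by (rule continuous_on_eq) (auto simp: u)
  have "u0 \<in> H_space s"
    using u0(1) decay_sobolev[OF u0(4), of m0 s] u0(3) unfolding H_space_def by blast
  moreover have "torus_periodic (u t)" if "t \<in> I" for t
    unfolding u[OF that] by (rule fseries_periodic)
  moreover have "set_borel_measurable borel (I \<times> UNIV) (\<lambda>(t, x). u t x)"
  proof -
    have "I \<times> (UNIV :: real set) \<in> sets borel" by (intro borel_Times sets_I) auto
    from borel_measurable_continuous_on_indicator[OF this uj] show ?thesis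
      by (simp add: set_borel_measurable_def case_prod_unfold)
  qed
  moreover have "Linfty_loc_H I s u"
  proof -
    have dec: "decay (sqrt (2 * pi) * m) r (fourier (u t))" if "t \<in> I" for t
      using curve_decay[OF a that] unfolding u[OF that] decay_def fourier_fseries[OF l1[OF that]]
      by (auto simp: norm_mult mult.assoc)
    obtain C where C: "\<And>a. decay (sqrt (2 * pi) * m) r a \<Longrightarrow> sobolev_summable s a \<and> sobolev_norm s a \<le> C"
      using decay_sobolev[OF r] by metis
    have "u t \<in> H_space s \<and> sobolev_norm s (fourier (u t)) \<le> C" if "t \<in> I" for t
      using C[OF dec[OF that]] fseries_L2[OF l1[OF that]] unfolding H_space_def u[OF that] by auto
    then show ?thesis
      unfolding Linfty_loc_H_def by (intro allI impI exI[of _ C] always_eventually) auto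
  qed
  moreover have "L3_loc I u"
    unfolding L3_loc_def set_integrable_def
  proof (intro allI impI)
    fix K assume K: "compact K \<and> K \<subseteq> I"
    have "continuous_on (K \<times> torus) (\<lambda>p. u (fst p) (snd p))"
      by (rule continuous_on_subset[OF uj]) (use K in auto)
    then have "continuous_on (K \<times> torus) (\<lambda>p. (cmod (u (fst p) (snd p))) ^ 3)" by (intro continuous_intros)
    moreover have "compact (K \<times> torus)" using K by (intro compact_Times) (auto simp: torus_def)
    ultimately show "integrable lborel (\<lambda>p. indicator (K \<times> torus) p *\<^sub>R (case p of (t, x) \<Rightarrow> (cmod (u t x)) ^ 3))"
      using borel_integrable_compact[of "K \<times> torus" "\<lambda>p. (cmod (u (fst p) (snd p))) ^ 3"] by (simp add: case_prod_unfold)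
  qed
  moreover have "L1_loc_H I (- s) (\<lambda>t. dx_abs_sq (u t))"
  proof -
    have eq: "distr_fourier (dx_abs_sq (u t)) = dx_abs_sq_coeff (a t)" if "t \<in> I" for t
      unfolding dx_abs_sq_coeff_def
      by (intro ext distr_fourier_dx_abs_sq um l1 that) (simp add: torus_ae_eq_def u[OF that])
    obtain m' where m': "\<And>a. decay m r a \<Longrightarrow> decay m' (r / 4) (dx_abs_sq_coeff a)"
      using dx_abs_sq_coeff_decay[OF r] by metis
    have r4: "0 < r / 4" using r by simp
    have dec: "decay m' (r / 4) (dx_abs_sq_coeff (a t))" if "t \<in> I" for t using m'[OF curve_decay[OF a that]] .
    obtain C where C: "\<And>a k. decay m' (r / 4) a \<Longrightarrow> (1 + (real_of_int k)\<^sup>2) powr (- s) * (cmod (a k))\<^sup>2 \<le> C * exp (- (r / 4 * \<bar>real_of_int k\<bar>))"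
      using sobolev_majorant[OF r4] by metis
    have cont: "continuous_on I (\<lambda>t. sobolev_norm (- s) (dx_abs_sq_coeff (a t)))"
      unfolding sobolev_norm_def
    proof (intro continuous_intros infsum_continuous_on_dominated)
      show "(\<lambda>k::int. C * exp (- (r / 4 * \<bar>real_of_int k\<bar>))) summable_on UNIV"
        by (intro summable_on_cmult_right summable_on_exp_neg_abs r4)
      show "norm ((1 + (real_of_int k)\<^sup>2) powr (- s) * (cmod (dx_abs_sq_coeff (a t) k))\<^sup>2) \<le> C * exp (- (r / 4 * \<bar>real_of_int k\<bar>))"
        if "t \<in> I" for k t using C[OF dec[OF that], of k] by simp
    qed (rule dx_abs_sq_coeff_continuous[OF a r])
    show ?thesis
      unfolding L1_loc_H_def
    proof (intro allI impI conjI)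
      fix K assume K: "compact K \<and> K \<subseteq> I"
      obtain C' where "\<And>a. decay m' (r / 4) a \<Longrightarrow> sobolev_summable (- s) a \<and> sobolev_norm (- s) a \<le> C'"
        using decay_sobolev[OF r4] by metis
      then show "AE t in lborel. t \<in> K \<longrightarrow> sobolev_summable (- s) (distr_fourier (dx_abs_sq (u t)))"
        using K dec by (intro always_eventually) (auto simp: eq subset_eq)
      have "continuous_on K (\<lambda>t. sobolev_norm (- s) (distr_fourier (dx_abs_sq (u t))))"
        by (rule continuous_on_eq[OF continuous_on_subset[OF cont]]) (use K eq in auto)
      then show "set_integrable lborel K (\<lambda>t. sobolev_norm (- s) (distr_fourier (dx_abs_sq (u t))))"
        unfolding set_integrable_def using K by (intro borel_integrable_compact) auto
    qed
  qed
  moreover have "weak_equation \<alpha>1 \<alpha>2 \<gamma>1 \<gamma>2 \<Gamma> I \<sigma> u0 u \<phi>" if \<phi>: "\<phi> \<in> test_functions I" for \<phi>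
  proof -
    obtain b where b: "0 < b" "b < T" "\<And>t x. t \<in> I \<Longrightarrow> b \<le> \<bar>t\<bar> \<Longrightarrow> \<phi> t x = 0 \<and> d_t I \<phi> t x = 0"
      using test_function(3)[OF \<phi>] by blast
    have "mode_defect \<alpha>1 \<alpha>2 \<gamma>1 \<gamma>2 \<Gamma> b (a 0) a \<phi> k = 0" for k
      by (rule mode_defect_zero[OF \<phi> a r d _ b(1,2)]) (use b(3) in auto)
    then have "(mode_defect \<alpha>1 \<alpha>2 \<gamma>1 \<gamma>2 \<Gamma> b (a 0) a \<phi> has_sum 0) UNIV"
      by (intro has_sum_0) auto
    moreover have "u0 \<in> borel_measurable borel" using u0(1) by (simp add: L2_torus_def)
    moreover have "torus_ae_eq (u t) (fseries (a t))" if "t \<in> I" for t using u[OF that] by (simp add: torus_ae_eq_def)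
    moreover have "weak_equation \<alpha>1 \<alpha>2 \<gamma>1 \<gamma>2 \<Gamma> I \<sigma> u0 u \<phi> \<longleftrightarrow> (mode_defect \<alpha>1 \<alpha>2 \<gamma>1 \<gamma>2 \<Gamma> b (a 0) a \<phi> has_sum 0) UNIV"
      by (rule weak_equation_modes[OF \<phi> a r])
         (use calculation um u0(2) l1[OF zero_in] b in blast)+
    ultimately show ?thesis by blast
  qed
  ultimately show ?thesis unfolding solution_on_def by blast
qed

end

section \<open>Continuous curves in the analytic spaces\<close>

lemma sqrt_2pi: "0 < sqrt (2 * pi)" "1 \<le> sqrt (2 * pi)"
  using pi_gt3 by auto

lemma divide_sqrt_2pi_le: "0 \<le> x \<Longrightarrow> x / sqrt (2 * pi) \<le> x"
  using divide_left_mono[OF sqrt_2pi(2), of x] sqrt_2pi(1) by simp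

lemma fourier_diff:
  assumes "f \<in> L2_torus" "g \<in> L2_torus"
  shows "fourier (\<lambda>x. f x - g x) k = fourier f k - fourier g k"
proof -
  note w = wave_mult_integrable[OF L2_torus_integrable]
  show ?thesis
    unfolding fourier_def exp_neg_eq_wave right_diff_distrib
    by (subst set_integral_diff(2)[OF w[OF assms(1)] w[OF assms(2)]]) (simp add: right_diff_distrib)
qed

lemma A_space_L2: "f \<in> A_space r \<Longrightarrow> f \<in> L2_torus"
  by (simp add: A_space_def)

lemma A_space_summable: "f \<in> A_space r \<Longrightarrow> (\<lambda>k::int. exp (r * \<bar>real_of_int k\<bar>) * cmod (fourier f k)) summable_on UNIV"
  by (simp add: A_space_def)

lemma A_weight_le_norm:
  assumes "(\<lambda>k::int. exp (r * \<bar>real_of_int k\<bar>) * cmod (fourier f k)) summable_on UNIV"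
  shows "exp (r * \<bar>real_of_int k\<bar>) * cmod (fourier f k) \<le> A_norm r f"
proof -
  have "(\<Sum>k\<in>{k}. exp (r * \<bar>real_of_int k\<bar>) * cmod (fourier f k)) \<le> A_norm r f"
    unfolding A_norm_def by (rule finite_sum_le_infsum[OF assms]) auto
  then show ?thesis by simp
qed

lemma A_space_decay:
  assumes "f \<in> A_space r"
  shows "decay (A_norm r f) r (fourier f)"
  unfolding decay_def
  using A_weight_le_norm[OF A_space_summable[OF assms]] by (simp add: exp_minus field_simps)

text \<open>The normalisation inverse to that of \<open>fseries\<close>. It is the source of the
  divisor \<open>sqrt (2 * pi)\<close> that accompanies \<open>A_norm\<close> in the smallness
  conditions.\<close>

definition fcoeff :: "(real \<Rightarrow> complex) \<Rightarrow> int \<Rightarrow> complex" where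
  "fcoeff f k = fourier f k / of_real (sqrt (2 * pi))"

lemma fcoeff_decay:
  assumes "f \<in> A_space r"
  shows "decay (A_norm r f) r (fcoeff f)"
  unfolding decay_def
proof
  fix k
  have "cmod (fcoeff f k) \<le> cmod (fourier f k)"
    using divide_sqrt_2pi_le[of "cmod (fourier f k)"] by (simp add: fcoeff_def norm_divide)
  also have "\<dots> \<le> A_norm r f * exp (- (r * \<bar>real_of_int k\<bar>))" using A_space_decay[OF assms] by (simp add: decay_def)
  finally show "cmod (fcoeff f k) \<le> A_norm r f * exp (- (r * \<bar>real_of_int k\<bar>))" .
qed

lemma fcoeff_AE:
  assumes "f \<in> A_space r" "0 < r"
  shows "torus_ae_eq f (fseries (fcoeff f))"
  unfolding fcoeff_def[abs_def]
  by (rule fseries_fourier_AE[OF A_space_L2[OF assms(1)] decay_l1[OF A_space_decay[OF assms(1)] assms(2)]])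

text \<open>A single weighted coefficient is bounded by the norm, so convergence in the norm gives
  convergence of each coefficient. The norm itself is continuous, hence bounded on the compact set
  \<open>J\<close>, and this bound is the common decay constant.\<close>

lemma continuous_into_A_fcoeff:
  assumes v: "continuous_into_A J r v" and J: "compact J"
  shows "continuous_on J (\<lambda>t. fcoeff (v t) k)" "\<exists>m. \<forall>t\<in>J. decay m r (fcoeff (v t))"
proof -
  have A: "v t \<in> A_space r" if "t \<in> J" for t using v that by (simp add: continuous_into_A_def)
  have lim: "((\<lambda>\<tau>. A_norm r (\<lambda>x. v \<tau> x - v t x)) \<longlongrightarrow> 0) (at t within J)" if "t \<in> J" for t
    using v that by (simp add: continuous_into_A_def)
  have fd: "fourier (\<lambda>x. v \<tau> x - v t x) k = fourier (v \<tau>) k - fourier (v t) k" if "t \<in> J" "\<tau> \<in> J" for t \<tau> k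
    using that A by (intro fourier_diff A_space_L2[of _ r])
  have sd: "(\<lambda>k::int. exp (r * \<bar>real_of_int k\<bar>) * cmod (fourier (\<lambda>x. v \<tau> x - v t x) k)) summable_on UNIV"
    if "t \<in> J" "\<tau> \<in> J" for t \<tau>
  proof (rule summable_on_comparison_test[OF summable_on_add[OF A_space_summable[OF A[OF that(2)]] A_space_summable[OF A[OF that(1)]]]])
    fix k
    have "cmod (fourier (v \<tau>) k - fourier (v t) k) \<le> cmod (fourier (v \<tau>) k) + cmod (fourier (v t) k)"
      by (rule norm_triangle_ineq4)
    then show "exp (r * \<bar>real_of_int k\<bar>) * cmod (fourier (\<lambda>x. v \<tau> x - v t x) k) \<le>
       exp (r * \<bar>real_of_int k\<bar>) * cmod (fourier (v \<tau>) k) + exp (r * \<bar>real_of_int k\<bar>) * cmod (fourier (v t) k)"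
      unfolding fd[OF that] distrib_left[symmetric] by (intro mult_left_mono) auto
  qed auto
  show "continuous_on J (\<lambda>t. fcoeff (v t) k)"
    unfolding continuous_on_def
  proof
    fix t assume t: "t \<in> J"
    have "((\<lambda>\<tau>. fcoeff (v \<tau>) k - fcoeff (v t) k) \<longlongrightarrow> 0) (at t within J)"
    proof (rule Lim_null_comparison)
      show "((\<lambda>\<tau>. exp (- (r * \<bar>real_of_int k\<bar>)) * A_norm r (\<lambda>x. v \<tau> x - v t x)) \<longlongrightarrow> 0) (at t within J)"
        using tendsto_mult_right_zero[OF lim[OF t]] .
      show "\<forall>\<^sub>F \<tau> in at t within J. norm (fcoeff (v \<tau>) k - fcoeff (v t) k) \<le> exp (- (r * \<bar>real_of_int k\<bar>)) * A_norm r (\<lambda>x. v \<tau> x - v t x)"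
        unfolding eventually_at_filter
      proof (intro always_eventually allI impI)
        fix \<tau> assume \<tau>: "\<tau> \<in> J"
        have "norm (fcoeff (v \<tau>) k - fcoeff (v t) k) = cmod (fourier (\<lambda>x. v \<tau> x - v t x) k) / sqrt (2 * pi)"
          unfolding fd[OF t \<tau>] fcoeff_def diff_divide_distrib[symmetric] norm_divide by simp
        also have "\<dots> \<le> cmod (fourier (\<lambda>x. v \<tau> x - v t x) k)"
          by (rule divide_sqrt_2pi_le) simp
        also have "\<dots> \<le> exp (- (r * \<bar>real_of_int k\<bar>)) * A_norm r (\<lambda>x. v \<tau> x - v t x)"
          using A_weight_le_norm[OF sd[OF t \<tau>], of k] by (simp add: exp_minus field_simps)
        finally show "norm (fcoeff (v \<tau>) k - fcoeff (v t) k) \<le> exp (- (r * \<bar>real_of_int k\<bar>)) * A_norm r (\<lambda>x. v \<tau> x - v t x)" .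
      qed
    qed
    then show "((\<lambda>\<tau>. fcoeff (v \<tau>) k) \<longlongrightarrow> fcoeff (v t) k) (at t within J)" by (rule LIM_zero_cancel)
  qed
  have "continuous_on J (\<lambda>t. A_norm r (v t))"
    unfolding continuous_on_def
  proof
    fix t assume t: "t \<in> J"
    have "((\<lambda>\<tau>. A_norm r (v \<tau>) - A_norm r (v t)) \<longlongrightarrow> 0) (at t within J)"
    proof (rule Lim_null_comparison[OF _ lim[OF t]])
      show "\<forall>\<^sub>F \<tau> in at t within J. norm (A_norm r (v \<tau>) - A_norm r (v t)) \<le> A_norm r (\<lambda>x. v \<tau> x - v t x)"
        unfolding eventually_at_filter
      proof (intro always_eventually allI impI)
        fix \<tau> assume \<tau>: "\<tau> \<in> J"
        \<comment> \<open>Stated for both orders of \<open>t\<close> and \<open>\<tau>\<close> with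
          the same difference on the right, so that the two instances bound the absolute value of
          the difference of the norms.\<close>
        have "A_norm r (v p) \<le> A_norm r (v q) + A_norm r (\<lambda>x. v \<tau> x - v t x)" if pq: "(p, q) \<in> {(t, \<tau>), (\<tau>, t)}" for p q
        proof -
          have s: "(\<lambda>k::int. exp (r * \<bar>real_of_int k\<bar>) * cmod (fourier (v q) k)) summable_on UNIV"
            "(\<lambda>k::int. exp (r * \<bar>real_of_int k\<bar>) * cmod (fourier (v p) k)) summable_on UNIV"
            using pq t \<tau> A A_space_summable by auto
          show ?thesis
            unfolding A_norm_def infsum_add[OF s(1) sd[OF t \<tau>], symmetric]
          proof (rule infsum_mono[OF s(2) summable_on_add[OF s(1) sd[OF t \<tau>]]])
            fix k
            have "cmod (fourier (v p) k) \<le> cmod (fourier (v q) k) + cmod (fourier (v \<tau>) k - fourier (v t) k)"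
              using pq norm_triangle_sub[of "fourier (v p) k" "fourier (v q) k"] by (auto simp: norm_minus_commute)
            then show "exp (r * \<bar>real_of_int k\<bar>) * cmod (fourier (v p) k) \<le> exp (r * \<bar>real_of_int k\<bar>) * cmod (fourier (v q) k) +
               exp (r * \<bar>real_of_int k\<bar>) * cmod (fourier (\<lambda>x. v \<tau> x - v t x) k)"
              unfolding fd[OF t \<tau>] distrib_left[symmetric] by (intro mult_left_mono) auto
          qed
        qed
        from this[of t \<tau>] this[of \<tau> t] show "norm (A_norm r (v \<tau>) - A_norm r (v t)) \<le> A_norm r (\<lambda>x. v \<tau> x - v t x)" by auto
      qed
    qed
    then show "((\<lambda>\<tau>. A_norm r (v \<tau>)) \<longlongrightarrow> A_norm r (v t)) (at t within J)" by (rule LIM_zero_cancel)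
  qed
  then have "bounded ((\<lambda>t. A_norm r (v t)) ` J)" using J by (intro compact_imp_bounded compact_continuous_image)
  then obtain m where "\<And>t. t \<in> J \<Longrightarrow> A_norm r (v t) \<le> m" unfolding bounded_iff by (metis abs_le_D1 image_eqI real_norm_def)
  then show "\<exists>m. \<forall>t\<in>J. decay m r (fcoeff (v t))" using decay_mono[OF fcoeff_decay[OF A]] by blast
qed

text \<open>The weighted coefficients have a summable majorant independent of time, so dominated
  convergence upgrades continuity of the single modes to continuity in the norm, with no loss of
  radius.\<close>

lemma continuous_into_A_fseries:
  assumes c: "\<And>k. continuous_on J (\<lambda>t. a t k)" and r: "0 \<le> r"
    and le: "\<And>t k. t \<in> J \<Longrightarrow> cmod (a t k) \<le> exp (- (r * \<bar>real_of_int k\<bar>)) * B k" and B: "B summable_on UNIV"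
  shows "continuous_into_A J r (\<lambda>t. fseries (a t))"
proof -
  have le': "exp (r * \<bar>real_of_int k\<bar>) * cmod (a t k) \<le> B k" if "t \<in> J" for t k
    using le[OF that, of k] by (simp add: exp_minus field_simps)
  have l: "l1 (a t)" if t: "t \<in> J" for t
  proof (rule summable_on_comparison_test[OF B])
    fix k
    have "1 * cmod (a t k) \<le> exp (r * \<bar>real_of_int k\<bar>) * cmod (a t k)" using r by (intro mult_right_mono) auto
    then show "cmod (a t k) \<le> B k" using le'[OF t, of k] by simp
  qed auto
  have L2: "fseries (a t) \<in> L2_torus" if "t \<in> J" for t by (rule fseries_L2[OF l[OF that]])
  have F: "cmod (fourier (fseries (a t)) k) = sqrt (2 * pi) * cmod (a t k)" if "t \<in> J" for t k
    unfolding fourier_fseries[OF l[OF that]] by (simp add: norm_mult)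
  have "fseries (a t) \<in> A_space r" if t: "t \<in> J" for t
    unfolding A_space_def
  proof (intro CollectI conjI L2 t)
    show "(\<lambda>k::int. exp (r * \<bar>real_of_int k\<bar>) * cmod (fourier (fseries (a t)) k)) summable_on UNIV"
      by (rule summable_on_comparison_test[OF summable_on_cmult_right[OF B, of "sqrt (2 * pi)"]])
         (use le'[OF t] sqrt_2pi in \<open>auto simp: F[OF t] mult.left_commute intro!: mult_left_mono\<close>)
  qed
  moreover have "((\<lambda>\<tau>. A_norm r (\<lambda>x. fseries (a \<tau>) x - fseries (a t) x)) \<longlongrightarrow> 0) (at t within J)" if t: "t \<in> J" for t
  proof -
    have "((\<lambda>\<tau>. \<Sum>\<^sub>\<infinity>k::int. exp (r * \<bar>real_of_int k\<bar>) * (sqrt (2 * pi) * cmod (a \<tau> k - a t k))) \<longlongrightarrow> (\<Sum>\<^sub>\<infinity>k::int. 0)) (at t within J)"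
    proof (rule infsum_tendsto_dominated)
      show "((\<lambda>\<tau>. exp (r * \<bar>real_of_int k\<bar>) * (sqrt (2 * pi) * cmod (a \<tau> k - a t k))) \<longlongrightarrow> 0) (at t within J)" for k
      proof -
        have "((\<lambda>\<tau>. a \<tau> k) \<longlongrightarrow> a t k) (at t within J)" using c t by (simp add: continuous_on_def)
        then have "((\<lambda>\<tau>. exp (r * \<bar>real_of_int k\<bar>) * (sqrt (2 * pi) * cmod (a \<tau> k - a t k))) \<longlongrightarrow>
           exp (r * \<bar>real_of_int k\<bar>) * (sqrt (2 * pi) * cmod (a t k - a t k))) (at t within J)"
          by (intro tendsto_intros)
        then show ?thesis by simp
      qed
      show "(\<lambda>k. sqrt (2 * pi) * (B k + B k)) summable_on UNIV" by (intro summable_on_cmult_right summable_on_add B)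
      show "\<forall>\<^sub>F \<tau> in at t within J. \<forall>k. norm (exp (r * \<bar>real_of_int k\<bar>) * (sqrt (2 * pi) * cmod (a \<tau> k - a t k))) \<le> sqrt (2 * pi) * (B k + B k)"
        unfolding eventually_at_filter
      proof (intro always_eventually allI impI)
        fix \<tau> k assume \<tau>: "\<tau> \<in> J"
        have "exp (r * \<bar>real_of_int k\<bar>) * cmod (a \<tau> k - a t k) \<le> exp (r * \<bar>real_of_int k\<bar>) * (cmod (a \<tau> k) + cmod (a t k))"
          by (intro mult_left_mono norm_triangle_ineq4) auto
        also have "\<dots> \<le> B k + B k" unfolding distrib_left by (intro add_mono le' t \<tau>)
        finally have "sqrt (2 * pi) * (exp (r * \<bar>real_of_int k\<bar>) * cmod (a \<tau> k - a t k)) \<le> sqrt (2 * pi) * (B k + B k)"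
          using sqrt_2pi by (intro mult_left_mono) auto
        then show "norm (exp (r * \<bar>real_of_int k\<bar>) * (sqrt (2 * pi) * cmod (a \<tau> k - a t k))) \<le> sqrt (2 * pi) * (B k + B k)"
          by (simp add: mult_ac)
      qed
    qed
    moreover have "A_norm r (\<lambda>x. fseries (a \<tau>) x - fseries (a t) x) = (\<Sum>\<^sub>\<infinity>k::int. exp (r * \<bar>real_of_int k\<bar>) * (sqrt (2 * pi) * cmod (a \<tau> k - a t k)))"
      if \<tau>: "\<tau> \<in> J" for \<tau>
      unfolding A_norm_def fourier_diff[OF L2[OF \<tau>] L2[OF t]] fourier_fseries[OF l[OF \<tau>]] fourier_fseries[OF l[OF t]]
        right_diff_distrib[symmetric] by (simp add: norm_mult)
    then have "\<forall>\<^sub>F \<tau> in at t within J. A_norm r (\<lambda>x. fseries (a \<tau>) x - fseries (a t) x) = (\<Sum>\<^sub>\<infinity>k::int. exp (r * \<bar>real_of_int k\<bar>) * (sqrt (2 * pi) * cmod (a \<tau> k - a t k)))"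
      unfolding eventually_at_filter by (intro always_eventually) auto
    ultimately show ?thesis using tendsto_cong by fastforce
  qed
  ultimately show ?thesis unfolding continuous_into_A_def by blast
qed

section \<open>Existence, uniqueness and the lower bound for the existence time\<close>

lemma mode_curve_exists:
  assumes T: "0 < T" and r: "0 < r" and u0: "u0 \<in> A_space r"
    and small: "(\<bar>\<gamma>1\<bar> * T + (\<bar>\<gamma>2\<bar> + \<bar>\<Gamma>\<bar>) * (2 * T / r)) * (8 * (A_norm r u0 / sqrt (2 * pi))\<^sup>2) \<le> 1"
  obtains a B where "a 0 = fcoeff u0" "\<And>k. continuous_on {-T..T} (\<lambda>t. a t k)" "B summable_on UNIV"
    "\<And>t k. t \<in> {-T..T} \<Longrightarrow> cmod (a t k) \<le> exp (- (r / 2 * \<bar>real_of_int k\<bar>)) * B k"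
    "\<And>t k. t \<in> {0..<T} \<Longrightarrow> ((\<lambda>t. a t k) has_vector_derivative mode_rhs \<alpha>1 \<alpha>2 \<gamma>1 \<gamma>2 \<Gamma> (a t) k) (at t within {0..<T})"
    "\<And>t k. t \<in> {-T<..0} \<Longrightarrow> ((\<lambda>t. a t k) has_vector_derivative mode_rhs \<alpha>1 \<alpha>2 \<gamma>1 \<gamma>2 \<Gamma> (a t) k) (at t within {-T<..0})"
proof -
  interpret P: half_interval T 1 "{0..<T}" by unfold_locales (use T in auto)
  interpret N: half_interval T "- 1" "{-T<..0}" by unfold_locales (use T in auto)
  have R: "((\<lambda>k. exp (r * \<bar>real_of_int k\<bar>) * cmod (fcoeff u0 k)) has_sum A_norm r u0 / sqrt (2 * pi)) UNIV"
  proof -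
    have "((\<lambda>k. 1 / sqrt (2 * pi) * (exp (r * \<bar>real_of_int k\<bar>) * cmod (fourier u0 k))) has_sum 1 / sqrt (2 * pi) * A_norm r u0) UNIV"
      unfolding A_norm_def by (intro has_sum_cmult_right has_sum_infsum A_space_summable u0)
    moreover have "1 / sqrt (2 * pi) * (exp (r * \<bar>real_of_int k\<bar>) * cmod (fourier u0 k)) = exp (r * \<bar>real_of_int k\<bar>) * cmod (fcoeff u0 k)" for k
      by (simp add: fcoeff_def norm_divide)
    moreover have "1 / sqrt (2 * pi) * A_norm r u0 = A_norm r u0 / sqrt (2 * pi)" by simp
    ultimately show ?thesis by (simp only:)
  qed
  obtain f C where f: "f 0 = fcoeff u0" "\<And>t k. t \<in> {-T..T} \<Longrightarrow> 0 \<le> 1 * t \<Longrightarrow> cmod (f t k) \<le> exp (- (r / 2 * \<bar>real_of_int k\<bar>)) * C k"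
    "C summable_on UNIV" "\<And>k. continuous_on {t\<in>{-T..T}. 0 \<le> 1 * t} (\<lambda>t. f t k)"
    "\<And>t k. t \<in> {0..<T} \<Longrightarrow> ((\<lambda>t. f t k) has_vector_derivative mode_rhs \<alpha>1 \<alpha>2 \<gamma>1 \<gamma>2 \<Gamma> (f t) k) (at t within {0..<T})"
    by (rule P.half_mode_exists[OF r R small, of \<alpha>1 \<alpha>2]) blast
  obtain g D where g: "g 0 = fcoeff u0" "\<And>t k. t \<in> {-T..T} \<Longrightarrow> 0 \<le> - 1 * t \<Longrightarrow> cmod (g t k) \<le> exp (- (r / 2 * \<bar>real_of_int k\<bar>)) * D k"
    "D summable_on UNIV" "\<And>k. continuous_on {t\<in>{-T..T}. 0 \<le> - 1 * t} (\<lambda>t. g t k)"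
    "\<And>t k. t \<in> {-T<..0} \<Longrightarrow> ((\<lambda>t. g t k) has_vector_derivative mode_rhs \<alpha>1 \<alpha>2 \<gamma>1 \<gamma>2 \<Gamma> (g t) k) (at t within {-T<..0})"
    by (rule N.half_mode_exists[OF r R small, of \<alpha>1 \<alpha>2]) blast
  \<comment> \<open>The forward and the backward solution share their value at 0, so the glued curve
    is continuous and satisfies the one-sided equations on both half intervals.\<close>
  define a where "a t = (if 0 \<le> t then f t else g t)" for t
  have ag: "a t = g t" if "t \<le> 0" for t using that f(1) g(1) by (cases "t = 0") (auto simp: a_def)
  \<comment> \<open>Nonnegativity is read off from the bounds at time 0. It makes the sum of the two
    majorants valid on both sides.\<close>
  have C0: "0 \<le> C k" and D0: "0 \<le> D k" for k
    using order_trans[OF norm_ge_zero f(2)[of 0 k]] order_trans[OF norm_ge_zero g(2)[of 0 k]] T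
    by (auto simp: zero_le_mult_iff)
  show ?thesis
  proof (rule that[of a "\<lambda>k. C k + D k"])
    show "a 0 = fcoeff u0" by (simp add: a_def f(1))
    show "(\<lambda>k. C k + D k) summable_on UNIV" by (intro summable_on_add f(3) g(3))
    show "continuous_on {-T..T} (\<lambda>t. a t k)" for k
    proof -
      have "{t\<in>{-T..T}. 0 \<le> 1 * t} = {0..T}" "{t\<in>{-T..T}. 0 \<le> - 1 * t} = {-T..0}" using T by auto
      then have c: "continuous_on {0..T} (\<lambda>t. f t k)" "continuous_on {-T..0} (\<lambda>t. g t k)" using f(4)[of k] g(4)[of k] by simp_all
      have "continuous_on ({-T..0} \<union> {0..T}) (\<lambda>t. a t k)"
      proof (rule continuous_on_closed_Un)
        show "continuous_on {-T..0} (\<lambda>t. a t k)" by (rule continuous_on_eq[OF c(2)]) (simp add: ag)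
        show "continuous_on {0..T} (\<lambda>t. a t k)" by (rule continuous_on_eq[OF c(1)]) (simp add: a_def)
      qed auto
      moreover have "{-T..0} \<union> {0..T} = {-T..T}" using T by auto
      ultimately show ?thesis by simp
    qed
    show "cmod (a t k) \<le> exp (- (r / 2 * \<bar>real_of_int k\<bar>)) * (C k + D k)" if t: "t \<in> {-T..T}" for t k
    proof (cases "0 \<le> t")
      case True
      then have "cmod (a t k) \<le> exp (- (r / 2 * \<bar>real_of_int k\<bar>)) * C k" using f(2)[OF t] by (simp add: a_def)
      also have "\<dots> \<le> exp (- (r / 2 * \<bar>real_of_int k\<bar>)) * (C k + D k)" using D0 by (intro mult_left_mono) auto
      finally show ?thesis .
    next
      case False
      then have "cmod (a t k) \<le> exp (- (r / 2 * \<bar>real_of_int k\<bar>)) * D k" using g(2)[OF t] by (simp add: a_def)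
      also have "\<dots> \<le> exp (- (r / 2 * \<bar>real_of_int k\<bar>)) * (C k + D k)" using C0 by (intro mult_left_mono) auto
      finally show ?thesis .
    qed
    show "((\<lambda>t. a t k) has_vector_derivative mode_rhs \<alpha>1 \<alpha>2 \<gamma>1 \<gamma>2 \<Gamma> (a t) k) (at t within {0..<T})" if t: "t \<in> {0..<T}" for t k
    proof (rule has_vector_derivative_transform[OF t])
      show "((\<lambda>t. f t k) has_vector_derivative mode_rhs \<alpha>1 \<alpha>2 \<gamma>1 \<gamma>2 \<Gamma> (a t) k) (at t within {0..<T})"
        using f(5)[OF t] t by (simp add: a_def)
    qed (simp add: a_def)
    show "((\<lambda>t. a t k) has_vector_derivative mode_rhs \<alpha>1 \<alpha>2 \<gamma>1 \<gamma>2 \<Gamma> (a t) k) (at t within {-T<..0})" if t: "t \<in> {-T<..0}" for t k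
    proof (rule has_vector_derivative_transform[OF t])
      show "((\<lambda>t. g t k) has_vector_derivative mode_rhs \<alpha>1 \<alpha>2 \<gamma>1 \<gamma>2 \<Gamma> (a t) k) (at t within {-T<..0})"
        using g(5)[OF t] t by (simp add: ag)
    qed (simp add: ag)
  qed
qed

text \<open>A competitor \<open>v\<close> is identified through its coefficients: continuity in the
  analytic space gives them one decay constant on the compact interval, the weak equation gives the
  mode equations on each half, and uniqueness for modes applies. The ends \<open>T\<close> and
  \<open>- T\<close>, which the weak equation does not reach, are covered by continuity.\<close>

lemma solution_exists_unique:
  assumes T: "0 < T" and r: "0 < r" and u0: "u0 \<in> A_space r"
    and small: "(\<bar>\<gamma>1\<bar> * T + (\<bar>\<gamma>2\<bar> + \<bar>\<Gamma>\<bar>) * (2 * T / r)) * (8 * (A_norm r u0 / sqrt (2 * pi))\<^sup>2) \<le> 1"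
  shows "\<exists>u. continuous_into_A {-T..T} (r / 2) u \<and> (\<forall>s\<ge>0. solution \<alpha>1 \<alpha>2 \<gamma>1 \<gamma>2 \<Gamma> T s u0 u) \<and>
     (\<forall>v. continuous_into_A {-T..T} (r / 2) v \<and> (\<exists>s\<ge>0. solution \<alpha>1 \<alpha>2 \<gamma>1 \<gamma>2 \<Gamma> T s u0 v) \<longrightarrow>
       (\<forall>t\<in>{-T..T}. torus_ae_eq (v t) (u t)))"
proof -
  interpret P: half_interval T 1 "{0..<T}" by unfold_locales (use T in auto)
  interpret N: half_interval T "- 1" "{-T<..0}" by unfold_locales (use T in auto)
  have r2: "0 < r / 2" using r by simp
  obtain a B where a: "a 0 = fcoeff u0" "\<And>k. continuous_on {-T..T} (\<lambda>t. a t k)" "B summable_on UNIV"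
    "\<And>t k. t \<in> {-T..T} \<Longrightarrow> cmod (a t k) \<le> exp (- (r / 2 * \<bar>real_of_int k\<bar>)) * B k"
    and dP: "\<And>t k. t \<in> {0..<T} \<Longrightarrow> ((\<lambda>t. a t k) has_vector_derivative mode_rhs \<alpha>1 \<alpha>2 \<gamma>1 \<gamma>2 \<Gamma> (a t) k) (at t within {0..<T})"
    and dN: "\<And>t k. t \<in> {-T<..0} \<Longrightarrow> ((\<lambda>t. a t k) has_vector_derivative mode_rhs \<alpha>1 \<alpha>2 \<gamma>1 \<gamma>2 \<Gamma> (a t) k) (at t within {-T<..0})"
    by (rule mode_curve_exists[OF T r u0 small, of \<alpha>1 \<alpha>2]) blast
  define u where "u t = fseries (a t)" for t
  have B0: "0 \<le> B k" for k
    using order_trans[OF norm_ge_zero a(4)[of 0 k]] T by (auto simp: zero_le_mult_iff)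
  define m where "m = (\<Sum>\<^sub>\<infinity>k. B k)"
  have am: "decay m (r / 2) (a t)" if "t \<in> {-T..T}" for t
    unfolding decay_def
  proof
    fix k
    have "(\<Sum>k\<in>{k}. B k) \<le> m" unfolding m_def by (rule finite_sum_le_infsum[OF a(3)]) (use B0 in auto)
    then have "exp (- (r / 2 * \<bar>real_of_int k\<bar>)) * B k \<le> exp (- (r / 2 * \<bar>real_of_int k\<bar>)) * m" by simp
    from order_trans[OF a(4)[OF that] this] show "cmod (a t k) \<le> m * exp (- (r / 2 * \<bar>real_of_int k\<bar>))"
      by (simp only: mult.commute)
  qed
  have subP: "{0..<T} \<subseteq> {-T..T}" and subN: "{-T<..0} \<subseteq> {-T..T}" using T by auto
  have cP: "P.curve m' (r / 2) f" and cN: "N.curve m' (r / 2) f"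
    if "\<And>k. continuous_on {-T..T} (\<lambda>t. f t k)" "\<And>t. t \<in> {-T..T} \<Longrightarrow> decay m' (r / 2) (f t)" for m' f
    unfolding P.curve_def N.curve_def using that subP subN continuous_on_subset by blast+
  note u0L = A_space_L2[OF u0] and u0d = A_space_decay[OF u0] and u0e = fcoeff_AE[OF u0 r]
  have u0m: "u0 \<in> borel_measurable borel" using u0L by (simp add: L2_torus_def)
  have u0l: "l1 (fcoeff u0)" by (rule decay_l1[OF fcoeff_decay[OF u0] r])
  have "continuous_into_A {-T..T} (r / 2) u"
    unfolding u_def[abs_def] by (rule continuous_into_A_fseries[OF a(2) _ a(4,3)]) (use r in auto)
  moreover have "solution \<alpha>1 \<alpha>2 \<gamma>1 \<gamma>2 \<Gamma> T s u0 u" for s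
  proof -
    have aP: "P.curve m (r / 2) a" by (rule cP[where f = a]) (fact a(2), erule am)
    have aN: "N.curve m (r / 2) a" by (rule cN[where f = a]) (fact a(2), erule am)
    show ?thesis
      unfolding solution_def
    proof
      show "solution_on \<alpha>1 \<alpha>2 \<gamma>1 \<gamma>2 \<Gamma> {0..<T} 1 s u0 u"
        by (rule P.solution_on_of_modes[OF aP r2 _ _ u0L u0e[folded a(1)] u0d r]) (erule dP, simp only: u_def)
      show "solution_on \<alpha>1 \<alpha>2 \<gamma>1 \<gamma>2 \<Gamma> {-T<..0} (- 1) s u0 u"
        by (rule N.solution_on_of_modes[OF aN r2 _ _ u0L u0e[folded a(1)] u0d r]) (erule dN, simp only: u_def)
    qed
  qed
  moreover have "torus_ae_eq (v t) (u t)"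
    if v: "continuous_into_A {-T..T} (r / 2) v" and sol: "solution \<alpha>1 \<alpha>2 \<gamma>1 \<gamma>2 \<Gamma> T s u0 v" and t: "t \<in> {-T..T}" for v s t
  proof -
    define b where "b t = fcoeff (v t)" for t
    have vA: "v t \<in> A_space (r / 2)" if "t \<in> {-T..T}" for t using v that by (simp add: continuous_into_A_def)
    have bc: "continuous_on {-T..T} (\<lambda>t. b t k)" for k
      unfolding b_def by (rule continuous_into_A_fcoeff(1)[OF v]) simp
    obtain m1 where m1: "\<And>t. t \<in> {-T..T} \<Longrightarrow> decay m1 (r / 2) (b t)"
      using continuous_into_A_fcoeff(2)[OF v compact_Icc] unfolding b_def by blast
    have vm: "v t \<in> borel_measurable borel" and ve: "torus_ae_eq (v t) (fseries (b t))" if "t \<in> {-T..T}" for t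
      using A_space_L2[OF vA[OF that]] fcoeff_AE[OF vA[OF that] r2] by (auto simp: b_def L2_torus_def)
    have solP: "solution_on \<alpha>1 \<alpha>2 \<gamma>1 \<gamma>2 \<Gamma> {0..<T} 1 s u0 v" and solN: "solution_on \<alpha>1 \<alpha>2 \<gamma>1 \<gamma>2 \<Gamma> {-T<..0} (- 1) s u0 v"
      using sol by (simp_all add: solution_def)
    have wP: "weak_equation \<alpha>1 \<alpha>2 \<gamma>1 \<gamma>2 \<Gamma> {0..<T} 1 u0 v \<phi>" if "\<phi> \<in> test_functions {0..<T}" for \<phi>
      using solP that by (simp add: solution_on_def)
    have wN: "weak_equation \<alpha>1 \<alpha>2 \<gamma>1 \<gamma>2 \<Gamma> {-T<..0} (- 1) u0 v \<phi>" if "\<phi> \<in> test_functions {-T<..0}" for \<phi>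
      using solN that by (simp add: solution_on_def)
    have bP: "P.curve m1 (r / 2) b" by (rule cP[where f = b]) (fact bc, erule m1)
    have bN: "N.curve m1 (r / 2) b" by (rule cN[where f = b]) (fact bc, erule m1)
    have vmP: "v t \<in> borel_measurable borel" and veP: "torus_ae_eq (v t) (fseries (b t))" if "t \<in> {0..<T}" for t
      using vm[of t] ve[of t] that subP by auto
    have vmN: "v t \<in> borel_measurable borel" and veN: "torus_ae_eq (v t) (fseries (b t))" if "t \<in> {-T<..0}" for t
      using vm[of t] ve[of t] that subN by auto
    have b0: "b 0 k = fcoeff u0 k" for k
      by (rule P.weak_solution_modes(1)[OF bP r2 _ _ u0m u0e u0l]) (erule vmP, erule veP, erule wP)
    have bdP: "((\<lambda>t. b t k) has_vector_derivative mode_rhs \<alpha>1 \<alpha>2 \<gamma>1 \<gamma>2 \<Gamma> (b t) k) (at t within {0..<T})"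
      if "t \<in> {0..<T}" for t k
      by (rule P.weak_solution_modes(2)[OF bP r2 _ _ u0m u0e u0l _ that]) (erule vmP, erule veP, erule wP)
    have bdN: "((\<lambda>t. b t k) has_vector_derivative mode_rhs \<alpha>1 \<alpha>2 \<gamma>1 \<gamma>2 \<Gamma> (b t) k) (at t within {-T<..0})"
      if "t \<in> {-T<..0}" for t k
      by (rule N.weak_solution_modes(2)[OF bN r2 _ _ u0m u0e u0l _ that]) (erule vmN, erule veN, erule wN)
    have ba: "b 0 = a 0" using b0 a(1) by auto
    define M where "M = max m m1"
    have aM: "decay M (r / 2) (a t)" and bM: "decay M (r / 2) (b t)" if "t \<in> {-T..T}" for t
      using decay_mono[OF am[OF that]] decay_mono[OF m1[OF that]] by (simp_all add: M_def)
    have "b t k = a t k" for k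
    proof (cases "0 \<le> t")
      case True
      then have t0: "0 \<le> 1 * t" by simp
      show ?thesis
        by (rule P.half_mode_unique[where a = b and b = a, OF r2 _ _ _ _ _ _ ba t t0]) (fact bc, erule bM, erule bdP, fact a(2), erule aM, erule dP)
    next
      case False
      then have t0: "0 \<le> - 1 * t" by simp
      show ?thesis
        by (rule N.half_mode_unique[where a = b and b = a, OF r2 _ _ _ _ _ _ ba t t0]) (fact bc, erule bM, erule bdN, fact a(2), erule aM, erule dN)
    qed
    then have "b t = a t" by blast
    then show ?thesis using ve[OF t] by (simp add: u_def)
  qed
  ultimately show ?thesis by blast
qed

theorem proposition4p3:
  fixes \<alpha>1 \<alpha>2 \<gamma>1 \<gamma>2 \<Gamma> :: real
  shows "\<exists>c>0. \<forall>r>0. \<forall>u0\<in>A_space r. \<exists>T>0.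
    (\<not> torus_ae_eq u0 (\<lambda>x. 0) \<longrightarrow> T \<ge> c * min 1 r * (A_norm r u0) powi (-2)) \<and>
    (\<exists>u. continuous_into_A {-T..T} (r / 2) u \<and>
         (\<forall>s\<ge>0. solution \<alpha>1 \<alpha>2 \<gamma>1 \<gamma>2 \<Gamma> T s u0 u) \<and>
         (\<forall>v. continuous_into_A {-T..T} (r / 2) v \<and>
              (\<exists>s\<ge>0. solution \<alpha>1 \<alpha>2 \<gamma>1 \<gamma>2 \<Gamma> T s u0 v) \<longrightarrow>
              (\<forall>t\<in>{-T..T}. torus_ae_eq (v t) (u t))))"
proof -
  define K where "K = \<bar>\<gamma>1\<bar> + 2 * (\<bar>\<gamma>2\<bar> + \<bar>\<Gamma>\<bar>)"
  \<comment> \<open>The computation below bounds the left side of the smallness condition by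
    \<open>2 * K * c\<close>; the \<open>+ 1\<close> keeps \<open>c\<close> finite when all
    constants of the nonlinearity vanish.\<close>
  define c where "c = 1 / (2 * (K + 1))"
  have K: "0 \<le> K" by (simp add: K_def)
  then have c: "0 < c" by (simp add: c_def)
  show ?thesis
  proof (rule exI[of _ c], intro conjI c allI impI ballI)
    fix r :: real and u0 assume r: "0 < r" and u0: "u0 \<in> A_space r"
    define N where "N = A_norm r u0"
    \<comment> \<open>If the norm is zero, any \<open>T\<close> is small enough. The lower bound
      also holds then, because \<open>0 powi (-2)\<close> is 0.\<close>
    define T where "T = (if N = 0 then 1 else c * min 1 r * N powi (-2))"
    have T: "0 < T" using c r by (auto simp: T_def power_int_def)
    have lower: "T \<ge> c * min 1 r * N powi (-2)" by (simp add: T_def)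
    have small: "(\<bar>\<gamma>1\<bar> * T + (\<bar>\<gamma>2\<bar> + \<bar>\<Gamma>\<bar>) * (2 * T / r)) * (8 * (N / sqrt (2 * pi))\<^sup>2) \<le> 1"
    proof (cases "N = 0")
      case False
      define \<mu> where "\<mu> = min 1 r"
      have \<mu>: "0 < \<mu>" "\<mu> \<le> 1" "\<mu> \<le> r" using r by (auto simp: \<mu>_def)
      have TN: "T * N\<^sup>2 = c * \<mu>" using False by (simp add: T_def \<mu>_def power_int_def field_simps)
      \<comment> \<open>Both \<open>T\<close> and \<open>T / r\<close> are at most
        \<open>T / \<mu>\<close>; this is where the factor \<open>min 1 r\<close> in the lower bound
        comes from.\<close>
      have "\<bar>\<gamma>1\<bar> * T + (\<bar>\<gamma>2\<bar> + \<bar>\<Gamma>\<bar>) * (2 * T / r) \<le> \<bar>\<gamma>1\<bar> * (T / \<mu>) + (\<bar>\<gamma>2\<bar> + \<bar>\<Gamma>\<bar>) * (2 * T / \<mu>)"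
        using T \<mu> r by (intro add_mono mult_left_mono) (auto simp: field_simps)
      also have "\<dots> = K * (T / \<mu>)" by (simp add: K_def algebra_simps add_divide_distrib)
      finally have "(\<bar>\<gamma>1\<bar> * T + (\<bar>\<gamma>2\<bar> + \<bar>\<Gamma>\<bar>) * (2 * T / r)) * (8 * (N / sqrt (2 * pi))\<^sup>2) \<le> K * (T / \<mu>) * (8 * (N / sqrt (2 * pi))\<^sup>2)"
        by (intro mult_right_mono) auto
      also have "\<dots> = K * (T * N\<^sup>2) * 4 / (\<mu> * pi)" by (simp add: power_divide)
      also have "\<dots> = K * c * (4 / pi)" unfolding TN using \<mu> by simp
      also have "\<dots> \<le> K * c * 2" using K c pi_gt3 by (intro mult_left_mono) (auto simp: field_simps)
      also have "\<dots> \<le> 1" using K by (simp add: c_def field_simps)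
      finally show ?thesis .
    qed simp
    show "\<exists>T>0. (\<not> torus_ae_eq u0 (\<lambda>x. 0) \<longrightarrow> T \<ge> c * min 1 r * (A_norm r u0) powi (-2)) \<and>
      (\<exists>u. continuous_into_A {-T..T} (r / 2) u \<and>
         (\<forall>s\<ge>0. solution \<alpha>1 \<alpha>2 \<gamma>1 \<gamma>2 \<Gamma> T s u0 u) \<and>
         (\<forall>v. continuous_into_A {-T..T} (r / 2) v \<and>
              (\<exists>s\<ge>0. solution \<alpha>1 \<alpha>2 \<gamma>1 \<gamma>2 \<Gamma> T s u0 v) \<longrightarrow>
              (\<forall>t\<in>{-T..T}. torus_ae_eq (v t) (u t))))"
    proof (intro exI[of _ T] conjI impI)
      show "T \<ge> c * min 1 r * (A_norm r u0) powi (-2)" using lower unfolding N_def .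
    qed (rule T solution_exists_unique[OF T r u0 small[unfolded N_def]])+
  qed
qed

end
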